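(* Let $A=\mathcal{A}_\mu(R,\sigma,t)$ be a regular, $\mu$-consistent TGWA of rank $m$ with canonical generators $X_1^{\pm},\dots,X_m^{\pm}$, and $B=\mathcal{A}_\nu(S,\rho,h)$ a regular, $\nu$-consistent TGWA of rank $n$ with canonical generators $Y_1^{\pm},\dots,Y_n^{\pm}$. Extend the automorphisms $\sigma_j$ and $\rho_i$ trivially to $R\otimes S$ (that is, $\sigma_j$ acts as the identity on $S$ and $\rho_i$ as the identity on $R$). Let $q_{ij}\in k^\times$ for $i\in[n]$, $j\in[m]$, and set $q_{ij}^{(+,+)}=q_{ij}^{(-,-)}=q_{ij}$ and $q_{ij}^{(+,-)}=q_{ij}^{(-,+)}=q_{ij}^{-1}$. Let $\tau:B\otimes A\to A\otimes B$ be the twisting map $$\tau(sY_{\mathbf v}\otimes rX_{\mathbf u})=q_{(\mathbf v,\mathbf u)}\,rX_{\mathbf u}\otimes sY_{\mathbf v}$$ for $r\in R$, $s\in S$ and finite sequences $\mathbf u$ in $\pm[m]$, $\mathbf v$ in $\pm[n]$. For $(\alpha,\beta)\in\mathbb Z^m\times\mathbb Z^n$ let $\chi_{(\alpha,\beta)}\in\mathrm{Aut}_k(A\otimes B)$ be defined by $$\chi_{(\alpha,\beta)}(r\otimes s)=r\otimes s,\quad \chi_{(\alpha,\beta)}(X_j^{\pm}\otimes1)=X_j^{\pm}\otimes1,\quad \chi_{(\alpha,\beta)}(1\otimes Y_i^{\pm})=\prod_{j=1}^m(q_{ij}^{\pm1})^{\alpha_j}\,(1\otimes Y_i^{\pm})$$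 for all $r\in R$, $s\in S$, $j\in[m]$, $i\in[n]$, and let $\chi=\{\chi_{(\alpha,\beta)}\}$ be the resulting twisting system on the $\mathbb Z^m\times\mathbb Z^n$-graded algebra $A\otimes B$. Then ${}^{\chi}(A\otimes B)\cong A\otimes_\tau B$, with the isomorphism given by $\mathrm{id}_{A\otimes B}$.
   Context: $k$ is a field; algebras are unital $k$-algebras; $\otimes=\otimes_k$; $[n]=\{1,\dots,n\}$; $\pm[n]=\{\pm1,\dots,\pm n\}$; $Z(R)$ is the center of $R$; $\mathbf e_i$ is the $i$-th standard basis vector. A twisted generalized Weyl datum (TGWD) of rank $n$ is a triple $(R,\sigma,t)$ with $R$ an algebra, $\sigma=(\sigma_1,\dots,\sigma_n)$ commuting automorphisms of $R$, and $t=(t_1,\dots,t_n)\in Z(R)^n$. For $\mu=(\mu_{ij})\in M_n(k^\times)$, the twisted generalized Weyl construction $\mathcal{C}_\mu(R,\sigma,t)$ is the algebra generated over $R$ by $X_1^{\pm},\dots,X_n^{\pm}$ (the canonical generators) with relations $X_i^{\pm}r=\sigma_i^{\pm1}(r)X_i^{\pm}$, $X_i^-X_i^+=t_i$, $X_i^+X_i^-=\sigma_i(t_i)$ for $r\in R$, $i\in[n]$, and $X_i^+X_j^-=\mu_{ij}X_j^-X_i^+$ for $i\ne j$. It is $\mathbb Z^n$-graded by $\deg r=\mathbf 0$, $\deg X_i^{\pm}=\pm\mathbf e_i$. The twisted generalized Weyl algebra (TGWA) is $\mathcal{A}_\mu(R,\sigma,t)=\mathcal{C}_\mu(R,\sigma,t)/\mathcal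 J$, where $\mathcal J$ is the sum of all graded ideals $J$ with $J_{\mathbf 0}=\{0\}$. It is regular if every $t_i$ is a regular element (non-zero-divisor) of $R$, and $\mu$-consistent if the canonical map $R\to\mathcal{A}_\mu(R,\sigma,t)$ is injective. Notation: for $u\in\pm[m]$, $X_u=X_{|u|}^{\mathfrak s(u)}$ where $\mathfrak s(u)$ is the sign of $u$; for $\mathbf u=(u_1,\dots,u_p)\in(\pm[m])^p$, $X_{\mathbf u}=X_{u_1}\cdots X_{u_p}$; similarly $Y_{\mathbf v}$ for $\mathbf v\in(\pm[n])^\ell$. For $v\in\pm[n]$, $u\in\pm[m]$, $q_{v,u}=q_{|v|,|u|}^{(\mathfrak s(v),\mathfrak s(u))}$, and $q_{(\mathbf v,\mathbf u)}=\prod_{i,j}q_{v_i,u_j}$. $A\otimes_\tau B$ is $A\otimes B$ with multiplication $(\mu_A\otimes\mu_B)\circ(\mathrm{id}_A\otimes\tau\otimes\mathrm{id}_B)$, where $\mu_A,\mu_B$ are the multiplications of $A,B$. For a $\Gamma$-graded algebra $E$ ($\Gamma$ an abelian group) and a homomorphism $\gamma\mapsto\chi_\gamma$ from $\Gamma$ to the graded algebra automorphisms of $E$, the graded twist ${}^{\chi}E$ is $E$ as a vector space with multiplication $a\star b=\chi_\gamma(a)b$ for $a\in E$ homogeneous and $b\in E_\gamma$. Here $E=A\otimes B$ is the ordinary tensor product algebra with its $\mathbb Z^m\times\mathbb Z^n$-grading. *)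

theory Defs
  imports "HOL-Algebra.Module" "HOL-Algebra.QuotRing" "HOL-Algebra.Product_Groups"
begin

section \<open>Algebras over a field\<close>

text \<open>The library locale \<open>algebra\<close> is commutative; here multiplication need not commute.\<close>

locale k_algebra = K?: field K + module K A + A?: ring A
  for K :: "('k, 'x) ring_scheme" and A :: "('k, 'a, 'y) module_scheme" +
  assumes smult_mult_left:
      "\<lbrakk>c \<in> carrier K; x \<in> carrier A; y \<in> carrier A\<rbrakk>
        \<Longrightarrow> (c \<odot>\<^bsub>A\<^esub> x) \<otimes>\<^bsub>A\<^esub> y = c \<odot>\<^bsub>A\<^esub> (x \<otimes>\<^bsub>A\<^esub> y)"
    and smult_mult_right:
      "\<lbrakk>c \<in> carrier K; x \<in> carrier A; y \<in> carrier A\<rbrakk>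
        \<Longrightarrow> x \<otimes>\<^bsub>A\<^esub> (c \<odot>\<^bsub>A\<^esub> y) = c \<odot>\<^bsub>A\<^esub> (x \<otimes>\<^bsub>A\<^esub> y)"

definition linear_maps ::
  "('k, 'x) ring_scheme \<Rightarrow> ('k, 'a, 'y) module_scheme \<Rightarrow> ('k, 'b, 'z) module_scheme \<Rightarrow> ('a \<Rightarrow> 'b) set"
  where "linear_maps K M N = {f \<in> carrier M \<rightarrow> carrier N.
    (\<forall>x\<in>carrier M. \<forall>y\<in>carrier M. f (x \<oplus>\<^bsub>M\<^esub> y) = f x \<oplus>\<^bsub>N\<^esub> f y) \<and>
    (\<forall>c\<in>carrier K. \<forall>x\<in>carrier M. f (c \<odot>\<^bsub>M\<^esub> x) = c \<odot>\<^bsub>N\<^esub> f x)}"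

definition alg_iso ::
  "('k, 'x) ring_scheme \<Rightarrow> ('k, 'a, 'y) module_scheme \<Rightarrow> ('k, 'b, 'z) module_scheme \<Rightarrow> ('a \<Rightarrow> 'b) set"
  where "alg_iso K A B = linear_maps K A B \<inter> ring_iso A B"

definition ring_center :: "('a, 'x) ring_scheme \<Rightarrow> 'a set"
  where "ring_center R = {z \<in> carrier R. \<forall>x\<in>carrier R. z \<otimes>\<^bsub>R\<^esub> x = x \<otimes>\<^bsub>R\<^esub> z}"

definition regular_element :: "('a, 'x) ring_scheme \<Rightarrow> 'a \<Rightarrow> bool"
  where "regular_element R a \<longleftrightarrow> a \<in> carrier R \<and>
    (\<forall>x\<in>carrier R. a \<otimes>\<^bsub>R\<^esub> x = \<zero>\<^bsub>R\<^esub> \<longrightarrow> x = \<zero>\<^bsub>R\<^esub>) \<and>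
    (\<forall>x\<in>carrier R. x \<otimes>\<^bsub>R\<^esub> a = \<zero>\<^bsub>R\<^esub> \<longrightarrow> x = \<zero>\<^bsub>R\<^esub>)"

definition lin_span ::
  "('k, 'x) ring_scheme \<Rightarrow> ('k, 'a, 'y) module_scheme \<Rightarrow> 'a set \<Rightarrow> 'a set"
  where "lin_span K M S = \<Inter>{H. submodule H K M \<and> S \<subseteq> H}"

text \<open>The library quotient \<open>A Quot I\<close>, with the induced scalar multiplication.
  When \<open>A\<close> is only used as a vector space and \<open>I\<close> is a subspace, the two
  multiplicative fields are meaningless.\<close>

definition quot_algebra :: "('k, 'a, 'y) module_scheme \<Rightarrow> 'a set \<Rightarrow> ('k, 'a set) module"
  where "quot_algebra A I =
    \<lparr>carrier = carrier (A Quot I), mult = mult (A Quot I), one = one (A Quot I),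
     zero = zero (A Quot I), add = add (A Quot I),
     smult = (\<lambda>c Y. \<Union>y\<in>Y. I +>\<^bsub>A\<^esub> (c \<odot>\<^bsub>A\<^esub> y))\<rparr>"


section \<open>Free modules and free algebras\<close>

text \<open>Finitely supported functions on \<open>X\<close>, extended by zero outside \<open>X\<close>.
  This is only a vector space, so the multiplicative fields are left unspecified.\<close>

definition free_module :: "('k, 'x) ring_scheme \<Rightarrow> 'b set \<Rightarrow> ('k, 'b \<Rightarrow> 'k) module"
  where "free_module K X =
    \<lparr>carrier = {f. (\<forall>x\<in>X. f x \<in> carrier K) \<and> (\<forall>x. x \<notin> X \<longrightarrow> f x = \<zero>\<^bsub>K\<^esub>) \<and>
                 finite {x. f x \<noteq> \<zero>\<^bsub>K\<^esub>}},
     mult = undefined, one = undefined,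
     zero = (\<lambda>_. \<zero>\<^bsub>K\<^esub>), add = (\<lambda>f g x. f x \<oplus>\<^bsub>K\<^esub> g x),
     smult = (\<lambda>c f x. c \<otimes>\<^bsub>K\<^esub> f x)\<rparr>"

definition single :: "('k, 'x) ring_scheme \<Rightarrow> 'b \<Rightarrow> 'b \<Rightarrow> 'k"
  where "single K x = (\<lambda>y. if y = x then \<one>\<^bsub>K\<^esub> else \<zero>\<^bsub>K\<^esub>)"

text \<open>Words in \<open>G\<close> form the basis; multiplication extends concatenation bilinearly.\<close>

definition free_algebra :: "('k, 'x) ring_scheme \<Rightarrow> 'g set \<Rightarrow> ('k, 'g list \<Rightarrow> 'k) module"
  where "free_algebra K G = (free_module K (lists G))
    \<lparr>mult := (\<lambda>f g w. \<Oplus>\<^bsub>K\<^esub>i\<in>{..length w}. f (take i w) \<otimes>\<^bsub>K\<^esub> g (drop i w)),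
     one := single K []\<rparr>"


section \<open>Gradings and graded twists\<close>

definition int_lattice :: "nat \<Rightarrow> (nat \<Rightarrow> int) monoid"
  where "int_lattice n = product_group {1..n} (\<lambda>_. integer_group)"

text \<open>A grading is a family \<open>gr\<close> of subspaces indexed by \<open>carrier \<Gamma>\<close>; the group operation of
  \<open>\<Gamma>\<close> is written multiplicatively.\<close>

definition graded_ideal ::
  "('g, 'w) monoid_scheme \<Rightarrow> ('k, 'a, 'y) module_scheme \<Rightarrow> ('g \<Rightarrow> 'a set) \<Rightarrow> 'a set \<Rightarrow> bool"
  where "graded_ideal \<Gamma> E gr J \<longleftrightarrow> ideal J E \<and>
    J = generate (add_monoid E) (\<Union>\<gamma>\<in>carrier \<Gamma>. J \<inter> gr \<gamma>)"

definition homogeneous_components ::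
  "('g, 'w) monoid_scheme \<Rightarrow> ('k, 'a, 'y) module_scheme \<Rightarrow> ('g \<Rightarrow> 'a set) \<Rightarrow> 'a \<Rightarrow> 'g \<Rightarrow> 'a"
  where "homogeneous_components \<Gamma> E gr b =
    (THE d. d \<in> (\<Pi>\<^sub>E \<gamma>\<in>carrier \<Gamma>. gr \<gamma>) \<and> finite {\<gamma> \<in> carrier \<Gamma>. d \<gamma> \<noteq> \<zero>\<^bsub>E\<^esub>} \<and>
       b = (\<Oplus>\<^bsub>E\<^esub>\<gamma>\<in>{\<gamma> \<in> carrier \<Gamma>. d \<gamma> \<noteq> \<zero>\<^bsub>E\<^esub>}. d \<gamma>))"

text \<open>A homomorphism from \<open>\<Gamma>\<close> to the group of graded algebra automorphisms of \<open>E\<close>.  Equality of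
  automorphisms is equality on the carrier.\<close>

definition twisting_system ::
  "('k, 'x) ring_scheme \<Rightarrow> ('g, 'w) monoid_scheme \<Rightarrow> ('k, 'a, 'y) module_scheme
    \<Rightarrow> ('g \<Rightarrow> 'a set) \<Rightarrow> ('g \<Rightarrow> 'a \<Rightarrow> 'a) \<Rightarrow> bool"
  where "twisting_system K \<Gamma> E gr chi \<longleftrightarrow>
    (\<forall>\<gamma>\<in>carrier \<Gamma>. chi \<gamma> \<in> alg_iso K E E \<and> (\<forall>\<delta>\<in>carrier \<Gamma>. chi \<gamma> ` gr \<delta> = gr \<delta>)) \<and>
    (\<forall>\<gamma>\<in>carrier \<Gamma>. \<forall>\<delta>\<in>carrier \<Gamma>. \<forall>x\<in>carrier E. chi (\<gamma> \<otimes>\<^bsub>\<Gamma>\<^esub> \<delta>) x = chi \<gamma> (chi \<delta> x))"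

text \<open>The rule \<open>a \<star> b = \<chi>\<^sub>\<gamma>(a) b\<close> for \<open>b\<close> of degree \<open>\<gamma>\<close>, extended linearly in \<open>b\<close>
  (it is already linear in \<open>a\<close>).\<close>

definition graded_twist ::
  "('g, 'w) monoid_scheme \<Rightarrow> ('k, 'a) module \<Rightarrow> ('g \<Rightarrow> 'a set) \<Rightarrow> ('g \<Rightarrow> 'a \<Rightarrow> 'a) \<Rightarrow> ('k, 'a) module"
  where "graded_twist \<Gamma> E gr chi = E
    \<lparr>mult := (\<lambda>a b. let d = homogeneous_components \<Gamma> E gr b in
       \<Oplus>\<^bsub>E\<^esub>\<gamma>\<in>{\<gamma> \<in> carrier \<Gamma>. d \<gamma> \<noteq> \<zero>\<^bsub>E\<^esub>}. chi \<gamma> a \<otimes>\<^bsub>E\<^esub> d \<gamma>)\<rparr>"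


section \<open>Tensor products\<close>

definition tensor_relations ::
  "('k, 'x) ring_scheme \<Rightarrow> ('k, 'a, 'y) module_scheme \<Rightarrow> ('k, 'b, 'z) module_scheme
    \<Rightarrow> ('a \<times> 'b \<Rightarrow> 'k) set"
  where "tensor_relations K A B = (let F = free_module K (carrier A \<times> carrier B) in
    {single K (a \<oplus>\<^bsub>A\<^esub> a', b) \<ominus>\<^bsub>F\<^esub> (single K (a, b) \<oplus>\<^bsub>F\<^esub> single K (a', b)) | a a' b.
       a \<in> carrier A \<and> a' \<in> carrier A \<and> b \<in> carrier B} \<union>
    {single K (a, b \<oplus>\<^bsub>B\<^esub> b') \<ominus>\<^bsub>F\<^esub> (single K (a, b) \<oplus>\<^bsub>F\<^esub> single K (a, b')) | a b b'.
       a \<in> carrier A \<and> b \<in> carrier B \<and> b' \<in> carrier B} \<union>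
    {single K (c \<odot>\<^bsub>A\<^esub> a, b) \<ominus>\<^bsub>F\<^esub> (c \<odot>\<^bsub>F\<^esub> single K (a, b)) | c a b.
       c \<in> carrier K \<and> a \<in> carrier A \<and> b \<in> carrier B} \<union>
    {single K (a, c \<odot>\<^bsub>B\<^esub> b) \<ominus>\<^bsub>F\<^esub> (c \<odot>\<^bsub>F\<^esub> single K (a, b)) | c a b.
       c \<in> carrier K \<and> a \<in> carrier A \<and> b \<in> carrier B})"

definition tensor_kernel ::
  "('k, 'x) ring_scheme \<Rightarrow> ('k, 'a, 'y) module_scheme \<Rightarrow> ('k, 'b, 'z) module_scheme
    \<Rightarrow> ('a \<times> 'b \<Rightarrow> 'k) set"
  where "tensor_kernel K A B =
    lin_span K (free_module K (carrier A \<times> carrier B)) (tensor_relations K A B)"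

definition tensor_space ::
  "('k, 'x) ring_scheme \<Rightarrow> ('k, 'a, 'y) module_scheme \<Rightarrow> ('k, 'b, 'z) module_scheme
    \<Rightarrow> ('k, ('a \<times> 'b \<Rightarrow> 'k) set) module"
  where "tensor_space K A B =
    quot_algebra (free_module K (carrier A \<times> carrier B)) (tensor_kernel K A B)"

definition pure_tensor ::
  "('k, 'x) ring_scheme \<Rightarrow> ('k, 'a, 'y) module_scheme \<Rightarrow> ('k, 'b, 'z) module_scheme
    \<Rightarrow> 'a \<Rightarrow> 'b \<Rightarrow> ('a \<times> 'b \<Rightarrow> 'k) set"
  where "pure_tensor K A B a b =
    tensor_kernel K A B +>\<^bsub>free_module K (carrier A \<times> carrier B)\<^esub> single K (a, b)"

text \<open>The linear map on \<open>A \<otimes> B\<close> induced by a bilinear map \<open>f\<close> into \<open>P\<close>: the common value of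
  \<open>\<Sum> r (a, b) f (a, b)\<close> over all representatives \<open>r\<close> of a class.\<close>

definition tensor_lift ::
  "('k, 'x) ring_scheme \<Rightarrow> ('k, 'p, 'y) module_scheme \<Rightarrow> ('a \<times> 'b \<Rightarrow> 'p)
    \<Rightarrow> ('a \<times> 'b \<Rightarrow> 'k) set \<Rightarrow> 'p"
  where "tensor_lift K P f x =
    the_elem ((\<lambda>r. \<Oplus>\<^bsub>P\<^esub>p\<in>{p. r p \<noteq> \<zero>\<^bsub>K\<^esub>}. r p \<odot>\<^bsub>P\<^esub> f p) ` x)"

definition tensor_map ::
  "('k, 'x) ring_scheme \<Rightarrow> ('k, 'c, 'y) module_scheme \<Rightarrow> ('k, 'd, 'z) module_scheme
    \<Rightarrow> ('a \<Rightarrow> 'c) \<Rightarrow> ('b \<Rightarrow> 'd) \<Rightarrow> ('a \<times> 'b \<Rightarrow> 'k) set \<Rightarrow> ('c \<times> 'd \<Rightarrow> 'k) set"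
  where "tensor_map K C D f g =
    tensor_lift K (tensor_space K C D) (\<lambda>(a, b). pure_tensor K C D (f a) (g b))"

definition tensor_algebra ::
  "('k, 'x) ring_scheme \<Rightarrow> ('k, 'a, 'y) module_scheme \<Rightarrow> ('k, 'b, 'z) module_scheme
    \<Rightarrow> ('k, ('a \<times> 'b \<Rightarrow> 'k) set) module"
  where "tensor_algebra K A B = (tensor_space K A B)
    \<lparr>mult := (\<lambda>x y.
       tensor_lift K (tensor_space K A B) (\<lambda>(a, b).
         tensor_lift K (tensor_space K A B) (\<lambda>(a', b').
           pure_tensor K A B (a \<otimes>\<^bsub>A\<^esub> a') (b \<otimes>\<^bsub>B\<^esub> b')) y) x),
     one := pure_tensor K A B \<one>\<^bsub>A\<^esub> \<one>\<^bsub>B\<^esub>\<rparr>"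

text \<open>On \<open>(a \<otimes> b) \<otimes> (a' \<otimes> b')\<close> the map \<open>(\<mu>\<^sub>A \<otimes> \<mu>\<^sub>B) \<circ> (id \<otimes> \<tau> \<otimes> id)\<close> takes the value
  \<open>\<Sum> a c \<otimes> d b'\<close>, where \<open>\<tau> (b \<otimes> a') = \<Sum> c \<otimes> d\<close>.\<close>

definition twisted_tensor_algebra ::
  "('k, 'x) ring_scheme \<Rightarrow> ('k, 'a, 'y) module_scheme \<Rightarrow> ('k, 'b, 'z) module_scheme
    \<Rightarrow> (('b \<times> 'a \<Rightarrow> 'k) set \<Rightarrow> ('a \<times> 'b \<Rightarrow> 'k) set) \<Rightarrow> ('k, ('a \<times> 'b \<Rightarrow> 'k) set) module"
  where "twisted_tensor_algebra K A B tau = (tensor_space K A B)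
    \<lparr>mult := (\<lambda>x y.
       tensor_lift K (tensor_space K A B) (\<lambda>(a, b).
         tensor_lift K (tensor_space K A B) (\<lambda>(a', b').
           tensor_map K A B (\<lambda>c. a \<otimes>\<^bsub>A\<^esub> c) (\<lambda>d. d \<otimes>\<^bsub>B\<^esub> b') (tau (pure_tensor K B A b a'))) y) x),
     one := pure_tensor K A B \<one>\<^bsub>A\<^esub> \<one>\<^bsub>B\<^esub>\<rparr>"

definition tensor_grading ::
  "('k, 'x) ring_scheme \<Rightarrow> ('k, 'a, 'y) module_scheme \<Rightarrow> ('k, 'b, 'z) module_scheme
    \<Rightarrow> ('g \<Rightarrow> 'a set) \<Rightarrow> ('h \<Rightarrow> 'b set) \<Rightarrow> 'g \<times> 'h \<Rightarrow> ('a \<times> 'b \<Rightarrow> 'k) set set"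
  where "tensor_grading K A B grA grB = (\<lambda>(\<alpha>, \<beta>).
    lin_span K (tensor_space K A B) {pure_tensor K A B a b | a b. a \<in> grA \<alpha> \<and> b \<in> grB \<beta>})"


section \<open>Twisted generalized Weyl algebras\<close>

text \<open>A datum \<open>(R, \<sigma>, t)\<close> of rank \<open>n\<close> together with the parameter matrix \<open>\<mu>\<close>.  Indices run over
  \<open>{1..n}\<close>; values at other indices and the diagonal of \<open>\<mu>\<close> are never used.\<close>

record ('k, 'r) tgw_data =
  tgw_base :: "('k, 'r) module"
  tgw_rank :: nat
  tgw_sigma :: "nat \<Rightarrow> 'r \<Rightarrow> 'r"
  tgw_t :: "nat \<Rightarrow> 'r"
  tgw_mu :: "nat \<Rightarrow> nat \<Rightarrow> 'k"

locale tgw_datum = k_algebra K "tgw_base D"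
  for K :: "('k, 'x) ring_scheme" and D :: "('k, 'r) tgw_data" +
  assumes sigma_aut: "i \<in> {1..tgw_rank D} \<Longrightarrow> tgw_sigma D i \<in> alg_iso K (tgw_base D) (tgw_base D)"
    and sigma_commute: "\<lbrakk>i \<in> {1..tgw_rank D}; j \<in> {1..tgw_rank D}; r \<in> carrier (tgw_base D)\<rbrakk>
      \<Longrightarrow> tgw_sigma D i (tgw_sigma D j r) = tgw_sigma D j (tgw_sigma D i r)"
    and t_central: "i \<in> {1..tgw_rank D} \<Longrightarrow> tgw_t D i \<in> ring_center (tgw_base D)"
    and mu_units: "\<lbrakk>i \<in> {1..tgw_rank D}; j \<in> {1..tgw_rank D}\<rbrakk> \<Longrightarrow> tgw_mu D i j \<in> Units K"

datatype 'r tgw_gen = Coeff 'r | XPos nat | XNeg nat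

definition tgw_gens :: "('k, 'r) tgw_data \<Rightarrow> 'r tgw_gen set"
  where "tgw_gens D = Coeff ` carrier (tgw_base D) \<union> XPos ` {1..tgw_rank D} \<union> XNeg ` {1..tgw_rank D}"

definition tgw_free :: "('k, 'x) ring_scheme \<Rightarrow> ('k, 'r) tgw_data \<Rightarrow> ('k, 'r tgw_gen list \<Rightarrow> 'k) module"
  where "tgw_free K D = free_algebra K (tgw_gens D)"

text \<open>The first four rules make \<open>r \<mapsto> [Coeff r]\<close> a unital algebra homomorphism from the base
  algebra, so that the quotient is the algebra generated over the base by the \<open>X\<^sub>i\<^sup>\<plusminus>\<close>.\<close>

inductive_set tgw_relations ::
  "('k, 'x) ring_scheme \<Rightarrow> ('k, 'r) tgw_data \<Rightarrow> ('r tgw_gen list \<Rightarrow> 'k) set"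
  for K :: "('k, 'x) ring_scheme" and D :: "('k, 'r) tgw_data"
  where
    coeff_add: "\<lbrakk>r \<in> carrier (tgw_base D); s \<in> carrier (tgw_base D)\<rbrakk> \<Longrightarrow>
      single K [Coeff (r \<oplus>\<^bsub>tgw_base D\<^esub> s)]
        \<ominus>\<^bsub>tgw_free K D\<^esub> (single K [Coeff r] \<oplus>\<^bsub>tgw_free K D\<^esub> single K [Coeff s]) \<in> tgw_relations K D"
  | coeff_smult: "\<lbrakk>c \<in> carrier K; r \<in> carrier (tgw_base D)\<rbrakk> \<Longrightarrow>
      single K [Coeff (c \<odot>\<^bsub>tgw_base D\<^esub> r)]
        \<ominus>\<^bsub>tgw_free K D\<^esub> (c \<odot>\<^bsub>tgw_free K D\<^esub> single K [Coeff r]) \<in> tgw_relations K D"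
  | coeff_mult: "\<lbrakk>r \<in> carrier (tgw_base D); s \<in> carrier (tgw_base D)\<rbrakk> \<Longrightarrow>
      single K [Coeff (r \<otimes>\<^bsub>tgw_base D\<^esub> s)]
        \<ominus>\<^bsub>tgw_free K D\<^esub> single K [Coeff r, Coeff s] \<in> tgw_relations K D"
  | coeff_one:
      "single K [Coeff \<one>\<^bsub>tgw_base D\<^esub>] \<ominus>\<^bsub>tgw_free K D\<^esub> single K [] \<in> tgw_relations K D"
  | X_pos_coeff: "\<lbrakk>i \<in> {1..tgw_rank D}; r \<in> carrier (tgw_base D)\<rbrakk> \<Longrightarrow>
      single K [XPos i, Coeff r]
        \<ominus>\<^bsub>tgw_free K D\<^esub> single K [Coeff (tgw_sigma D i r), XPos i] \<in> tgw_relations K D"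
  | X_neg_coeff: "\<lbrakk>i \<in> {1..tgw_rank D}; r \<in> carrier (tgw_base D)\<rbrakk> \<Longrightarrow>
      single K [XNeg i, Coeff r]
        \<ominus>\<^bsub>tgw_free K D\<^esub> single K [Coeff (inv_into (carrier (tgw_base D)) (tgw_sigma D i) r), XNeg i]
        \<in> tgw_relations K D"
  | X_neg_pos: "i \<in> {1..tgw_rank D} \<Longrightarrow>
      single K [XNeg i, XPos i] \<ominus>\<^bsub>tgw_free K D\<^esub> single K [Coeff (tgw_t D i)] \<in> tgw_relations K D"
  | X_pos_neg: "i \<in> {1..tgw_rank D} \<Longrightarrow>
      single K [XPos i, XNeg i]
        \<ominus>\<^bsub>tgw_free K D\<^esub> single K [Coeff (tgw_sigma D i (tgw_t D i))] \<in> tgw_relations K D"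
  | X_mixed: "\<lbrakk>i \<in> {1..tgw_rank D}; j \<in> {1..tgw_rank D}; i \<noteq> j\<rbrakk> \<Longrightarrow>
      single K [XPos i, XNeg j]
        \<ominus>\<^bsub>tgw_free K D\<^esub> (tgw_mu D i j \<odot>\<^bsub>tgw_free K D\<^esub> single K [XNeg j, XPos i]) \<in> tgw_relations K D"

definition tgw_ideal :: "('k, 'x) ring_scheme \<Rightarrow> ('k, 'r) tgw_data \<Rightarrow> ('r tgw_gen list \<Rightarrow> 'k) set"
  where "tgw_ideal K D = Idl\<^bsub>tgw_free K D\<^esub> (tgw_relations K D)"

definition tgwc :: "('k, 'x) ring_scheme \<Rightarrow> ('k, 'r) tgw_data
    \<Rightarrow> ('k, ('r tgw_gen list \<Rightarrow> 'k) set) module"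
  where "tgwc K D = quot_algebra (tgw_free K D) (tgw_ideal K D)"

fun gen_degree :: "'r tgw_gen \<Rightarrow> nat \<Rightarrow> int"
  where
    "gen_degree (Coeff r) l = 0"
  | "gen_degree (XPos i) l = (if l = i then 1 else 0)"
  | "gen_degree (XNeg i) l = (if l = i then - 1 else 0)"

definition word_degree :: "nat \<Rightarrow> 'r tgw_gen list \<Rightarrow> nat \<Rightarrow> int"
  where "word_degree n w = (\<lambda>l\<in>{1..n}. \<Sum>g\<leftarrow>w. gen_degree g l)"

definition tgwc_grading :: "('k, 'x) ring_scheme \<Rightarrow> ('k, 'r) tgw_data
    \<Rightarrow> (nat \<Rightarrow> int) \<Rightarrow> ('r tgw_gen list \<Rightarrow> 'k) set set"
  where "tgwc_grading K D \<alpha> = (\<lambda>f. tgw_ideal K D +>\<^bsub>tgw_free K D\<^esub> f) `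
    {f \<in> carrier (tgw_free K D). \<forall>w. f w \<noteq> \<zero>\<^bsub>K\<^esub> \<longrightarrow> word_degree (tgw_rank D) w = \<alpha>}"

text \<open>The sum of a family of ideals is the additive subgroup generated by their union.\<close>

definition tgw_radical :: "('k, 'x) ring_scheme \<Rightarrow> ('k, 'r) tgw_data
    \<Rightarrow> ('r tgw_gen list \<Rightarrow> 'k) set set"
  where "tgw_radical K D = generate (add_monoid (tgwc K D))
    (\<Union>{J. graded_ideal (int_lattice (tgw_rank D)) (tgwc K D) (tgwc_grading K D) J \<and>
          J \<inter> tgwc_grading K D \<one>\<^bsub>int_lattice (tgw_rank D)\<^esub> = {\<zero>\<^bsub>tgwc K D\<^esub>}})"

definition tgwa :: "('k, 'x) ring_scheme \<Rightarrow> ('k, 'r) tgw_data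
    \<Rightarrow> ('k, ('r tgw_gen list \<Rightarrow> 'k) set set) module"
  where "tgwa K D = quot_algebra (tgwc K D) (tgw_radical K D)"

definition tgwa_grading :: "('k, 'x) ring_scheme \<Rightarrow> ('k, 'r) tgw_data
    \<Rightarrow> (nat \<Rightarrow> int) \<Rightarrow> ('r tgw_gen list \<Rightarrow> 'k) set set set"
  where "tgwa_grading K D \<alpha> = (\<lambda>x. tgw_radical K D +>\<^bsub>tgwc K D\<^esub> x) ` tgwc_grading K D \<alpha>"

definition tgwa_class :: "('k, 'x) ring_scheme \<Rightarrow> ('k, 'r) tgw_data
    \<Rightarrow> ('r tgw_gen list \<Rightarrow> 'k) \<Rightarrow> ('r tgw_gen list \<Rightarrow> 'k) set set"
  where "tgwa_class K D f =
    tgw_radical K D +>\<^bsub>tgwc K D\<^esub> (tgw_ideal K D +>\<^bsub>tgw_free K D\<^esub> f)"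

definition tgwa_coeff :: "('k, 'x) ring_scheme \<Rightarrow> ('k, 'r) tgw_data
    \<Rightarrow> 'r \<Rightarrow> ('r tgw_gen list \<Rightarrow> 'k) set set"
  where "tgwa_coeff K D r = tgwa_class K D (single K [Coeff r])"

definition signed_indices :: "nat \<Rightarrow> int set"
  where "signed_indices n = {- int n..int n} - {0}"

text \<open>\<open>X\<^sub>u\<close> for \<open>u\<close> in \<open>signed_indices n\<close>: the sign of \<open>u\<close> selects \<open>X\<^sup>+\<close> or \<open>X\<^sup>-\<close>.\<close>

definition tgwa_X :: "('k, 'x) ring_scheme \<Rightarrow> ('k, 'r) tgw_data
    \<Rightarrow> int \<Rightarrow> ('r tgw_gen list \<Rightarrow> 'k) set set"
  where "tgwa_X K D u =
    tgwa_class K D (single K [if u > 0 then XPos (nat \<bar>u\<bar>) else XNeg (nat \<bar>u\<bar>)])"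

definition tgwa_X_word :: "('k, 'x) ring_scheme \<Rightarrow> ('k, 'r) tgw_data
    \<Rightarrow> int list \<Rightarrow> ('r tgw_gen list \<Rightarrow> 'k) set set"
  where "tgwa_X_word K D us = foldr (\<lambda>u x. tgwa_X K D u \<otimes>\<^bsub>tgwa K D\<^esub> x) us \<one>\<^bsub>tgwa K D\<^esub>"

definition tgw_regular :: "('k, 'r) tgw_data \<Rightarrow> bool"
  where "tgw_regular D \<longleftrightarrow> (\<forall>i\<in>{1..tgw_rank D}. regular_element (tgw_base D) (tgw_t D i))"

definition tgw_consistent :: "('k, 'x) ring_scheme \<Rightarrow> ('k, 'r) tgw_data \<Rightarrow> bool"
  where "tgw_consistent K D \<longleftrightarrow> inj_on (tgwa_coeff K D) (carrier (tgw_base D))"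


section \<open>The twisting map and the twisting system\<close>

text \<open>\<open>q_signed K q v u\<close> is \<open>q\<^sub>v\<^sub>,\<^sub>u\<close> for signed indices: \<open>q\<close> at the absolute values, inverted if the
  signs differ.\<close>

definition q_signed :: "('k, 'x) ring_scheme \<Rightarrow> (nat \<Rightarrow> nat \<Rightarrow> 'k) \<Rightarrow> int \<Rightarrow> int \<Rightarrow> 'k"
  where "q_signed K q v u =
    (if sgn v = sgn u then q (nat \<bar>v\<bar>) (nat \<bar>u\<bar>) else inv\<^bsub>K\<^esub> (q (nat \<bar>v\<bar>) (nat \<bar>u\<bar>)))"

definition q_words :: "('k, 'x) ring_scheme \<Rightarrow> (nat \<Rightarrow> nat \<Rightarrow> 'k) \<Rightarrow> int list \<Rightarrow> int list \<Rightarrow> 'k"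
  where "q_words K q vs us =
    (\<Otimes>\<^bsub>K\<^esub>i\<in>{..<length vs}. \<Otimes>\<^bsub>K\<^esub>j\<in>{..<length us}. q_signed K q (vs ! i) (us ! j))"

definition is_tgwa_twisting_map ::
  "('k, 'x) ring_scheme \<Rightarrow> ('k, 'r) tgw_data \<Rightarrow> ('k, 's) tgw_data \<Rightarrow> (nat \<Rightarrow> nat \<Rightarrow> 'k)
    \<Rightarrow> ((('s tgw_gen list \<Rightarrow> 'k) set set \<times> ('r tgw_gen list \<Rightarrow> 'k) set set \<Rightarrow> 'k) set
       \<Rightarrow> (('r tgw_gen list \<Rightarrow> 'k) set set \<times> ('s tgw_gen list \<Rightarrow> 'k) set set \<Rightarrow> 'k) set) \<Rightarrow> bool"
  where "is_tgwa_twisting_map K D D' q tau \<longleftrightarrow> (let A = tgwa K D; B = tgwa K D' in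
    tau \<in> linear_maps K (tensor_space K B A) (tensor_space K A B) \<and>
    (\<forall>r\<in>carrier (tgw_base D). \<forall>s\<in>carrier (tgw_base D').
     \<forall>us\<in>lists (signed_indices (tgw_rank D)). \<forall>vs\<in>lists (signed_indices (tgw_rank D')).
       tau (pure_tensor K B A (tgwa_coeff K D' s \<otimes>\<^bsub>B\<^esub> tgwa_X_word K D' vs)
                              (tgwa_coeff K D r \<otimes>\<^bsub>A\<^esub> tgwa_X_word K D us)) =
       q_words K q vs us \<odot>\<^bsub>tensor_space K A B\<^esub>
         pure_tensor K A B (tgwa_coeff K D r \<otimes>\<^bsub>A\<^esub> tgwa_X_word K D us)
                           (tgwa_coeff K D' s \<otimes>\<^bsub>B\<^esub> tgwa_X_word K D' vs)))"

definition is_tgwa_chi ::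
  "('k, 'x) ring_scheme \<Rightarrow> ('k, 'r) tgw_data \<Rightarrow> ('k, 's) tgw_data \<Rightarrow> (nat \<Rightarrow> nat \<Rightarrow> 'k)
    \<Rightarrow> ((nat \<Rightarrow> int) \<times> (nat \<Rightarrow> int)
       \<Rightarrow> (('r tgw_gen list \<Rightarrow> 'k) set set \<times> ('s tgw_gen list \<Rightarrow> 'k) set set \<Rightarrow> 'k) set
       \<Rightarrow> (('r tgw_gen list \<Rightarrow> 'k) set set \<times> ('s tgw_gen list \<Rightarrow> 'k) set set \<Rightarrow> 'k) set) \<Rightarrow> bool"
  where "is_tgwa_chi K D D' q chi \<longleftrightarrow>
    (let A = tgwa K D; B = tgwa K D'; E = tensor_algebra K A B in
    \<forall>\<alpha>\<in>carrier (int_lattice (tgw_rank D)). \<forall>\<beta>\<in>carrier (int_lattice (tgw_rank D')).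
      chi (\<alpha>, \<beta>) \<in> alg_iso K E E \<and>
      (\<forall>r\<in>carrier (tgw_base D). \<forall>s\<in>carrier (tgw_base D').
         chi (\<alpha>, \<beta>) (pure_tensor K A B (tgwa_coeff K D r) (tgwa_coeff K D' s)) =
           pure_tensor K A B (tgwa_coeff K D r) (tgwa_coeff K D' s)) \<and>
      (\<forall>u\<in>signed_indices (tgw_rank D).
         chi (\<alpha>, \<beta>) (pure_tensor K A B (tgwa_X K D u) \<one>\<^bsub>B\<^esub>) =
           pure_tensor K A B (tgwa_X K D u) \<one>\<^bsub>B\<^esub>) \<and>
      (\<forall>i\<in>{1..tgw_rank D'}.
         chi (\<alpha>, \<beta>) (pure_tensor K A B \<one>\<^bsub>A\<^esub> (tgwa_X K D' (int i))) =
           (\<Otimes>\<^bsub>K\<^esub>j\<in>{1..tgw_rank D}. q i j [^]\<^bsub>K\<^esub> \<alpha> j) \<odot>\<^bsub>E\<^esub>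
             pure_tensor K A B \<one>\<^bsub>A\<^esub> (tgwa_X K D' (int i)) \<and>
         chi (\<alpha>, \<beta>) (pure_tensor K A B \<one>\<^bsub>A\<^esub> (tgwa_X K D' (- int i))) =
           (\<Otimes>\<^bsub>K\<^esub>j\<in>{1..tgw_rank D}. (inv\<^bsub>K\<^esub> (q i j)) [^]\<^bsub>K\<^esub> \<alpha> j) \<odot>\<^bsub>E\<^esub>
             pure_tensor K A B \<one>\<^bsub>A\<^esub> (tgwa_X K D' (- int i))))"

end

theory Submission
  imports Defs
begin

text \<open>Write \<open>A\<close> and \<open>B\<close> for the two twisted generalized Weyl algebras, graded by \<open>\<int>\<^sup>m\<close> and \<open>\<int>\<^sup>n\<close>,
  and put \<open>Q(\<beta>, \<alpha>) = \<Prod> q\<^sub>i\<^sub>j\<^bsup>\<beta>\<^sub>i \<alpha>\<^sub>j\<^esup>\<close>, a bicharacter of the two lattices.  Both algebras in the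
  theorem live on the vector space \<open>A \<otimes> B\<close>, and both multiplications distort the ordinary one by
  \<open>Q\<close>.

  Indeed, the scalar in the formula for \<open>\<tau>\<close> depends on the degrees of the two words only, so that
  \<open>\<tau>(b \<otimes> a) = Q(\<beta>, \<alpha>) a \<otimes> b\<close> for \<open>a\<close> and \<open>b\<close> homogeneous of degrees \<open>\<alpha>\<close> and \<open>\<beta>\<close>
  (\<open>q_words_eq_lattice_pairing\<close>).  Likewise \<open>\<chi>\<close> of degree \<open>(\<alpha>, \<beta>)\<close> multiplies the component of
  degree \<open>(\<alpha>', \<beta>')\<close> by \<open>Q(\<beta>', \<alpha>)\<close>.  Hence in either algebra the product of homogeneous tensors
  \<open>a \<otimes> b\<close> and \<open>a' \<otimes> b'\<close> is \<open>Q(\<beta>, \<alpha>') a a' \<otimes> b b'\<close>, where \<open>\<beta>\<close> is the degree of \<open>b\<close> and \<open>\<alpha>'\<close>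
  that of \<open>a'\<close>.  Such tensors span, so the multiplications coincide
  (\<open>graded_twist_eq_twisted_tensor\<close>), and the associativity of the graded twist
  (\<open>graded_twist_k_algebra\<close>) gives that of the twisted tensor product.

  The rest serves to justify these formulas, and consists of existence and uniqueness.  For
  existence, \<open>A\<close> and \<open>B\<close> must be direct sums of their homogeneous components: the defining relations
  are homogeneous, and the radical is a sum of graded ideals, so both quotients are graded
  (\<open>tgwa_graded\<close>), and the tensor product inherits a grading from its factors
  (\<open>tensor_grading_grading\<close>).  On a graded space the components may be rescaled at will, which
  produces \<open>\<tau>\<close> and \<open>\<chi>\<close> from \<open>Q\<close> (\<open>bicharacter_flip_exists\<close>, \<open>bicharacter_automorphism_exists\<close>).
  For uniqueness, the relations move all coefficients to the left, so the monomials \<open>r X\<^sub>u\<close> span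
  (\<open>tgwa_monomial_span\<close>); therefore any \<open>\<tau>\<close> and \<open>\<chi>\<close> with the prescribed values on monomials or on
  generators are those constructed from \<open>Q\<close>.\<close>

section \<open>Linear maps and spans\<close>

lemma linear_mapsI:
  assumes "\<And>x. x \<in> carrier M \<Longrightarrow> f x \<in> carrier N"
    and "\<And>x y. x \<in> carrier M \<Longrightarrow> y \<in> carrier M \<Longrightarrow> f (x \<oplus>\<^bsub>M\<^esub> y) = f x \<oplus>\<^bsub>N\<^esub> f y"
    and "\<And>c x. c \<in> carrier K \<Longrightarrow> x \<in> carrier M \<Longrightarrow> f (c \<odot>\<^bsub>M\<^esub> x) = c \<odot>\<^bsub>N\<^esub> f x"
  shows "f \<in> linear_maps K M N"
  using assms by (auto simp: linear_maps_def)

lemma linear_map_closed: "f \<in> linear_maps K M N \<Longrightarrow> x \<in> carrier M \<Longrightarrow> f x \<in> carrier N"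
  and linear_map_add: "f \<in> linear_maps K M N \<Longrightarrow> x \<in> carrier M \<Longrightarrow> y \<in> carrier M \<Longrightarrow>
        f (x \<oplus>\<^bsub>M\<^esub> y) = f x \<oplus>\<^bsub>N\<^esub> f y"
  and linear_map_smult: "f \<in> linear_maps K M N \<Longrightarrow> c \<in> carrier K \<Longrightarrow> x \<in> carrier M \<Longrightarrow>
        f (c \<odot>\<^bsub>M\<^esub> x) = c \<odot>\<^bsub>N\<^esub> f x"
  by (auto simp: linear_maps_def)

lemmas linear_mapD = linear_map_closed linear_map_add linear_map_smult

lemma linear_map_zero:
  assumes "module K M" "module K N" "f \<in> linear_maps K M N"
  shows "f \<zero>\<^bsub>M\<^esub> = \<zero>\<^bsub>N\<^esub>"
proof -
  interpret M: module K M by fact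
  interpret N: module K N by fact
  have "f (\<zero>\<^bsub>K\<^esub> \<odot>\<^bsub>M\<^esub> \<zero>\<^bsub>M\<^esub>) = \<zero>\<^bsub>K\<^esub> \<odot>\<^bsub>N\<^esub> f \<zero>\<^bsub>M\<^esub>"
    by (rule linear_map_smult[OF assms(3)]) auto
  moreover have "f \<zero>\<^bsub>M\<^esub> \<in> carrier N"
    using linear_map_closed[OF assms(3)] by auto
  ultimately show ?thesis by simp
qed

lemma linear_map_cong:
  assumes "module K M" "f \<in> linear_maps K M N" "\<And>x. x \<in> carrier M \<Longrightarrow> g x = f x"
  shows "g \<in> linear_maps K M N"
proof -
  interpret M: module K M by fact
  show ?thesis
    using assms(2,3) by (auto simp: linear_maps_def)
qed

lemma linear_map_id: "(\<lambda>x. x) \<in> linear_maps K M M"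
  by (auto simp: linear_maps_def)

lemma linear_map_comp:
  assumes "f \<in> linear_maps K M N" "g \<in> linear_maps K N P"
  shows "(\<lambda>x. g (f x)) \<in> linear_maps K M P"
  using assms by (auto simp: linear_maps_def Pi_iff)

lemma linear_map_const_zero:
  assumes "module K N"
  shows "(\<lambda>x. \<zero>\<^bsub>N\<^esub>) \<in> linear_maps K M N"
proof -
  interpret N: module K N by fact
  show ?thesis by (auto simp: linear_maps_def)
qed

lemma linear_map_plus:
  assumes "module K N" "f \<in> linear_maps K M N" "g \<in> linear_maps K M N"
  shows "(\<lambda>x. f x \<oplus>\<^bsub>N\<^esub> g x) \<in> linear_maps K M N"
proof -
  interpret N: module K N by fact
  show ?thesis
    using assms(2,3)
    by (intro linear_mapsI)
      (simp_all add: linear_mapD N.smult_r_distr N.M.a_ac)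
qed

lemma linear_map_scale:
  assumes "module K N" "f \<in> linear_maps K M N" "c \<in> carrier K"
  shows "(\<lambda>x. c \<odot>\<^bsub>N\<^esub> f x) \<in> linear_maps K M N"
proof -
  interpret N: module K N by fact
  show ?thesis
    using assms(2,3)
    by (intro linear_mapsI)
      (simp_all add: linear_mapD N.smult_r_distr N.smult_assoc1[symmetric] N.R.m_comm)
qed

lemma linear_map_finsum:
  assumes "module K M" "module K N" "f \<in> linear_maps K M N" "finite I" "g \<in> I \<rightarrow> carrier M"
  shows "f (\<Oplus>\<^bsub>M\<^esub>i\<in>I. g i) = (\<Oplus>\<^bsub>N\<^esub>i\<in>I. f (g i))"
proof -
  interpret M: module K M by fact
  interpret N: module K N by fact
  show ?thesis
    using assms(4,5)
  proof (induction I rule: finite_induct)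
    case empty
    then show ?case using linear_map_zero[OF assms(1-3)] by simp
  next
    case (insert i I)
    then show ?case
      using linear_map_closed[OF assms(3)]
      by (simp add: linear_map_add[OF assms(3)] Pi_iff)
  qed
qed

text \<open>Closure under negation comes for free, as negation is scaling by \<open>-1\<close>.\<close>

lemma submodule_intro:
  assumes "module K M" "H \<subseteq> carrier M" "\<zero>\<^bsub>M\<^esub> \<in> H"
    and "\<And>a b. a \<in> H \<Longrightarrow> b \<in> H \<Longrightarrow> a \<oplus>\<^bsub>M\<^esub> b \<in> H"
    and smult: "\<And>c x. c \<in> carrier K \<Longrightarrow> x \<in> H \<Longrightarrow> c \<odot>\<^bsub>M\<^esub> x \<in> H"
  shows "submodule H K M"
proof -
  interpret M: module K M by fact
  show ?thesis
  proof (rule M.submoduleI)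
    fix a assume a: "a \<in> H"
    then have "\<ominus>\<^bsub>M\<^esub> a = (\<ominus>\<^bsub>K\<^esub> \<one>\<^bsub>K\<^esub>) \<odot>\<^bsub>M\<^esub> a"
      using assms(2) by (auto simp: M.smult_l_minus)
    then show "\<ominus>\<^bsub>M\<^esub> a \<in> H"
      using smult[OF _ a] by simp
  qed (use assms in auto)
qed

lemma submodule_carrier: "submodule H K M \<Longrightarrow> x \<in> H \<Longrightarrow> x \<in> carrier M"
  and submodule_zero: "submodule H K M \<Longrightarrow> \<zero>\<^bsub>M\<^esub> \<in> H"
  and submodule_add: "submodule H K M \<Longrightarrow> x \<in> H \<Longrightarrow> y \<in> H \<Longrightarrow> x \<oplus>\<^bsub>M\<^esub> y \<in> H"
  and submodule_smult: "submodule H K M \<Longrightarrow> c \<in> carrier K \<Longrightarrow> x \<in> H \<Longrightarrow> c \<odot>\<^bsub>M\<^esub> x \<in> H"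
  using subgroup.mem_carrier[OF submodule.axioms(1)] subgroup.one_closed[OF submodule.axioms(1)]
    subgroup.m_closed[OF submodule.axioms(1)] submodule.smult_closed
  by fastforce+

lemma lin_span_submodule:
  assumes "module K M" "S \<subseteq> carrier M"
  shows "submodule (lin_span K M S) K M"
proof -
  interpret M: module K M by fact
  have "lin_span K M S \<subseteq> carrier M"
    using M.carrier_is_submodule assms(2) by (auto simp: lin_span_def)
  then show ?thesis
    by (rule submodule_intro[OF assms(1)])
      (auto simp: lin_span_def submodule_zero submodule_add submodule_smult)
qed

lemma lin_span_superset: "S \<subseteq> lin_span K M S"
  by (auto simp: lin_span_def)

lemma lin_span_least: "submodule H K M \<Longrightarrow> S \<subseteq> H \<Longrightarrow> lin_span K M S \<subseteq> H"
  by (auto simp: lin_span_def)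

lemma lin_span_mono: "S \<subseteq> T \<Longrightarrow> lin_span K M S \<subseteq> lin_span K M T"
  by (auto simp: lin_span_def)

lemma lin_span_eq_carrierI:
  assumes "module K M" "S \<subseteq> carrier M" "carrier M = lin_span K M T" "T \<subseteq> lin_span K M S"
  shows "carrier M = lin_span K M S"
proof
  show "carrier M \<subseteq> lin_span K M S"
    using lin_span_least[OF lin_span_submodule[OF assms(1,2)] assms(4)] assms(3) by simp
  show "lin_span K M S \<subseteq> carrier M"
    using submodule_carrier[OF lin_span_submodule[OF assms(1,2)]] by auto
qed

lemma lin_span_induct [consumes 3, case_names base zero add smult]:
  assumes "module K M" "x \<in> lin_span K M S" "S \<subseteq> carrier M"
    and "\<And>s. s \<in> S \<Longrightarrow> P s"
    and "P \<zero>\<^bsub>M\<^esub>"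
    and "\<And>x y. x \<in> carrier M \<Longrightarrow> y \<in> carrier M \<Longrightarrow> P x \<Longrightarrow> P y \<Longrightarrow> P (x \<oplus>\<^bsub>M\<^esub> y)"
    and "\<And>c x. c \<in> carrier K \<Longrightarrow> x \<in> carrier M \<Longrightarrow> P x \<Longrightarrow> P (c \<odot>\<^bsub>M\<^esub> x)"
  shows "P x"
proof -
  interpret M: module K M by fact
  have "submodule {x \<in> carrier M. P x} K M"
    by (rule submodule_intro[OF assms(1)]) (use assms(5-) in auto)
  with assms(2,3,4) show ?thesis
    using lin_span_least[of "{x \<in> carrier M. P x}" K M S] by blast
qed

lemma linear_maps_eqI:
  assumes "module K M" "module K N" "carrier M = lin_span K M S"
    and "f \<in> linear_maps K M N" "g \<in> linear_maps K M N" "\<And>s. s \<in> S \<Longrightarrow> f s = g s"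
    and "x \<in> carrier M"
  shows "f x = g x"
proof -
  have S: "S \<subseteq> carrier M" using lin_span_superset[of S K M] assms(3) by simp
  have "x \<in> lin_span K M S" using assms(3,7) by simp
  from assms(1) this S show ?thesis
    by (induction rule: lin_span_induct)
      (use assms(4-6) in \<open>simp_all add: linear_mapD linear_map_zero[OF assms(1,2)]\<close>)
qed

lemma linear_image_span:
  assumes "module K M" "module K N" "f \<in> linear_maps K M N" "S \<subseteq> carrier M" "f ` S \<subseteq> T" "T \<subseteq> carrier N"
    and "x \<in> lin_span K M S"
  shows "f x \<in> lin_span K N T"
proof -
  note T = lin_span_submodule[OF assms(2,6)]
  from assms(1,7,4) show ?thesis
    by (induction rule: lin_span_induct)
      (use assms(3,5) linear_map_zero[OF assms(1-3)] lin_span_superset[of T K N] in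
        \<open>auto simp: linear_mapD submodule_zero[OF T] submodule_add[OF T] submodule_smult[OF T]\<close>)
qed

lemma surjective_image_span:
  assumes "module K M" "module K N" "f \<in> linear_maps K M N" "f ` carrier M = carrier N"
    and "carrier M = lin_span K M S"
  shows "carrier N = lin_span K N (f ` S)"
proof -
  have S: "S \<subseteq> carrier M" using lin_span_superset[of S K M] assms(5) by simp
  then have fS: "f ` S \<subseteq> carrier N" using assms(4) by auto
  show ?thesis
  proof
    show "lin_span K N (f ` S) \<subseteq> carrier N"
      using submodule_carrier[OF lin_span_submodule[OF assms(2) fS]] by auto
    have "f x \<in> lin_span K N (f ` S)" if "x \<in> carrier M" for x
      using that unfolding assms(5) by (rule linear_image_span[OF assms(1-3) S order_refl fS])
    then show "carrier N \<subseteq> lin_span K N (f ` S)"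
      unfolding assms(4)[symmetric] by (rule image_subsetI)
  qed
qed

definition bilinear_maps ::
  "('k, 'x) ring_scheme \<Rightarrow> ('k, 'a, 'y) module_scheme \<Rightarrow> ('k, 'b, 'z) module_scheme
    \<Rightarrow> ('k, 'p, 'w) module_scheme \<Rightarrow> ('a \<Rightarrow> 'b \<Rightarrow> 'p) set"
  where "bilinear_maps K A B P = {f. (\<forall>a\<in>carrier A. f a \<in> linear_maps K B P) \<and>
    (\<forall>b\<in>carrier B. (\<lambda>a. f a b) \<in> linear_maps K A P)}"

lemma bilinear_mapsI:
  assumes "\<And>a. a \<in> carrier A \<Longrightarrow> f a \<in> linear_maps K B P"
    and "\<And>b. b \<in> carrier B \<Longrightarrow> (\<lambda>a. f a b) \<in> linear_maps K A P"
  shows "f \<in> bilinear_maps K A B P"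
  using assms by (auto simp: bilinear_maps_def)

lemma bilinear_map_right: "f \<in> bilinear_maps K A B P \<Longrightarrow> a \<in> carrier A \<Longrightarrow> f a \<in> linear_maps K B P"
  and bilinear_map_left: "f \<in> bilinear_maps K A B P \<Longrightarrow> b \<in> carrier B \<Longrightarrow>
    (\<lambda>a. f a b) \<in> linear_maps K A P"
  by (auto simp: bilinear_maps_def)

lemma bilinear_map_comp:
  assumes "f \<in> bilinear_maps K A B P" "g \<in> linear_maps K A' A" "h \<in> linear_maps K B' B"
    "k \<in> linear_maps K P Q"
  shows "(\<lambda>a b. k (f (g a) (h b))) \<in> bilinear_maps K A' B' Q"
proof (rule bilinear_mapsI)
  show "(\<lambda>b. k (f (g a) (h b))) \<in> linear_maps K B' Q" if "a \<in> carrier A'" for a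
    by (rule linear_map_comp[OF linear_map_comp[OF assms(3)
            bilinear_map_right[OF assms(1) linear_map_closed[OF assms(2) that]]] assms(4)])
  show "(\<lambda>a. k (f (g a) (h b))) \<in> linear_maps K A' Q" if "b \<in> carrier B'" for b
    by (rule linear_map_comp[OF linear_map_comp[OF assms(2)
            bilinear_map_left[OF assms(1) linear_map_closed[OF assms(3) that]]] assms(4)])
qed

text \<open>One argument at a time: first both maps agree at \<open>(s, b)\<close> for spanning \<open>s\<close> and all \<open>b\<close>, then
  everywhere.\<close>

lemma bilinear_maps_eqI:
  assumes "module K A" "module K B" "module K P" "carrier A = lin_span K A S" "carrier B = lin_span K B T"
    and "f \<in> bilinear_maps K A B P" "g \<in> bilinear_maps K A B P"
    and "\<And>s t. s \<in> S \<Longrightarrow> t \<in> T \<Longrightarrow> f s t = g s t"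
    and "a \<in> carrier A" "b \<in> carrier B"
  shows "f a b = g a b"
proof -
  have "f s b = g s b" if "s \<in> S" for s
  proof -
    have "s \<in> carrier A" using that lin_span_superset[of S K A] assms(4) by auto
    then show ?thesis
      using linear_maps_eqI[OF assms(2,3,5) bilinear_map_right[OF assms(6)]
          bilinear_map_right[OF assms(7)] assms(8) assms(10)] that by blast
  qed
  then show ?thesis
    using linear_maps_eqI[OF assms(1,3,4) bilinear_map_left[OF assms(6)]
        bilinear_map_left[OF assms(7)] _ assms(9)] assms(10) by blast
qed

text \<open>The map \<open>g\<close> sends \<open>y\<close> to \<open>f x\<close> for any chosen \<open>x\<close> over \<open>y\<close>.  Two choices of \<open>x\<close> differ by an
  element of the kernel of \<open>p\<close>, which \<open>f\<close> kills, so the choice does not matter and linearity is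
  inherited from \<open>f\<close>.\<close>

lemma linear_map_factor:
  assumes "module K M" "module K P" "module K N"
    and p: "p \<in> linear_maps K M P" "p ` carrier M = carrier P"
    and f: "f \<in> linear_maps K M N" "\<And>x. x \<in> carrier M \<Longrightarrow> p x = \<zero>\<^bsub>P\<^esub> \<Longrightarrow> f x = \<zero>\<^bsub>N\<^esub>"
  shows "\<exists>g\<in>linear_maps K P N. \<forall>x\<in>carrier M. g (p x) = f x"
proof -
  interpret M: module K M by fact
  interpret P: module K P by fact
  interpret N: module K N by fact
  have eq: "f x = f y" if x: "x \<in> carrier M" and y: "y \<in> carrier M" and "p x = p y" for x y
  proof -
    let ?y = "(\<ominus>\<^bsub>K\<^esub> \<one>\<^bsub>K\<^esub>) \<odot>\<^bsub>M\<^esub> y"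
    have y': "?y \<in> carrier M" using y by simp
    have "p (x \<oplus>\<^bsub>M\<^esub> ?y) = \<zero>\<^bsub>P\<^esub>"
      using x y y' \<open>p x = p y\<close> p(1)
      by (simp add: linear_mapD[OF p(1)] P.smult_l_minus P.M.r_neg)
    then have "f (x \<oplus>\<^bsub>M\<^esub> ?y) = \<zero>\<^bsub>N\<^esub>" using f(2) x y' by simp
    then have "f x \<oplus>\<^bsub>N\<^esub> \<ominus>\<^bsub>N\<^esub> f y = \<zero>\<^bsub>N\<^esub>"
      using x y y' by (simp add: linear_mapD[OF f(1)] N.smult_l_minus)
    then show ?thesis
      using x y N.M.minus_equality[of "f x" "\<ominus>\<^bsub>N\<^esub> f y"] by (simp add: linear_mapD[OF f(1)])
  qed
  define g where "g y = f (SOME x. x \<in> carrier M \<and> p x = y)" for y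
  have g: "g (p x) = f x" if "x \<in> carrier M" for x
    unfolding g_def using that someI[of "\<lambda>x'. x' \<in> carrier M \<and> p x' = p x" x] by (intro eq) auto
  have "g \<in> linear_maps K P N"
  proof (rule linear_mapsI)
    fix x assume "x \<in> carrier P"
    then obtain x' where x': "x' \<in> carrier M" "x = p x'" using p(2) by auto
    then show "g x \<in> carrier N" by (simp add: g linear_mapD[OF f(1)])
    show "g (c \<odot>\<^bsub>P\<^esub> x) = c \<odot>\<^bsub>N\<^esub> g x" if "c \<in> carrier K" for c
    proof -
      have "c \<odot>\<^bsub>P\<^esub> x = p (c \<odot>\<^bsub>M\<^esub> x')" using x' that by (simp add: linear_mapD[OF p(1)])
      then show ?thesis using x' that by (simp add: g linear_mapD[OF f(1)])
    qed
    fix y assume "y \<in> carrier P"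
    then obtain y' where y': "y' \<in> carrier M" "y = p y'" using p(2) by auto
    have "x \<oplus>\<^bsub>P\<^esub> y = p (x' \<oplus>\<^bsub>M\<^esub> y')" using x' y' by (simp add: linear_mapD[OF p(1)])
    then show "g (x \<oplus>\<^bsub>P\<^esub> y) = g x \<oplus>\<^bsub>N\<^esub> g y"
      using x' y' by (simp add: g linear_mapD[OF f(1)])
  qed
  with g show ?thesis by blast
qed

text \<open>The tensor product, its twisted version and the graded twist carry different multiplications on
  one vector space.  This relation records that, so that spans, submodules and linear maps can be
  carried over without repeating any argument.\<close>

definition same_space :: "('k, 'a, 'y) module_scheme \<Rightarrow> ('k, 'a, 'z) module_scheme \<Rightarrow> bool"
  where "same_space M N \<longleftrightarrow> carrier N = carrier M \<and> add N = add M \<and> zero N = zero M \<and> smult N = smult M"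

lemma submodule_same_space: "same_space M N \<Longrightarrow> submodule H K N = submodule H K M"
  by (simp add: same_space_def submodule_def submodule_axioms_def subgroup_def m_inv_def)

lemma lin_span_same_space: "same_space M N \<Longrightarrow> lin_span K N S = lin_span K M S"
  by (simp add: lin_span_def submodule_same_space)

lemma linear_maps_same_space:
  "same_space M M' \<Longrightarrow> same_space N N' \<Longrightarrow> linear_maps K M' N' = linear_maps K M N"
  by (simp add: linear_maps_def same_space_def)

section \<open>Algebras and their quotients\<close>

text \<open>The axioms are equations and the existence of negatives, all of which pass to images.  Apart from
  quotients, this covers \<open>p\<close> the identity, where it says that operations agreeing on the carrier are interchangeable.\<close>

lemma module_surjective_image:
  assumes "module K M" "p ` carrier M = carrier N" "p \<zero>\<^bsub>M\<^esub> = \<zero>\<^bsub>N\<^esub>"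
    and add: "\<And>x y. x \<in> carrier M \<Longrightarrow> y \<in> carrier M \<Longrightarrow> p (x \<oplus>\<^bsub>M\<^esub> y) = p x \<oplus>\<^bsub>N\<^esub> p y"
    and smult: "\<And>c x. c \<in> carrier K \<Longrightarrow> x \<in> carrier M \<Longrightarrow> p (c \<odot>\<^bsub>M\<^esub> x) = c \<odot>\<^bsub>N\<^esub> p x"
  shows "module K N"
proof -
  interpret M: module K M by fact
  have pre: "\<exists>x'\<in>carrier M. x = p x'" if "x \<in> carrier N" for x using that assms(2) by auto
  have cl: "p x \<in> carrier N" if "x \<in> carrier M" for x using that assms(2) by auto
  have zero: "\<zero>\<^bsub>N\<^esub> = p \<zero>\<^bsub>M\<^esub>" using assms(3) by simp
  show ?thesis
  proof (rule moduleI[OF M.R.is_cring])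
    show "abelian_group N"
    proof (rule abelian_groupI)
      fix x assume "x \<in> carrier N"
      then obtain x' where x': "x' \<in> carrier M" "x = p x'" using pre by blast
      show "\<zero>\<^bsub>N\<^esub> \<oplus>\<^bsub>N\<^esub> x = x" using x' by (simp add: zero add[symmetric])
      show "\<exists>y\<in>carrier N. y \<oplus>\<^bsub>N\<^esub> x = \<zero>\<^bsub>N\<^esub>"
        using x' by (intro bexI[of _ "p (\<ominus>\<^bsub>M\<^esub> x')"]) (simp_all add: zero add[symmetric] cl M.M.l_neg)
      fix y assume "y \<in> carrier N"
      then obtain y' where y': "y' \<in> carrier M" "y = p y'" using pre by blast
      show "x \<oplus>\<^bsub>N\<^esub> y \<in> carrier N" "x \<oplus>\<^bsub>N\<^esub> y = y \<oplus>\<^bsub>N\<^esub> x"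
        using x' y' by (simp_all add: add[symmetric] cl M.M.a_comm)
      fix z assume "z \<in> carrier N"
      then obtain z' where z': "z' \<in> carrier M" "z = p z'" using pre by blast
      show "x \<oplus>\<^bsub>N\<^esub> y \<oplus>\<^bsub>N\<^esub> z = x \<oplus>\<^bsub>N\<^esub> (y \<oplus>\<^bsub>N\<^esub> z)"
        using x' y' z' by (simp add: add[symmetric] M.M.a_assoc)
    qed (simp add: zero cl)
    fix c x assume c: "c \<in> carrier K" and "x \<in> carrier N"
    then obtain x' where x': "x' \<in> carrier M" "x = p x'" using pre by blast
    show "c \<odot>\<^bsub>N\<^esub> x \<in> carrier N" using c x' by (simp add: smult[symmetric] cl)
    show "(c \<oplus>\<^bsub>K\<^esub> d) \<odot>\<^bsub>N\<^esub> x = (c \<odot>\<^bsub>N\<^esub> x) \<oplus>\<^bsub>N\<^esub> (d \<odot>\<^bsub>N\<^esub> x)"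
      "(c \<otimes>\<^bsub>K\<^esub> d) \<odot>\<^bsub>N\<^esub> x = c \<odot>\<^bsub>N\<^esub> (d \<odot>\<^bsub>N\<^esub> x)" if "d \<in> carrier K" for d
      using c x' that
      by (simp_all add: smult[symmetric] add[symmetric] M.smult_l_distr M.smult_assoc1)
    fix y assume "y \<in> carrier N"
    then obtain y' where y': "y' \<in> carrier M" "y = p y'" using pre by blast
    show "c \<odot>\<^bsub>N\<^esub> (x \<oplus>\<^bsub>N\<^esub> y) = (c \<odot>\<^bsub>N\<^esub> x) \<oplus>\<^bsub>N\<^esub> (c \<odot>\<^bsub>N\<^esub> y)"
      using c x' y' by (simp add: smult[symmetric] add[symmetric] M.smult_r_distr)
  next
    fix x assume "x \<in> carrier N"
    then obtain x' where x': "x' \<in> carrier M" "x = p x'" using pre by blast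
    then show "\<one>\<^bsub>K\<^esub> \<odot>\<^bsub>N\<^esub> x = x" by (simp add: smult[symmetric])
  qed
qed

lemma module_same_space: "module K M \<Longrightarrow> same_space M N \<Longrightarrow> module K N"
  by (rule module_surjective_image[where p = "\<lambda>x. x"]) (auto simp: same_space_def)

lemma k_algebra_field: "k_algebra K A \<Longrightarrow> field K"
  and k_algebra_module: "k_algebra K A \<Longrightarrow> module K A"
  by (auto simp: k_algebra_def)

lemma k_algebra_mult_bilinear:
  assumes "k_algebra K A"
  shows "(\<otimes>\<^bsub>A\<^esub>) \<in> bilinear_maps K A A A"
proof -
  interpret k_algebra K A by fact
  show ?thesis
    by (intro bilinear_mapsI linear_mapsI)
      (simp_all add: smult_mult_left smult_mult_right A.l_distr A.r_distr)
qed

lemma k_algebra_surjective_image: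
  assumes "k_algebra K A" "p ` carrier A = carrier B" "p \<zero>\<^bsub>A\<^esub> = \<zero>\<^bsub>B\<^esub>" "p \<one>\<^bsub>A\<^esub> = \<one>\<^bsub>B\<^esub>"
    and add: "\<And>x y. x \<in> carrier A \<Longrightarrow> y \<in> carrier A \<Longrightarrow> p (x \<oplus>\<^bsub>A\<^esub> y) = p x \<oplus>\<^bsub>B\<^esub> p y"
    and smult: "\<And>c x. c \<in> carrier K \<Longrightarrow> x \<in> carrier A \<Longrightarrow> p (c \<odot>\<^bsub>A\<^esub> x) = c \<odot>\<^bsub>B\<^esub> p x"
    and mult: "\<And>x y. x \<in> carrier A \<Longrightarrow> y \<in> carrier A \<Longrightarrow> p (x \<otimes>\<^bsub>A\<^esub> y) = p x \<otimes>\<^bsub>B\<^esub> p y"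
  shows "k_algebra K B"
proof -
  interpret k_algebra K A by fact
  have B: "module K B"
    by (rule module_surjective_image[OF k_algebra_module[OF assms(1)], where p=p]) (use assms in auto)
  interpret B: module K B by fact
  have pre: "\<exists>x'\<in>carrier A. x = p x'" if "x \<in> carrier B" for x using that assms(2) by auto
  have cl: "p x \<in> carrier B" if "x \<in> carrier A" for x using that assms(2) by auto
  have one: "\<one>\<^bsub>B\<^esub> = p \<one>\<^bsub>A\<^esub>" using assms(4) by simp
  have "monoid B"
  proof (rule monoidI)
    fix x assume "x \<in> carrier B"
    then obtain x' where x': "x' \<in> carrier A" "x = p x'" using pre by blast
    show "\<one>\<^bsub>B\<^esub> \<otimes>\<^bsub>B\<^esub> x = x" "x \<otimes>\<^bsub>B\<^esub> \<one>\<^bsub>B\<^esub> = x"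
      using x' by (simp_all add: one mult[symmetric])
    fix y assume "y \<in> carrier B"
    then obtain y' where y': "y' \<in> carrier A" "y = p y'" using pre by blast
    show "x \<otimes>\<^bsub>B\<^esub> y \<in> carrier B" using x' y' by (simp add: mult[symmetric] cl)
    fix z assume "z \<in> carrier B"
    then obtain z' where z': "z' \<in> carrier A" "z = p z'" using pre by blast
    show "x \<otimes>\<^bsub>B\<^esub> y \<otimes>\<^bsub>B\<^esub> z = x \<otimes>\<^bsub>B\<^esub> (y \<otimes>\<^bsub>B\<^esub> z)"
      using x' y' z' by (simp add: mult[symmetric] A.m_assoc)
  qed (simp add: one cl)
  moreover have "(x \<oplus>\<^bsub>B\<^esub> y) \<otimes>\<^bsub>B\<^esub> z = x \<otimes>\<^bsub>B\<^esub> z \<oplus>\<^bsub>B\<^esub> y \<otimes>\<^bsub>B\<^esub> z \<and>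
      z \<otimes>\<^bsub>B\<^esub> (x \<oplus>\<^bsub>B\<^esub> y) = z \<otimes>\<^bsub>B\<^esub> x \<oplus>\<^bsub>B\<^esub> z \<otimes>\<^bsub>B\<^esub> y"
    if x: "x \<in> carrier B" and y: "y \<in> carrier B" and z: "z \<in> carrier B" for x y z
  proof -
    obtain x' where "x' \<in> carrier A" "x = p x'" using pre[OF x] by blast
    moreover obtain y' where "y' \<in> carrier A" "y = p y'" using pre[OF y] by blast
    moreover obtain z' where "z' \<in> carrier A" "z = p z'" using pre[OF z] by blast
    ultimately show ?thesis
      by (simp add: mult[symmetric] add[symmetric] A.l_distr A.r_distr)
  qed
  ultimately have "ring B"
    by (intro ringI B.M.abelian_group_axioms) auto
  moreover have "(c \<odot>\<^bsub>B\<^esub> x) \<otimes>\<^bsub>B\<^esub> y = c \<odot>\<^bsub>B\<^esub> (x \<otimes>\<^bsub>B\<^esub> y) \<and> x \<otimes>\<^bsub>B\<^esub> (c \<odot>\<^bsub>B\<^esub> y) = c \<odot>\<^bsub>B\<^esub> (x \<otimes>\<^bsub>B\<^esub> y)"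
    if c: "c \<in> carrier K" and x: "x \<in> carrier B" and y: "y \<in> carrier B" for c x y
  proof -
    obtain x' where "x' \<in> carrier A" "x = p x'" using pre[OF x] by blast
    moreover obtain y' where "y' \<in> carrier A" "y = p y'" using pre[OF y] by blast
    ultimately show ?thesis
      using c by (simp add: mult[symmetric] smult[symmetric] smult_mult_left smult_mult_right)
  qed
  ultimately show ?thesis
    using B K.field_axioms by (simp add: k_algebra_def k_algebra_axioms_def)
qed

text \<open>Associativity is a trilinear condition and the unit laws are linear ones, so spanning vectors
  suffice.  The free algebra (words), the tensor product (pure tensors) and the graded twist
  (homogeneous elements) are all shown to be algebras in this way.\<close>

lemma k_algebraI_span:
  assumes "field K" "module K A" "(\<otimes>\<^bsub>A\<^esub>) \<in> bilinear_maps K A A A" "\<one>\<^bsub>A\<^esub> \<in> carrier A"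
    and S: "carrier A = lin_span K A S"
    and one: "\<And>s. s \<in> S \<Longrightarrow> \<one>\<^bsub>A\<^esub> \<otimes>\<^bsub>A\<^esub> s = s" "\<And>s. s \<in> S \<Longrightarrow> s \<otimes>\<^bsub>A\<^esub> \<one>\<^bsub>A\<^esub> = s"
    and assoc: "\<And>s t u. s \<in> S \<Longrightarrow> t \<in> S \<Longrightarrow> u \<in> S \<Longrightarrow> s \<otimes>\<^bsub>A\<^esub> t \<otimes>\<^bsub>A\<^esub> u = s \<otimes>\<^bsub>A\<^esub> (t \<otimes>\<^bsub>A\<^esub> u)"
  shows "k_algebra K A"
proof -
  interpret A: module K A by fact
  note R = bilinear_map_right[OF assms(3)] and L = bilinear_map_left[OF assms(3)]
  have SA: "S \<subseteq> carrier A" using S lin_span_superset[of S K A] by simp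
  have cl: "x \<otimes>\<^bsub>A\<^esub> y \<in> carrier A" if "x \<in> carrier A" "y \<in> carrier A" for x y
    using linear_map_closed[OF R] that by blast
  note eqI = linear_maps_eqI[OF assms(2,2) S]
  have "x \<otimes>\<^bsub>A\<^esub> y \<otimes>\<^bsub>A\<^esub> z = x \<otimes>\<^bsub>A\<^esub> (y \<otimes>\<^bsub>A\<^esub> z)"
    if x: "x \<in> carrier A" and y: "y \<in> carrier A" and z: "z \<in> carrier A" for x y z
  proof (rule eqI[OF linear_map_comp[OF L[OF y] L[OF z]] L[OF cl[OF y z]] _ x])
    fix s assume s: "s \<in> S"
    then have s': "s \<in> carrier A" using SA by auto
    show "s \<otimes>\<^bsub>A\<^esub> y \<otimes>\<^bsub>A\<^esub> z = s \<otimes>\<^bsub>A\<^esub> (y \<otimes>\<^bsub>A\<^esub> z)"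
    proof (rule eqI[OF linear_map_comp[OF R[OF s'] L[OF z]] linear_map_comp[OF L[OF z] R[OF s']] _ y])
      fix t assume t: "t \<in> S"
      then have t': "t \<in> carrier A" using SA by auto
      show "s \<otimes>\<^bsub>A\<^esub> t \<otimes>\<^bsub>A\<^esub> z = s \<otimes>\<^bsub>A\<^esub> (t \<otimes>\<^bsub>A\<^esub> z)"
        by (rule eqI[OF R[OF cl[OF s' t']] linear_map_comp[OF R[OF t'] R[OF s']] _ z])
          (use assoc s t in auto)
    qed
  qed
  moreover have "\<one>\<^bsub>A\<^esub> \<otimes>\<^bsub>A\<^esub> x = x" "x \<otimes>\<^bsub>A\<^esub> \<one>\<^bsub>A\<^esub> = x" if "x \<in> carrier A" for x
    using eqI[OF R[OF assms(4)] linear_map_id] eqI[OF L[OF assms(4)] linear_map_id] one that by auto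
  ultimately have "monoid A"
    using cl assms(4) by (intro monoidI) auto
  then have "ring A"
    using linear_map_add[OF L] linear_map_add[OF R] by (intro ringI A.M.abelian_group_axioms) auto
  then show ?thesis
    using assms(1,2) linear_map_smult[OF L] linear_map_smult[OF R]
    by (simp add: k_algebra_def k_algebra_axioms_def)
qed

lemma quot_algebra_simps:
  "zero (quot_algebra M I) = I" "one (quot_algebra M I) = I +>\<^bsub>M\<^esub> \<one>\<^bsub>M\<^esub>"
  "mult (quot_algebra M I) = rcoset_mult M I"
  "carrier (quot_algebra M I) = (\<lambda>x. I +>\<^bsub>M\<^esub> x) ` carrier M"
  by (auto simp: quot_algebra_def FactRing_def A_RCOSETS_def RCOSETS_def a_r_coset_def)

context
  fixes K :: "('k, 'x) ring_scheme" and M :: "('k, 'a, 'y) module_scheme" and I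
  assumes M: "module K M" and I: "submodule I K M"
begin

interpretation M: module K M by (rule M)
interpretation I: abelian_subgroup I M
  using submodule.axioms(1)[OF I]
  by (intro abelian_subgroupI3 additive_subgroup.intro M.M.abelian_group_axioms)

lemma quot_coset_eq_iff:
  assumes "x \<in> carrier M" "y \<in> carrier M"
  shows "I +>\<^bsub>M\<^esub> x = I +>\<^bsub>M\<^esub> y \<longleftrightarrow> (\<exists>i\<in>I. x = i \<oplus>\<^bsub>M\<^esub> y)"
proof
  assume "I +>\<^bsub>M\<^esub> x = I +>\<^bsub>M\<^esub> y"
  then have "x \<in> I +>\<^bsub>M\<^esub> y" using I.a_rcos_self[OF assms(1)] by simp
  then show "\<exists>i\<in>I. x = i \<oplus>\<^bsub>M\<^esub> y" by (auto simp: a_r_coset_def')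
next
  assume "\<exists>i\<in>I. x = i \<oplus>\<^bsub>M\<^esub> y"
  then have "x \<in> I +>\<^bsub>M\<^esub> y" by (auto simp: a_r_coset_def')
  then show "I +>\<^bsub>M\<^esub> x = I +>\<^bsub>M\<^esub> y"
    using M.M.a_repr_independence[OF _ assms(2) submodule.axioms(1)[OF I]] by simp
qed

lemma quot_coset_eq_zero_iff:
  assumes "x \<in> carrier M"
  shows "I +>\<^bsub>M\<^esub> x = zero (quot_algebra M I) \<longleftrightarrow> x \<in> I"
proof -
  have "I +>\<^bsub>M\<^esub> \<zero>\<^bsub>M\<^esub> = I" by (rule M.M.a_coset_add_zero) (rule I.a_subset)
  then show ?thesis
    using quot_coset_eq_iff[OF assms M.M.zero_closed] submodule_carrier[OF I]
    by (auto simp: quot_algebra_simps)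
qed

lemma quot_smult:
  assumes "c \<in> carrier K" "x \<in> carrier M"
  shows "c \<odot>\<^bsub>quot_algebra M I\<^esub> (I +>\<^bsub>M\<^esub> x) = I +>\<^bsub>M\<^esub> (c \<odot>\<^bsub>M\<^esub> x)"
proof -
  have "I +>\<^bsub>M\<^esub> (c \<odot>\<^bsub>M\<^esub> y) = I +>\<^bsub>M\<^esub> (c \<odot>\<^bsub>M\<^esub> x)" if y: "y \<in> I +>\<^bsub>M\<^esub> x" for y
  proof -
    obtain i where i: "i \<in> I" "y = i \<oplus>\<^bsub>M\<^esub> x" using y by (auto simp: a_r_coset_def')
    have "c \<odot>\<^bsub>M\<^esub> y = c \<odot>\<^bsub>M\<^esub> i \<oplus>\<^bsub>M\<^esub> c \<odot>\<^bsub>M\<^esub> x"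
      using i assms submodule_carrier[OF I] by (simp add: M.smult_r_distr)
    then show ?thesis
      using i assms submodule_carrier[OF I] submodule_smult[OF I]
      by (subst quot_coset_eq_iff) auto
  qed
  moreover have "I +>\<^bsub>M\<^esub> x \<noteq> {}" using I.a_rcos_self[OF assms(2)] by auto
  ultimately have "(\<Union>y\<in>I +>\<^bsub>M\<^esub> x. I +>\<^bsub>M\<^esub> (c \<odot>\<^bsub>M\<^esub> y)) = I +>\<^bsub>M\<^esub> (c \<odot>\<^bsub>M\<^esub> x)"
    by (intro SUP_eq_const)
  then show ?thesis by (simp add: quot_algebra_def)
qed

lemma quot_add:
  assumes "x \<in> carrier M" "y \<in> carrier M"
  shows "(I +>\<^bsub>M\<^esub> x) \<oplus>\<^bsub>quot_algebra M I\<^esub> (I +>\<^bsub>M\<^esub> y) = I +>\<^bsub>M\<^esub> (x \<oplus>\<^bsub>M\<^esub> y)"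
  using I.a_rcos_sum[OF assms] by (simp add: quot_algebra_def FactRing_def)

lemma quot_module: "module K (quot_algebra M I)"
proof (rule module_surjective_image[OF M, of "\<lambda>x. I +>\<^bsub>M\<^esub> x"])
  show "I +>\<^bsub>M\<^esub> \<zero>\<^bsub>M\<^esub> = zero (quot_algebra M I)"
    by (simp add: quot_coset_eq_zero_iff submodule_zero[OF I])
qed (simp_all add: quot_algebra_simps(4) quot_add quot_smult)

lemma quot_projection_linear: "(\<lambda>x. I +>\<^bsub>M\<^esub> x) \<in> linear_maps K M (quot_algebra M I)"
  by (rule linear_mapsI) (simp_all add: quot_algebra_simps(4) quot_add quot_smult)

end

text \<open>Stability under scalars holds because \<open>c x = (c 1) x\<close>.\<close>

lemma ideal_submodule:
  assumes "k_algebra K A" "ideal I A"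
  shows "submodule I K A"
proof -
  interpret k_algebra K A by fact
  interpret I: ideal I A by fact
  show ?thesis
  proof (rule submodule_intro[OF k_algebra_module[OF assms(1)]])
    fix c x assume c: "c \<in> carrier K" and x: "x \<in> I"
    then have "c \<odot>\<^bsub>A\<^esub> x = (c \<odot>\<^bsub>A\<^esub> \<one>\<^bsub>A\<^esub>) \<otimes>\<^bsub>A\<^esub> x"
      using I.Icarr by (simp add: smult_mult_left)
    then show "c \<odot>\<^bsub>A\<^esub> x \<in> I" using c x by (simp add: I.I_l_closed)
  qed (use I.a_subset in auto)
qed

lemma quot_k_algebra:
  assumes "k_algebra K A" "ideal I A"
  shows "k_algebra K (quot_algebra A I)"
    and "x \<in> carrier A \<Longrightarrow> y \<in> carrier A \<Longrightarrow>
      (I +>\<^bsub>A\<^esub> x) \<otimes>\<^bsub>quot_algebra A I\<^esub> (I +>\<^bsub>A\<^esub> y) = I +>\<^bsub>A\<^esub> (x \<otimes>\<^bsub>A\<^esub> y)"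
proof -
  interpret k_algebra K A by fact
  interpret I: ideal I A by fact
  note M = k_algebra_module[OF assms(1)]
  note I = ideal_submodule[OF assms]
  show m: "x \<in> carrier A \<Longrightarrow> y \<in> carrier A \<Longrightarrow>
      (I +>\<^bsub>A\<^esub> x) \<otimes>\<^bsub>quot_algebra A I\<^esub> (I +>\<^bsub>A\<^esub> y) = I +>\<^bsub>A\<^esub> (x \<otimes>\<^bsub>A\<^esub> y)" for x y
    by (simp add: quot_algebra_simps I.rcoset_mult_add)
  show "k_algebra K (quot_algebra A I)"
    by (rule k_algebra_surjective_image[OF assms(1), of "\<lambda>x. I +>\<^bsub>A\<^esub> x"])
      (simp_all add: m quot_algebra_simps(2,4) quot_add[OF M I] quot_smult[OF M I]
        quot_coset_eq_zero_iff[OF M I] submodule_zero[OF I])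
qed

section \<open>Free modules and free algebras\<close>

lemma free_module_simps:
  "f \<in> carrier (free_module K X) \<longleftrightarrow> (\<forall>x\<in>X. f x \<in> carrier K) \<and>
     (\<forall>x. x \<notin> X \<longrightarrow> f x = \<zero>\<^bsub>K\<^esub>) \<and> finite {x. f x \<noteq> \<zero>\<^bsub>K\<^esub>}"
  "zero (free_module K X) = (\<lambda>_. \<zero>\<^bsub>K\<^esub>)"
  "f \<oplus>\<^bsub>free_module K X\<^esub> g = (\<lambda>x. f x \<oplus>\<^bsub>K\<^esub> g x)"
  "c \<odot>\<^bsub>free_module K X\<^esub> f = (\<lambda>x. c \<otimes>\<^bsub>K\<^esub> f x)"
  by (simp_all add: free_module_def)

lemma free_module_value:
  assumes "cring K" "f \<in> carrier (free_module K X)"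
  shows "f x \<in> carrier K"
proof -
  interpret cring K by fact
  show ?thesis using assms(2) by (cases "x \<in> X") (auto simp: free_module_simps)
qed

lemma free_module_module:
  assumes "cring K"
  shows "module K (free_module K X)"
proof -
  interpret cring K by fact
  note [simp] = free_module_simps(2,3,4)
  note V = free_module_value[OF assms]
  have fin_sub: "finite {x. h x \<noteq> \<zero>\<^bsub>K\<^esub>}"
    if "finite {x. f x \<noteq> \<zero>\<^bsub>K\<^esub>}" "finite {x. g x \<noteq> \<zero>\<^bsub>K\<^esub>}"
      "\<And>x. f x = \<zero>\<^bsub>K\<^esub> \<Longrightarrow> g x = \<zero>\<^bsub>K\<^esub> \<Longrightarrow> h x = \<zero>\<^bsub>K\<^esub>" for f g h :: "_ \<Rightarrow> 'a"
    by (rule finite_subset[OF _ finite_UnI[OF that(1,2)]]) (use that(3) in blast)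
  show ?thesis
  proof (rule moduleI[OF assms])
    show "abelian_group (free_module K X)"
    proof (rule abelian_groupI)
      fix f assume f: "f \<in> carrier (free_module K X)"
      show "\<zero>\<^bsub>free_module K X\<^esub> \<oplus>\<^bsub>free_module K X\<^esub> f = f"
        using V[OF f] by auto
      have "(\<lambda>x. \<ominus>\<^bsub>K\<^esub> f x) \<in> carrier (free_module K X)"
        using f fin_sub[of f f "\<lambda>x. \<ominus>\<^bsub>K\<^esub> f x"] by (auto simp: free_module_simps(1))
      then show "\<exists>g\<in>carrier (free_module K X). g \<oplus>\<^bsub>free_module K X\<^esub> f = \<zero>\<^bsub>free_module K X\<^esub>"
        using V[OF f] by (intro bexI) (auto simp: l_neg)
      fix g assume g: "g \<in> carrier (free_module K X)"
      show "f \<oplus>\<^bsub>free_module K X\<^esub> g \<in> carrier (free_module K X)"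
        using f g fin_sub[of f g "\<lambda>x. f x \<oplus>\<^bsub>K\<^esub> g x"] by (auto simp: free_module_simps(1))
      show "f \<oplus>\<^bsub>free_module K X\<^esub> g = g \<oplus>\<^bsub>free_module K X\<^esub> f"
        using V[OF f] V[OF g] by (auto simp: a_comm)
      fix h assume h: "h \<in> carrier (free_module K X)"
      show "f \<oplus>\<^bsub>free_module K X\<^esub> g \<oplus>\<^bsub>free_module K X\<^esub> h = f \<oplus>\<^bsub>free_module K X\<^esub> (g \<oplus>\<^bsub>free_module K X\<^esub> h)"
        using V[OF f] V[OF g] V[OF h] by (auto simp: a_assoc)
    qed (simp add: free_module_simps(1))
    fix c f assume c: "c \<in> carrier K" and f: "f \<in> carrier (free_module K X)"
    show "c \<odot>\<^bsub>free_module K X\<^esub> f \<in> carrier (free_module K X)"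
      using c f fin_sub[of f f "\<lambda>x. c \<otimes>\<^bsub>K\<^esub> f x"] by (auto simp: free_module_simps(1))
    show "(c \<oplus>\<^bsub>K\<^esub> d) \<odot>\<^bsub>free_module K X\<^esub> f = c \<odot>\<^bsub>free_module K X\<^esub> f \<oplus>\<^bsub>free_module K X\<^esub> d \<odot>\<^bsub>free_module K X\<^esub> f"
      "(c \<otimes>\<^bsub>K\<^esub> d) \<odot>\<^bsub>free_module K X\<^esub> f = c \<odot>\<^bsub>free_module K X\<^esub> (d \<odot>\<^bsub>free_module K X\<^esub> f)"
      if "d \<in> carrier K" for d
      using c that V[OF f] by (auto simp: l_distr m_assoc)
    fix g assume g: "g \<in> carrier (free_module K X)"
    show "c \<odot>\<^bsub>free_module K X\<^esub> (f \<oplus>\<^bsub>free_module K X\<^esub> g)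
        = c \<odot>\<^bsub>free_module K X\<^esub> f \<oplus>\<^bsub>free_module K X\<^esub> c \<odot>\<^bsub>free_module K X\<^esub> g"
      using c V[OF f] V[OF g] by (auto simp: r_distr)
  next
    fix f assume f: "f \<in> carrier (free_module K X)"
    show "\<one>\<^bsub>K\<^esub> \<odot>\<^bsub>free_module K X\<^esub> f = f"
      using V[OF f] by auto
  qed
qed

lemma single_in_free_module:
  assumes "cring K" "x \<in> X"
  shows "single K x \<in> carrier (free_module K X)"
proof -
  interpret cring K by fact
  have "{y. single K x y \<noteq> \<zero>\<^bsub>K\<^esub>} \<subseteq> {x}" by (auto simp: single_def)
  then have "finite {y. single K x y \<noteq> \<zero>\<^bsub>K\<^esub>}" by (rule finite_subset) simp
  then show ?thesis using assms(2) by (auto simp: free_module_simps single_def)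
qed

text \<open>By induction on a finite set containing the support, splitting off one basis vector at a time.\<close>

lemma free_module_support_span:
  assumes "cring K" "f \<in> carrier (free_module K X)" "{x. f x \<noteq> \<zero>\<^bsub>K\<^esub>} \<subseteq> Y" "Y \<subseteq> X"
  shows "f \<in> lin_span K (free_module K X) (single K ` Y)"
proof -
  interpret cring K by fact
  let ?F = "free_module K X"
  have sub: "submodule (lin_span K ?F (single K ` Y)) K ?F"
    using assms(4)
    by (intro lin_span_submodule free_module_module[OF assms(1)])
      (auto intro: single_in_free_module[OF assms(1)])
  have "\<forall>f\<in>carrier ?F. {x. f x \<noteq> \<zero>\<^bsub>K\<^esub>} \<subseteq> S \<longrightarrow> f \<in> lin_span K ?F (single K ` Y)"
    if "finite S" "S \<subseteq> Y" for S
    using that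
  proof (induction S rule: finite_induct)
    case empty
    have "f = zero ?F" if "{x. f x \<noteq> \<zero>\<^bsub>K\<^esub>} \<subseteq> {}" for f
      using that by (auto simp: free_module_simps)
    then show ?case using submodule_zero[OF sub] by auto
  next
    case (insert s S)
    show ?case
    proof (intro ballI impI)
      fix f assume f: "f \<in> carrier ?F" and supp: "{x. f x \<noteq> \<zero>\<^bsub>K\<^esub>} \<subseteq> insert s S"
      let ?g = "f(s := \<zero>\<^bsub>K\<^esub>)"
      note V = free_module_value[OF assms(1) f]
      have "finite {x. f x \<noteq> \<zero>\<^bsub>K\<^esub>}" using f by (simp add: free_module_simps)
      then have "finite {x. ?g x \<noteq> \<zero>\<^bsub>K\<^esub>}" by (rule rev_finite_subset) auto
      then have "?g \<in> carrier ?F" using f by (simp add: free_module_simps)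
      moreover have "{x. ?g x \<noteq> \<zero>\<^bsub>K\<^esub>} \<subseteq> S" using supp by auto
      ultimately have "?g \<in> lin_span K ?F (single K ` Y)"
        using insert.IH insert.prems by blast
      moreover have "single K s \<in> lin_span K ?F (single K ` Y)"
        using insert.prems lin_span_superset[of "single K ` Y" K ?F] by auto
      moreover have "f = ?g \<oplus>\<^bsub>?F\<^esub> (f s \<odot>\<^bsub>?F\<^esub> single K s)"
        using V by (auto simp: free_module_simps single_def fun_eq_iff)
      ultimately show "f \<in> lin_span K ?F (single K ` Y)"
        using V submodule_add[OF sub] submodule_smult[OF sub] by metis
    qed
  qed
  then show ?thesis using assms(2,3) by (auto simp: free_module_simps)
qed

lemma free_module_span:
  assumes "cring K"
  shows "carrier (free_module K X) = lin_span K (free_module K X) (single K ` X)"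
proof
  have "submodule (lin_span K (free_module K X) (single K ` X)) K (free_module K X)"
    by (intro lin_span_submodule free_module_module[OF assms])
      (auto intro: single_in_free_module[OF assms])
  then show "lin_span K (free_module K X) (single K ` X) \<subseteq> carrier (free_module K X)"
    using submodule_carrier by auto
  show "carrier (free_module K X) \<subseteq> lin_span K (free_module K X) (single K ` X)"
  proof
    fix f assume f: "f \<in> carrier (free_module K X)"
    show "f \<in> lin_span K (free_module K X) (single K ` X)"
      by (rule free_module_support_span[OF assms f]) (use f in \<open>auto simp: free_module_simps\<close>)
  qed
qed

text \<open>The linear extension of \<open>f\<close> from the basis, written exactly as the sum over the support in
  \<open>tensor_lift\<close>.\<close>

definition free_extend ::
  "('k, 'x) ring_scheme \<Rightarrow> ('k, 'p, 'y) module_scheme \<Rightarrow> ('b \<Rightarrow> 'p) \<Rightarrow> ('b \<Rightarrow> 'k) \<Rightarrow> 'p"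
  where "free_extend K P f r = (\<Oplus>\<^bsub>P\<^esub>p\<in>{p. r p \<noteq> \<zero>\<^bsub>K\<^esub>}. r p \<odot>\<^bsub>P\<^esub> f p)"

text \<open>Points outside the support contribute zero, so the sum may be taken over any larger finite set.
  Additivity needs this: two vectors and their sum have different supports.\<close>

lemma free_extend_eq:
  assumes "module K P" "f \<in> X \<rightarrow> carrier P" "r \<in> carrier (free_module K X)"
    and "finite S" "{p. r p \<noteq> \<zero>\<^bsub>K\<^esub>} \<subseteq> S" "S \<subseteq> X"
  shows "free_extend K P f r = (\<Oplus>\<^bsub>P\<^esub>p\<in>S. r p \<odot>\<^bsub>P\<^esub> f p)"
proof -
  interpret P: module K P by fact
  have "r p \<odot>\<^bsub>P\<^esub> f p \<in> carrier P" if "p \<in> X" for p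
    using assms(2,3) that by (auto simp: free_module_simps)
  moreover have "r p \<odot>\<^bsub>P\<^esub> f p = \<zero>\<^bsub>P\<^esub>" if "p \<in> S - {p. r p \<noteq> \<zero>\<^bsub>K\<^esub>}" for p
    using that assms(2,6) by (auto simp: subset_iff Pi_iff)
  ultimately show ?thesis
    unfolding free_extend_def
    using assms(4-6) by (intro P.M.add.finprod_mono_neutral_cong_left) auto
qed

lemma free_extend_linear:
  assumes "module K P" "f \<in> X \<rightarrow> carrier P"
  shows "free_extend K P f \<in> linear_maps K (free_module K X) P"
proof -
  interpret P: module K P by fact
  let ?F = "free_module K X"
  interpret F: module K ?F by (rule free_module_module[OF P.R.is_cring])
  have supp: "finite {p. r p \<noteq> \<zero>\<^bsub>K\<^esub>}" "{p. r p \<noteq> \<zero>\<^bsub>K\<^esub>} \<subseteq> X" if "r \<in> carrier ?F" for r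
    using that by (auto simp: free_module_simps)
  note eq = free_extend_eq[OF assms]
  have cl: "r p \<odot>\<^bsub>P\<^esub> f p \<in> carrier P" if "r \<in> carrier ?F" "p \<in> X" for r p
    using assms(2) that by (auto simp: free_module_simps)
  show ?thesis
  proof (rule linear_mapsI)
    fix r assume r: "r \<in> carrier ?F"
    show "free_extend K P f r \<in> carrier P"
      unfolding free_extend_def by (rule P.M.finsum_closed) (use cl[OF r] supp[OF r] in auto)
    show "free_extend K P f (c \<odot>\<^bsub>?F\<^esub> r) = c \<odot>\<^bsub>P\<^esub> free_extend K P f r" if c: "c \<in> carrier K" for c
    proof -
      have "free_extend K P f (c \<odot>\<^bsub>?F\<^esub> r) = (\<Oplus>\<^bsub>P\<^esub>p\<in>{p. r p \<noteq> \<zero>\<^bsub>K\<^esub>}. (c \<odot>\<^bsub>?F\<^esub> r) p \<odot>\<^bsub>P\<^esub> f p)"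
        by (rule eq[OF F.smult_closed[OF c r] supp(1)[OF r] _ supp(2)[OF r]])
          (use c in \<open>auto simp: free_module_simps\<close>)
      also have "\<dots> = (\<Oplus>\<^bsub>P\<^esub>p\<in>{p. r p \<noteq> \<zero>\<^bsub>K\<^esub>}. c \<odot>\<^bsub>P\<^esub> (r p \<odot>\<^bsub>P\<^esub> f p))"
      proof (rule P.M.finsum_cong'[OF refl])
        fix p assume "p \<in> {p. r p \<noteq> \<zero>\<^bsub>K\<^esub>}"
        then have "p \<in> X" using supp[OF r] by auto
        then show "(c \<odot>\<^bsub>?F\<^esub> r) p \<odot>\<^bsub>P\<^esub> f p = c \<odot>\<^bsub>P\<^esub> (r p \<odot>\<^bsub>P\<^esub> f p)"
          using c r assms(2) by (auto simp: free_module_simps Pi_iff P.smult_assoc1)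
      qed (use cl[OF r] supp[OF r] c in auto)
      also have "\<dots> = c \<odot>\<^bsub>P\<^esub> free_extend K P f r"
        unfolding free_extend_def
        by (rule P.finsum_smult_ldistr[symmetric]) (use supp[OF r] c cl[OF r] in auto)
      finally show ?thesis .
    qed
    fix s assume s: "s \<in> carrier ?F"
    let ?S = "{p. r p \<noteq> \<zero>\<^bsub>K\<^esub>} \<union> {p. s p \<noteq> \<zero>\<^bsub>K\<^esub>}"
    have S: "finite ?S" "?S \<subseteq> X" using supp r s by auto
    have "free_extend K P f (r \<oplus>\<^bsub>?F\<^esub> s) = (\<Oplus>\<^bsub>P\<^esub>p\<in>?S. (r \<oplus>\<^bsub>?F\<^esub> s) p \<odot>\<^bsub>P\<^esub> f p)"
      by (rule eq[OF F.M.a_closed[OF r s] S(1) _ S(2)]) (auto simp: free_module_simps)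
    also have "\<dots> = (\<Oplus>\<^bsub>P\<^esub>p\<in>?S. r p \<odot>\<^bsub>P\<^esub> f p \<oplus>\<^bsub>P\<^esub> s p \<odot>\<^bsub>P\<^esub> f p)"
    proof (rule P.M.finsum_cong'[OF refl])
      fix p assume "p \<in> ?S"
      then have "p \<in> X" using S(2) by blast
      then show "(r \<oplus>\<^bsub>?F\<^esub> s) p \<odot>\<^bsub>P\<^esub> f p = r p \<odot>\<^bsub>P\<^esub> f p \<oplus>\<^bsub>P\<^esub> s p \<odot>\<^bsub>P\<^esub> f p"
        using r s assms(2) by (auto simp: free_module_simps Pi_iff P.smult_l_distr)
    qed (use cl[OF r] cl[OF s] S(2) in blast)
    also have "\<dots> = (\<Oplus>\<^bsub>P\<^esub>p\<in>?S. r p \<odot>\<^bsub>P\<^esub> f p) \<oplus>\<^bsub>P\<^esub> (\<Oplus>\<^bsub>P\<^esub>p\<in>?S. s p \<odot>\<^bsub>P\<^esub> f p)"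
      by (rule P.M.finsum_addf) (use cl[OF r] cl[OF s] S(2) in blast)+
    also have "\<dots> = free_extend K P f r \<oplus>\<^bsub>P\<^esub> free_extend K P f s"
      using eq[OF r S(1) _ S(2)] eq[OF s S(1) _ S(2)] by auto
    finally show "free_extend K P f (r \<oplus>\<^bsub>?F\<^esub> s) = free_extend K P f r \<oplus>\<^bsub>P\<^esub> free_extend K P f s" .
  qed
qed

lemma free_extend_single:
  assumes "module K P" "f \<in> X \<rightarrow> carrier P" "x \<in> X"
  shows "free_extend K P f (single K x) = f x"
proof -
  interpret P: module K P by fact
  have fx: "f x \<in> carrier P" using assms(2,3) by auto
  have "free_extend K P f (single K x) = (\<Oplus>\<^bsub>P\<^esub>p\<in>{x}. single K x p \<odot>\<^bsub>P\<^esub> f p)"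
    by (rule free_extend_eq[OF assms(1,2) single_in_free_module[OF P.R.is_cring assms(3)]])
      (auto simp: single_def assms(3))
  also have "\<dots> = f x" using fx by (simp add: single_def Pi_iff)
  finally show ?thesis .
qed

lemma free_algebra_simps:
  "carrier (free_algebra K G) = carrier (free_module K (lists G))"
  "zero (free_algebra K G) = zero (free_module K (lists G))"
  "add (free_algebra K G) = add (free_module K (lists G))"
  "smult (free_algebra K G) = smult (free_module K (lists G))"
  "one (free_algebra K G) = single K []"
  by (simp_all add: free_algebra_def)

lemma free_algebra_same_space: "same_space (free_module K (lists G)) (free_algebra K G)"
  by (simp add: same_space_def free_algebra_simps)

lemma free_algebra_span:
  assumes "cring K"
  shows "carrier (free_algebra K G) = lin_span K (free_algebra K G) (single K ` lists G)"
  using free_module_span[OF assms] by (simp add: free_algebra_simps lin_span_same_space[OF free_algebra_same_space])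

lemma free_algebra_mult:
  "(f \<otimes>\<^bsub>free_algebra K G\<^esub> g) w = (\<Oplus>\<^bsub>K\<^esub>i\<in>{..length w}. f (take i w) \<otimes>\<^bsub>K\<^esub> g (drop i w))"
  by (simp add: free_algebra_def)

lemma free_algebra_mult_single:
  assumes "cring K"
  shows "single K u \<otimes>\<^bsub>free_algebra K G\<^esub> single K v = single K (u @ v)"
proof
  interpret cring K by fact
  fix w
  \<comment> \<open>Only the cut after the first \<open>length u\<close> letters contributes.\<close>
  have "(single K u \<otimes>\<^bsub>free_algebra K G\<^esub> single K v) w =
      (\<Oplus>\<^bsub>K\<^esub>i\<in>{..length w}. if i = length u then (if w = u @ v then \<one>\<^bsub>K\<^esub> else \<zero>\<^bsub>K\<^esub>) else \<zero>\<^bsub>K\<^esub>)"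
    unfolding free_algebra_mult
  proof (rule finsum_cong'[OF refl])
    fix i assume "i \<in> {..length w}"
    then have "take i w = u \<and> drop i w = v \<longleftrightarrow> i = length u \<and> w = u @ v"
      by (metis append_eq_conv_conj append_take_drop_id atMost_iff length_take min.absorb2)
    moreover have "single K u (take i w) \<otimes>\<^bsub>K\<^esub> single K v (drop i w) =
        (if take i w = u \<and> drop i w = v then \<one>\<^bsub>K\<^esub> else \<zero>\<^bsub>K\<^esub>)"
      by (simp add: single_def)
    ultimately show "single K u (take i w) \<otimes>\<^bsub>K\<^esub> single K v (drop i w) =
        (if i = length u then (if w = u @ v then \<one>\<^bsub>K\<^esub> else \<zero>\<^bsub>K\<^esub>) else \<zero>\<^bsub>K\<^esub>)"
      by simp
  qed auto
  also have "\<dots> = single K (u @ v) w"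
  proof (cases "w = u @ v")
    case True
    then have "length u \<in> {..length w}" by simp
    from add.finprod_singleton_swap[OF this, of "\<lambda>i. if w = u @ v then \<one>\<^bsub>K\<^esub> else \<zero>\<^bsub>K\<^esub>"]
    show ?thesis using True by (simp add: single_def)
  next
    case False
    then show ?thesis by (simp add: single_def)
  qed
  finally show "(single K u \<otimes>\<^bsub>free_algebra K G\<^esub> single K v) w = single K (u @ v) w" .
qed

text \<open>This gives both the finiteness of the support of a product and the additivity of degrees.\<close>

lemma free_algebra_mult_nonzero:
  assumes "cring K" "f \<in> carrier (free_algebra K G)" "g \<in> carrier (free_algebra K G)"
    and "(f \<otimes>\<^bsub>free_algebra K G\<^esub> g) w \<noteq> \<zero>\<^bsub>K\<^esub>"
  shows "\<exists>i. f (take i w) \<noteq> \<zero>\<^bsub>K\<^esub> \<and> g (drop i w) \<noteq> \<zero>\<^bsub>K\<^esub>"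
proof (rule ccontr)
  interpret cring K by fact
  have V: "f x \<in> carrier K" "g x \<in> carrier K" for x
    using free_module_value[OF assms(1)] assms(2,3) by (simp_all add: free_algebra_simps)
  assume neg: "\<not> ?thesis"
  have "(f \<otimes>\<^bsub>free_algebra K G\<^esub> g) w = (\<Oplus>\<^bsub>K\<^esub>i\<in>{..length w}. \<zero>\<^bsub>K\<^esub>)"
    unfolding free_algebra_mult
  proof (rule finsum_cong'[OF refl])
    fix i
    have "f (take i w) = \<zero>\<^bsub>K\<^esub> \<or> g (drop i w) = \<zero>\<^bsub>K\<^esub>" using neg by blast
    then show "f (take i w) \<otimes>\<^bsub>K\<^esub> g (drop i w) = \<zero>\<^bsub>K\<^esub>" using V by auto
  qed auto
  then show False using assms(4) by simp
qed

lemma free_algebra_mult_closed: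
  assumes "cring K" "f \<in> carrier (free_algebra K G)" "g \<in> carrier (free_algebra K G)"
  shows "f \<otimes>\<^bsub>free_algebra K G\<^esub> g \<in> carrier (free_algebra K G)"
proof -
  interpret cring K by fact
  let ?h = "f \<otimes>\<^bsub>free_algebra K G\<^esub> g"
  have V: "f x \<in> carrier K" "g x \<in> carrier K" for x
    using free_module_value[OF assms(1)] assms(2,3) by (simp_all add: free_algebra_simps)
  note nz = free_algebra_mult_nonzero[OF assms]
  have fin: "finite {x. f x \<noteq> \<zero>\<^bsub>K\<^esub>}" "finite {x. g x \<noteq> \<zero>\<^bsub>K\<^esub>}"
    using assms(2,3) by (auto simp: free_algebra_simps free_module_simps)
  have "{w. ?h w \<noteq> \<zero>\<^bsub>K\<^esub>} \<subseteq> (\<lambda>(u, v). u @ v) ` ({x. f x \<noteq> \<zero>\<^bsub>K\<^esub>} \<times> {x. g x \<noteq> \<zero>\<^bsub>K\<^esub>})"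
  proof
    fix w assume "w \<in> {w. ?h w \<noteq> \<zero>\<^bsub>K\<^esub>}"
    then obtain i where "f (take i w) \<noteq> \<zero>\<^bsub>K\<^esub>" "g (drop i w) \<noteq> \<zero>\<^bsub>K\<^esub>" using nz by auto
    then show "w \<in> (\<lambda>(u, v). u @ v) ` ({x. f x \<noteq> \<zero>\<^bsub>K\<^esub>} \<times> {x. g x \<noteq> \<zero>\<^bsub>K\<^esub>})"
      by (intro image_eqI[of _ _ "(take i w, drop i w)"]) auto
  qed
  then have "finite {w. ?h w \<noteq> \<zero>\<^bsub>K\<^esub>}" by (rule finite_subset) (use fin in auto)
  moreover have "?h w = \<zero>\<^bsub>K\<^esub>" if "w \<notin> lists G" for w
  proof (rule ccontr)
    assume "?h w \<noteq> \<zero>\<^bsub>K\<^esub>"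
    then obtain i where i: "f (take i w) \<noteq> \<zero>\<^bsub>K\<^esub>" "g (drop i w) \<noteq> \<zero>\<^bsub>K\<^esub>" using nz by auto
    then have "take i w \<in> lists G" "drop i w \<in> lists G"
      using assms(2,3) by (auto simp: free_algebra_simps free_module_simps)
    then have "take i w @ drop i w \<in> lists G" by (simp only: append_in_lists_conv)
    then show False using that by simp
  qed
  moreover have "?h w \<in> carrier K" for w
    unfolding free_algebra_mult by (rule finsum_closed) (use V in auto)
  ultimately show ?thesis by (simp add: free_algebra_simps free_module_simps)
qed

lemma free_algebra_k_algebra:
  assumes "field K"
  shows "k_algebra K (free_algebra K G)"
proof -
  interpret field K by fact
  let ?F = "free_algebra K G"
  have V: "f x \<in> carrier K" if "f \<in> carrier ?F" for f x
    using free_module_value[OF is_cring] that by (simp add: free_algebra_simps)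
  have "(\<otimes>\<^bsub>?F\<^esub>) \<in> bilinear_maps K ?F ?F ?F"
  proof (intro bilinear_mapsI linear_mapsI)
    fix f g c assume f: "f \<in> carrier ?F" and g: "g \<in> carrier ?F"
    show "f \<otimes>\<^bsub>?F\<^esub> g \<in> carrier ?F" by (rule free_algebra_mult_closed[OF is_cring f g])
    show "f \<otimes>\<^bsub>?F\<^esub> g \<in> carrier ?F" by (rule free_algebra_mult_closed[OF is_cring f g])
    {
      fix c assume c: "c \<in> carrier K"
      show "f \<otimes>\<^bsub>?F\<^esub> (c \<odot>\<^bsub>?F\<^esub> g) = c \<odot>\<^bsub>?F\<^esub> (f \<otimes>\<^bsub>?F\<^esub> g)"
        "(c \<odot>\<^bsub>?F\<^esub> f) \<otimes>\<^bsub>?F\<^esub> g = c \<odot>\<^bsub>?F\<^esub> (f \<otimes>\<^bsub>?F\<^esub> g)"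
        using V[OF f] V[OF g] c
        by (auto simp: fun_eq_iff free_algebra_mult free_algebra_simps free_module_simps
            finsum_rdistr m_lcomm m_assoc intro!: finsum_cong')
    }
    fix h assume h: "h \<in> carrier ?F"
    show "f \<otimes>\<^bsub>?F\<^esub> (g \<oplus>\<^bsub>?F\<^esub> h) = f \<otimes>\<^bsub>?F\<^esub> g \<oplus>\<^bsub>?F\<^esub> f \<otimes>\<^bsub>?F\<^esub> h"
      using V[OF f] V[OF g] V[OF h]
      by (auto simp: fun_eq_iff free_algebra_mult free_algebra_simps free_module_simps
          finsum_addf[symmetric] r_distr Pi_iff simp del: finsum_addf intro!: finsum_cong')
    show "(g \<oplus>\<^bsub>?F\<^esub> h) \<otimes>\<^bsub>?F\<^esub> f = g \<otimes>\<^bsub>?F\<^esub> f \<oplus>\<^bsub>?F\<^esub> h \<otimes>\<^bsub>?F\<^esub> f"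
      using V[OF f] V[OF g] V[OF h]
      by (auto simp: fun_eq_iff free_algebra_mult free_algebra_simps free_module_simps
          finsum_addf[symmetric] l_distr Pi_iff simp del: finsum_addf intro!: finsum_cong')
  qed
  moreover have "\<one>\<^bsub>?F\<^esub> \<in> carrier ?F"
    using single_in_free_module[OF is_cring, of "[]" "lists G"] by (simp add: free_algebra_simps)
  ultimately show ?thesis
    by (rule k_algebraI_span[OF assms module_same_space[OF free_module_module[OF is_cring] free_algebra_same_space] _ _ free_algebra_span[OF is_cring]])
      (auto simp: free_algebra_simps(5) free_algebra_mult_single[OF is_cring])
qed

section \<open>Gradings\<close>

text \<open>Directness of the decomposition is expressed by linear projections: for each \<open>\<gamma>\<close> some linear map
  fixes the component of degree \<open>\<gamma>\<close> and kills the others.  Together with spanning this is equivalent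
  to unique decomposition, and it passes to quotients and to tensor products, because linear maps
  do.\<close>

definition grading ::
  "('k, 'x) ring_scheme \<Rightarrow> ('g, 'w) monoid_scheme \<Rightarrow> ('k, 'a, 'y) module_scheme \<Rightarrow> ('g \<Rightarrow> 'a set) \<Rightarrow> bool"
  where "grading K \<Gamma> M gr \<longleftrightarrow> module K M \<and> (\<forall>\<gamma>\<in>carrier \<Gamma>. submodule (gr \<gamma>) K M) \<and>
    carrier M = lin_span K M (\<Union>\<gamma>\<in>carrier \<Gamma>. gr \<gamma>) \<and>
    (\<forall>\<gamma>\<in>carrier \<Gamma>. \<exists>p\<in>linear_maps K M M. \<forall>\<delta>\<in>carrier \<Gamma>. \<forall>x\<in>gr \<delta>. p x = (if \<delta> = \<gamma> then x else \<zero>\<^bsub>M\<^esub>))"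

lemma gradingI:
  assumes "module K M" "\<And>\<gamma>. \<gamma> \<in> carrier \<Gamma> \<Longrightarrow> submodule (gr \<gamma>) K M"
    and "carrier M = lin_span K M (\<Union>\<gamma>\<in>carrier \<Gamma>. gr \<gamma>)"
    and "\<And>\<gamma>. \<gamma> \<in> carrier \<Gamma> \<Longrightarrow> p \<gamma> \<in> linear_maps K M M"
    and "\<And>\<gamma> \<delta> x. \<gamma> \<in> carrier \<Gamma> \<Longrightarrow> \<delta> \<in> carrier \<Gamma> \<Longrightarrow> x \<in> gr \<delta> \<Longrightarrow>
      p \<gamma> x = (if \<delta> = \<gamma> then x else \<zero>\<^bsub>M\<^esub>)"
  shows "grading K \<Gamma> M gr"
  unfolding grading_def using assms by blast

lemma grading_module: "grading K \<Gamma> M gr \<Longrightarrow> module K M"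
  and grading_submodule: "grading K \<Gamma> M gr \<Longrightarrow> \<gamma> \<in> carrier \<Gamma> \<Longrightarrow> submodule (gr \<gamma>) K M"
  and grading_span: "grading K \<Gamma> M gr \<Longrightarrow> carrier M = lin_span K M (\<Union>\<gamma>\<in>carrier \<Gamma>. gr \<gamma>)"
  by (simp_all add: grading_def)

lemma grading_carrier: "grading K \<Gamma> M gr \<Longrightarrow> \<gamma> \<in> carrier \<Gamma> \<Longrightarrow> x \<in> gr \<gamma> \<Longrightarrow> x \<in> carrier M"
  using submodule_carrier[OF grading_submodule] .

lemma grading_same_space:
  assumes "grading K \<Gamma> M gr" "same_space M N"
  shows "grading K \<Gamma> N gr"
proof -
  have "carrier N = carrier M" "zero N = zero M" using assms(2) by (auto simp: same_space_def)
  then show ?thesis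
    using assms(1) module_same_space[OF grading_module[OF assms(1)] assms(2)]
    unfolding grading_def submodule_same_space[OF assms(2)] lin_span_same_space[OF assms(2)]
      linear_maps_same_space[OF assms(2,2)]
    by metis
qed

lemma grading_induct [consumes 2, case_names homogeneous zero add smult]:
  assumes "grading K \<Gamma> M gr" "x \<in> carrier M"
    and "\<And>\<gamma> x. \<gamma> \<in> carrier \<Gamma> \<Longrightarrow> x \<in> gr \<gamma> \<Longrightarrow> P x"
    and "P \<zero>\<^bsub>M\<^esub>"
    and "\<And>x y. x \<in> carrier M \<Longrightarrow> y \<in> carrier M \<Longrightarrow> P x \<Longrightarrow> P y \<Longrightarrow> P (x \<oplus>\<^bsub>M\<^esub> y)"
    and "\<And>c x. c \<in> carrier K \<Longrightarrow> x \<in> carrier M \<Longrightarrow> P x \<Longrightarrow> P (c \<odot>\<^bsub>M\<^esub> x)"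
  shows "P x"
proof -
  have "x \<in> lin_span K M (\<Union>\<gamma>\<in>carrier \<Gamma>. gr \<gamma>)"
    using assms(2) grading_span[OF assms(1)] by simp
  moreover have "(\<Union>\<gamma>\<in>carrier \<Gamma>. gr \<gamma>) \<subseteq> carrier M"
    using grading_carrier[OF assms(1)] by blast
  ultimately show ?thesis
    by (rule lin_span_induct[OF grading_module[OF assms(1)]]) (use assms(3-) in auto)
qed

context
  fixes K :: "('k, 'x) ring_scheme" and \<Gamma> :: "('g, 'w) monoid_scheme"
    and M :: "('k, 'a, 'y) module_scheme" and gr :: "'g \<Rightarrow> 'a set"
  assumes gr: "grading K \<Gamma> M gr"
begin

interpretation M: module K M by (rule grading_module[OF gr])

definition graded_proj :: "'g \<Rightarrow> 'a \<Rightarrow> 'a"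
  where "graded_proj \<gamma> = (SOME p. p \<in> linear_maps K M M \<and>
    (\<forall>\<delta>\<in>carrier \<Gamma>. \<forall>x\<in>gr \<delta>. p x = (if \<delta> = \<gamma> then x else \<zero>\<^bsub>M\<^esub>)))"

lemma graded_proj:
  assumes "\<gamma> \<in> carrier \<Gamma>"
  shows "graded_proj \<gamma> \<in> linear_maps K M M"
    and "\<And>\<delta> x. \<delta> \<in> carrier \<Gamma> \<Longrightarrow> x \<in> gr \<delta> \<Longrightarrow> graded_proj \<gamma> x = (if \<delta> = \<gamma> then x else \<zero>\<^bsub>M\<^esub>)"
proof -
  have "\<exists>p. p \<in> linear_maps K M M \<and> (\<forall>\<delta>\<in>carrier \<Gamma>. \<forall>x\<in>gr \<delta>. p x = (if \<delta> = \<gamma> then x else \<zero>\<^bsub>M\<^esub>))"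
    using gr assms unfolding grading_def by blast
  from someI_ex[OF this]
  show "graded_proj \<gamma> \<in> linear_maps K M M"
    and "\<And>\<delta> x. \<delta> \<in> carrier \<Gamma> \<Longrightarrow> x \<in> gr \<delta> \<Longrightarrow> graded_proj \<gamma> x = (if \<delta> = \<gamma> then x else \<zero>\<^bsub>M\<^esub>)"
    unfolding graded_proj_def[symmetric] by blast+
qed

lemma graded_proj_in:
  assumes "x \<in> carrier M" "\<gamma> \<in> carrier \<Gamma>"
  shows "graded_proj \<gamma> x \<in> gr \<gamma>"
proof -
  note S = grading_submodule[OF gr assms(2)]
  show ?thesis
    using gr assms(1)
    by (induction rule: grading_induct)
      (auto simp: graded_proj[OF assms(2)] linear_mapD[OF graded_proj(1)[OF assms(2)]]
        linear_map_zero[OF grading_module[OF gr] grading_module[OF gr] graded_proj(1)[OF assms(2)]]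
        submodule_zero[OF S] submodule_add[OF S] submodule_smult[OF S])
qed

lemma finite_graded_proj_support:
  assumes "x \<in> carrier M"
  shows "finite {\<gamma> \<in> carrier \<Gamma>. graded_proj \<gamma> x \<noteq> \<zero>\<^bsub>M\<^esub>}"
  using gr assms
proof (induction rule: grading_induct)
  case (homogeneous \<delta> x)
  have "{\<gamma> \<in> carrier \<Gamma>. graded_proj \<gamma> x \<noteq> \<zero>\<^bsub>M\<^esub>} \<subseteq> {\<delta>}"
    using homogeneous by (auto simp: graded_proj(2) split: if_splits)
  then show ?case by (rule finite_subset) simp
next
  case zero
  have "{\<gamma> \<in> carrier \<Gamma>. graded_proj \<gamma> \<zero>\<^bsub>M\<^esub> \<noteq> \<zero>\<^bsub>M\<^esub>} = {}"
    using linear_map_zero[OF grading_module[OF gr] grading_module[OF gr] graded_proj(1)] by auto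
  then show ?case by (metis finite.emptyI)
next
  case (add x y)
  have "{\<gamma> \<in> carrier \<Gamma>. graded_proj \<gamma> (x \<oplus>\<^bsub>M\<^esub> y) \<noteq> \<zero>\<^bsub>M\<^esub>} \<subseteq>
      {\<gamma> \<in> carrier \<Gamma>. graded_proj \<gamma> x \<noteq> \<zero>\<^bsub>M\<^esub>} \<union> {\<gamma> \<in> carrier \<Gamma>. graded_proj \<gamma> y \<noteq> \<zero>\<^bsub>M\<^esub>}"
    using add by (auto simp: linear_map_add[OF graded_proj(1)])
  then show ?case by (rule finite_subset) (use add in simp)
next
  case (smult c x)
  have "{\<gamma> \<in> carrier \<Gamma>. graded_proj \<gamma> (c \<odot>\<^bsub>M\<^esub> x) \<noteq> \<zero>\<^bsub>M\<^esub>} \<subseteq> {\<gamma> \<in> carrier \<Gamma>. graded_proj \<gamma> x \<noteq> \<zero>\<^bsub>M\<^esub>}"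
    using smult by (auto simp: linear_map_smult[OF graded_proj(1)])
  then show ?case by (rule finite_subset) (use smult in simp)
qed

text \<open>A linear map may be prescribed freely on each component.  The sum runs over the support of \<open>x\<close>; as
  in the case of free modules, it is linear because it does not change when the support is enlarged.\<close>

lemma graded_sum_linear:
  assumes "module K N" "\<And>\<gamma>. \<gamma> \<in> carrier \<Gamma> \<Longrightarrow> F \<gamma> \<in> linear_maps K M N"
  shows "(\<lambda>x. \<Oplus>\<^bsub>N\<^esub>\<gamma>\<in>{\<gamma> \<in> carrier \<Gamma>. graded_proj \<gamma> x \<noteq> \<zero>\<^bsub>M\<^esub>}. F \<gamma> (graded_proj \<gamma> x)) \<in> linear_maps K M N"
    and "\<delta> \<in> carrier \<Gamma> \<Longrightarrow> x \<in> gr \<delta> \<Longrightarrow>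
      (\<Oplus>\<^bsub>N\<^esub>\<gamma>\<in>{\<gamma> \<in> carrier \<Gamma>. graded_proj \<gamma> x \<noteq> \<zero>\<^bsub>M\<^esub>}. F \<gamma> (graded_proj \<gamma> x)) = F \<delta> x"
proof -
  interpret N: module K N by fact
  define supp where "supp x = {\<gamma> \<in> carrier \<Gamma>. graded_proj \<gamma> x \<noteq> \<zero>\<^bsub>M\<^esub>}" for x
  have supp: "finite (supp x)" "supp x \<subseteq> carrier \<Gamma>" if "x \<in> carrier M" for x
    using finite_graded_proj_support[OF that] by (auto simp: supp_def)
  have FL: "(\<lambda>x. F \<gamma> (graded_proj \<gamma> x)) \<in> linear_maps K M N" if "\<gamma> \<in> carrier \<Gamma>" for \<gamma>
    by (rule linear_map_comp[OF graded_proj(1)[OF that] assms(2)[OF that]])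
  note cl = linear_map_closed[OF FL]
  have ext: "(\<Oplus>\<^bsub>N\<^esub>\<gamma>\<in>supp x. F \<gamma> (graded_proj \<gamma> x)) = (\<Oplus>\<^bsub>N\<^esub>\<gamma>\<in>S. F \<gamma> (graded_proj \<gamma> x))"
    if x: "x \<in> carrier M" and S: "finite S" "S \<subseteq> carrier \<Gamma>" "supp x \<subseteq> S" for x S
  proof (rule N.M.add.finprod_mono_neutral_cong_left[OF S(1,3)])
    fix \<gamma> assume "\<gamma> \<in> S - supp x"
    then have "\<gamma> \<in> carrier \<Gamma>" "graded_proj \<gamma> x = \<zero>\<^bsub>M\<^esub>" using S by (auto simp: supp_def)
    then show "F \<gamma> (graded_proj \<gamma> x) = \<zero>\<^bsub>N\<^esub>"
      using linear_map_zero[OF grading_module[OF gr] assms(1) assms(2)] by simp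
  qed (use cl[OF _ x] S in auto)
  have "(\<lambda>x. \<Oplus>\<^bsub>N\<^esub>\<gamma>\<in>supp x. F \<gamma> (graded_proj \<gamma> x)) \<in> linear_maps K M N"
  proof (rule linear_mapsI)
    fix x assume x: "x \<in> carrier M"
    note sx = supp[OF x]
    show "(\<Oplus>\<^bsub>N\<^esub>\<gamma>\<in>supp x. F \<gamma> (graded_proj \<gamma> x)) \<in> carrier N"
      by (rule N.M.finsum_closed) (use cl[OF _ x] sx in auto)
    show "(\<Oplus>\<^bsub>N\<^esub>\<gamma>\<in>supp (c \<odot>\<^bsub>M\<^esub> x). F \<gamma> (graded_proj \<gamma> (c \<odot>\<^bsub>M\<^esub> x))) = c \<odot>\<^bsub>N\<^esub> (\<Oplus>\<^bsub>N\<^esub>\<gamma>\<in>supp x. F \<gamma> (graded_proj \<gamma> x))"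
      if c: "c \<in> carrier K" for c
    proof -
      have "supp (c \<odot>\<^bsub>M\<^esub> x) \<subseteq> supp x"
        using c x by (auto simp: supp_def linear_map_smult[OF graded_proj(1)])
      then have "(\<Oplus>\<^bsub>N\<^esub>\<gamma>\<in>supp (c \<odot>\<^bsub>M\<^esub> x). F \<gamma> (graded_proj \<gamma> (c \<odot>\<^bsub>M\<^esub> x))) = (\<Oplus>\<^bsub>N\<^esub>\<gamma>\<in>supp x. F \<gamma> (graded_proj \<gamma> (c \<odot>\<^bsub>M\<^esub> x)))"
        using ext[of "c \<odot>\<^bsub>M\<^esub> x" "supp x"] c x sx by simp
      also have "\<dots> = (\<Oplus>\<^bsub>N\<^esub>\<gamma>\<in>supp x. c \<odot>\<^bsub>N\<^esub> F \<gamma> (graded_proj \<gamma> x))"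
        by (rule N.M.finsum_cong'[OF refl])
          (use c x sx cl[OF _ x] linear_map_smult[OF FL] in auto)
      also have "\<dots> = c \<odot>\<^bsub>N\<^esub> (\<Oplus>\<^bsub>N\<^esub>\<gamma>\<in>supp x. F \<gamma> (graded_proj \<gamma> x))"
        by (rule N.finsum_smult_ldistr[symmetric]) (use c sx cl[OF _ x] in auto)
      finally show ?thesis .
    qed
    fix y assume y: "y \<in> carrier M"
    note sy = supp[OF y]
    let ?S = "supp x \<union> supp y"
    have S: "finite ?S" "?S \<subseteq> carrier \<Gamma>" using sx sy by auto
    have sub: "supp (x \<oplus>\<^bsub>M\<^esub> y) \<subseteq> ?S"
      using x y by (auto simp: supp_def linear_map_add[OF graded_proj(1)])
    have "(\<Oplus>\<^bsub>N\<^esub>\<gamma>\<in>supp (x \<oplus>\<^bsub>M\<^esub> y). F \<gamma> (graded_proj \<gamma> (x \<oplus>\<^bsub>M\<^esub> y))) = (\<Oplus>\<^bsub>N\<^esub>\<gamma>\<in>?S. F \<gamma> (graded_proj \<gamma> (x \<oplus>\<^bsub>M\<^esub> y)))"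
      by (rule ext[OF M.M.a_closed[OF x y] S sub])
    also have "\<dots> = (\<Oplus>\<^bsub>N\<^esub>\<gamma>\<in>?S. F \<gamma> (graded_proj \<gamma> x) \<oplus>\<^bsub>N\<^esub> F \<gamma> (graded_proj \<gamma> y))"
      by (rule N.M.finsum_cong'[OF refl])
        (use x y S cl[OF _ x] cl[OF _ y] linear_map_add[OF FL] in auto)
    also have "\<dots> = (\<Oplus>\<^bsub>N\<^esub>\<gamma>\<in>?S. F \<gamma> (graded_proj \<gamma> x)) \<oplus>\<^bsub>N\<^esub> (\<Oplus>\<^bsub>N\<^esub>\<gamma>\<in>?S. F \<gamma> (graded_proj \<gamma> y))"
      by (rule N.M.finsum_addf) (use S cl[OF _ x] cl[OF _ y] in auto)
    also have "\<dots> = (\<Oplus>\<^bsub>N\<^esub>\<gamma>\<in>supp x. F \<gamma> (graded_proj \<gamma> x)) \<oplus>\<^bsub>N\<^esub> (\<Oplus>\<^bsub>N\<^esub>\<gamma>\<in>supp y. F \<gamma> (graded_proj \<gamma> y))"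
      using ext[OF x S] ext[OF y S] by simp
    finally show "(\<Oplus>\<^bsub>N\<^esub>\<gamma>\<in>supp (x \<oplus>\<^bsub>M\<^esub> y). F \<gamma> (graded_proj \<gamma> (x \<oplus>\<^bsub>M\<^esub> y))) =
      (\<Oplus>\<^bsub>N\<^esub>\<gamma>\<in>supp x. F \<gamma> (graded_proj \<gamma> x)) \<oplus>\<^bsub>N\<^esub> (\<Oplus>\<^bsub>N\<^esub>\<gamma>\<in>supp y. F \<gamma> (graded_proj \<gamma> y))" .
  qed
  then show "(\<lambda>x. \<Oplus>\<^bsub>N\<^esub>\<gamma>\<in>{\<gamma> \<in> carrier \<Gamma>. graded_proj \<gamma> x \<noteq> \<zero>\<^bsub>M\<^esub>}. F \<gamma> (graded_proj \<gamma> x)) \<in> linear_maps K M N"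
    by (simp add: supp_def)
  assume \<delta>: "\<delta> \<in> carrier \<Gamma>" and x: "x \<in> gr \<delta>"
  have xM: "x \<in> carrier M" by (rule grading_carrier[OF gr \<delta> x])
  have "supp x \<subseteq> {\<delta>}"
    using x \<delta> by (auto simp: supp_def graded_proj(2) split: if_splits)
  then have "(\<Oplus>\<^bsub>N\<^esub>\<gamma>\<in>supp x. F \<gamma> (graded_proj \<gamma> x)) = (\<Oplus>\<^bsub>N\<^esub>\<gamma>\<in>{\<delta>}. F \<gamma> (graded_proj \<gamma> x))"
    using ext[OF xM, of "{\<delta>}"] \<delta> by simp
  also have "\<dots> = F \<delta> x"
    using cl[OF \<delta> xM] x \<delta> graded_proj(2)[OF \<delta> \<delta> x] by (simp add: Pi_iff)
  finally show "(\<Oplus>\<^bsub>N\<^esub>\<gamma>\<in>{\<gamma> \<in> carrier \<Gamma>. graded_proj \<gamma> x \<noteq> \<zero>\<^bsub>M\<^esub>}. F \<gamma> (graded_proj \<gamma> x)) = F \<delta> x"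
    by (simp add: supp_def)
qed

text \<open>Uniqueness is seen by applying the projection of degree \<open>\<delta>\<close> to a decomposition of \<open>x\<close>: only the
  summand of degree \<open>\<delta>\<close> survives.\<close>

lemma homogeneous_components_eq_graded_proj:
  assumes x: "x \<in> carrier M"
  shows "homogeneous_components \<Gamma> M gr x = (\<lambda>\<gamma>\<in>carrier \<Gamma>. graded_proj \<gamma> x)"
proof -
  let ?d = "\<lambda>\<gamma>\<in>carrier \<Gamma>. graded_proj \<gamma> x"
  have sum: "x = (\<Oplus>\<^bsub>M\<^esub>\<gamma>\<in>{\<gamma> \<in> carrier \<Gamma>. graded_proj \<gamma> x \<noteq> \<zero>\<^bsub>M\<^esub>}. graded_proj \<gamma> x)"
  proof (rule linear_maps_eqI[OF grading_module[OF gr] grading_module[OF gr] grading_span[OF gr]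
        linear_map_id graded_sum_linear(1)[OF grading_module[OF gr] linear_map_id] _ x])
    fix s assume "s \<in> (\<Union>\<gamma>\<in>carrier \<Gamma>. gr \<gamma>)"
    then show "s = (\<Oplus>\<^bsub>M\<^esub>\<gamma>\<in>{\<gamma> \<in> carrier \<Gamma>. graded_proj \<gamma> s \<noteq> \<zero>\<^bsub>M\<^esub>}. graded_proj \<gamma> s)"
      using graded_sum_linear(2)[OF grading_module[OF gr] linear_map_id] by force
  qed
  have supp: "{\<gamma> \<in> carrier \<Gamma>. ?d \<gamma> \<noteq> \<zero>\<^bsub>M\<^esub>} = {\<gamma> \<in> carrier \<Gamma>. graded_proj \<gamma> x \<noteq> \<zero>\<^bsub>M\<^esub>}" by auto
  have pM: "graded_proj \<gamma> x \<in> carrier M" if "\<gamma> \<in> carrier \<Gamma>" for \<gamma>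
    using linear_map_closed[OF graded_proj(1)[OF that] x] .
  show ?thesis
    unfolding homogeneous_components_def
  proof (rule the_equality)
    have "(\<Oplus>\<^bsub>M\<^esub>\<gamma>\<in>{\<gamma> \<in> carrier \<Gamma>. ?d \<gamma> \<noteq> \<zero>\<^bsub>M\<^esub>}. ?d \<gamma>) =
        (\<Oplus>\<^bsub>M\<^esub>\<gamma>\<in>{\<gamma> \<in> carrier \<Gamma>. graded_proj \<gamma> x \<noteq> \<zero>\<^bsub>M\<^esub>}. graded_proj \<gamma> x)"
      by (rule M.M.finsum_cong'[OF supp]) (use pM in auto)
    then show "?d \<in> (\<Pi>\<^sub>E \<gamma>\<in>carrier \<Gamma>. gr \<gamma>) \<and> finite {\<gamma> \<in> carrier \<Gamma>. ?d \<gamma> \<noteq> \<zero>\<^bsub>M\<^esub>} \<and>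
        x = (\<Oplus>\<^bsub>M\<^esub>\<gamma>\<in>{\<gamma> \<in> carrier \<Gamma>. ?d \<gamma> \<noteq> \<zero>\<^bsub>M\<^esub>}. ?d \<gamma>)"
      using sum supp finite_graded_proj_support[OF x] graded_proj_in[OF x] by auto
  next
    fix d
    let ?S = "{\<gamma> \<in> carrier \<Gamma>. d \<gamma> \<noteq> \<zero>\<^bsub>M\<^esub>}"
    assume d: "d \<in> (\<Pi>\<^sub>E \<gamma>\<in>carrier \<Gamma>. gr \<gamma>) \<and> finite ?S \<and> x = (\<Oplus>\<^bsub>M\<^esub>\<gamma>\<in>?S. d \<gamma>)"
    then have dg: "d \<gamma> \<in> gr \<gamma>" "d \<gamma> \<in> carrier M" if "\<gamma> \<in> carrier \<Gamma>" for \<gamma>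
      using that grading_carrier[OF gr that] by auto
    have "graded_proj \<delta> x = d \<delta>" if \<delta>: "\<delta> \<in> carrier \<Gamma>" for \<delta>
    proof -
      have "graded_proj \<delta> x = (\<Oplus>\<^bsub>M\<^esub>\<gamma>\<in>?S. graded_proj \<delta> (d \<gamma>))"
        using linear_map_finsum[OF grading_module[OF gr] grading_module[OF gr] graded_proj(1)[OF \<delta>], of ?S d]
          d dg by auto
      also have "\<dots> = (\<Oplus>\<^bsub>M\<^esub>\<gamma>\<in>?S. if \<gamma> = \<delta> then d \<gamma> else \<zero>\<^bsub>M\<^esub>)"
        by (rule M.M.finsum_cong'[OF refl]) (use dg graded_proj(2)[OF \<delta>] in auto)
      also have "\<dots> = d \<delta>"
      proof (cases "d \<delta> = \<zero>\<^bsub>M\<^esub>")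
        case True
        have "(\<Oplus>\<^bsub>M\<^esub>\<gamma>\<in>?S. if \<gamma> = \<delta> then d \<gamma> else \<zero>\<^bsub>M\<^esub>) = (\<Oplus>\<^bsub>M\<^esub>\<gamma>\<in>?S. \<zero>\<^bsub>M\<^esub>)"
          by (rule M.M.finsum_cong'[OF refl]) (use True in auto)
        then show ?thesis using True by simp
      next
        case False
        then show ?thesis
          using M.M.add.finprod_singleton_swap[of \<delta> ?S d] \<delta> d dg by auto
      qed
      finally show ?thesis .
    qed
    with d show "d = ?d" by (auto simp: fun_eq_iff PiE_iff extensional_def)
  qed
qed

text \<open>The extension from components, in the form in which it occurs in the definition of the graded
  twist.  The last part makes that sum a finite one of vectors in \<open>M\<close>.\<close>

lemma graded_extension:
  assumes "module K N" "\<And>\<gamma>. \<gamma> \<in> carrier \<Gamma> \<Longrightarrow> F \<gamma> \<in> linear_maps K M N"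
  shows "(\<lambda>x. let d = homogeneous_components \<Gamma> M gr x in
      \<Oplus>\<^bsub>N\<^esub>\<gamma>\<in>{\<gamma> \<in> carrier \<Gamma>. d \<gamma> \<noteq> \<zero>\<^bsub>M\<^esub>}. F \<gamma> (d \<gamma>)) \<in> linear_maps K M N"
    and "\<delta> \<in> carrier \<Gamma> \<Longrightarrow> x \<in> gr \<delta> \<Longrightarrow> (let d = homogeneous_components \<Gamma> M gr x in
      \<Oplus>\<^bsub>N\<^esub>\<gamma>\<in>{\<gamma> \<in> carrier \<Gamma>. d \<gamma> \<noteq> \<zero>\<^bsub>M\<^esub>}. F \<gamma> (d \<gamma>)) = F \<delta> x"
    and "y \<in> carrier M \<Longrightarrow> d = homogeneous_components \<Gamma> M gr y \<Longrightarrow>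
      finite {\<gamma> \<in> carrier \<Gamma>. d \<gamma> \<noteq> \<zero>\<^bsub>M\<^esub>} \<and> (\<forall>\<gamma>\<in>carrier \<Gamma>. d \<gamma> \<in> carrier M)"
proof -
  interpret N: module K N by fact
  have eq: "(let d = homogeneous_components \<Gamma> M gr x in
      \<Oplus>\<^bsub>N\<^esub>\<gamma>\<in>{\<gamma> \<in> carrier \<Gamma>. d \<gamma> \<noteq> \<zero>\<^bsub>M\<^esub>}. F \<gamma> (d \<gamma>)) =
      (\<Oplus>\<^bsub>N\<^esub>\<gamma>\<in>{\<gamma> \<in> carrier \<Gamma>. graded_proj \<gamma> x \<noteq> \<zero>\<^bsub>M\<^esub>}. F \<gamma> (graded_proj \<gamma> x))" if x: "x \<in> carrier M" for x
    unfolding homogeneous_components_eq_graded_proj[OF x] Let_def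
    by (rule N.M.finsum_cong')
      (use linear_map_closed[OF assms(2)] linear_map_closed[OF graded_proj(1) x] in auto)
  show "(\<lambda>x. let d = homogeneous_components \<Gamma> M gr x in
      \<Oplus>\<^bsub>N\<^esub>\<gamma>\<in>{\<gamma> \<in> carrier \<Gamma>. d \<gamma> \<noteq> \<zero>\<^bsub>M\<^esub>}. F \<gamma> (d \<gamma>)) \<in> linear_maps K M N"
    by (rule linear_map_cong[OF grading_module[OF gr] graded_sum_linear(1)[OF assms] eq])
  show "\<delta> \<in> carrier \<Gamma> \<Longrightarrow> x \<in> gr \<delta> \<Longrightarrow> (let d = homogeneous_components \<Gamma> M gr x in
      \<Oplus>\<^bsub>N\<^esub>\<gamma>\<in>{\<gamma> \<in> carrier \<Gamma>. d \<gamma> \<noteq> \<zero>\<^bsub>M\<^esub>}. F \<gamma> (d \<gamma>)) = F \<delta> x"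
    using eq[OF grading_carrier[OF gr]] graded_sum_linear(2)[OF assms] by auto
  show "finite {\<gamma> \<in> carrier \<Gamma>. d \<gamma> \<noteq> \<zero>\<^bsub>M\<^esub>} \<and> (\<forall>\<gamma>\<in>carrier \<Gamma>. d \<gamma> \<in> carrier M)"
    if y: "y \<in> carrier M" and d: "d = homogeneous_components \<Gamma> M gr y"
  proof -
    have "{\<gamma> \<in> carrier \<Gamma>. d \<gamma> \<noteq> \<zero>\<^bsub>M\<^esub>} = {\<gamma> \<in> carrier \<Gamma>. graded_proj \<gamma> y \<noteq> \<zero>\<^bsub>M\<^esub>}"
      unfolding d homogeneous_components_eq_graded_proj[OF y] by auto
    then show ?thesis
      using finite_graded_proj_support[OF y] linear_map_closed[OF graded_proj(1) y]
      by (auto simp: d homogeneous_components_eq_graded_proj[OF y])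
  qed
qed

end

text \<open>A projection of \<open>M\<close> maps each homogeneous element of the kernel to itself or to zero.  Since these
  elements span the kernel, the projection preserves the kernel and descends to \<open>N\<close>.\<close>

lemma grading_surjective_image:
  assumes gr: "grading K \<Gamma> M gr" and N: "module K N"
    and p: "p \<in> linear_maps K M N" "p ` carrier M = carrier N"
    and ker: "\<And>x. x \<in> carrier M \<Longrightarrow> p x = \<zero>\<^bsub>N\<^esub> \<Longrightarrow>
      x \<in> lin_span K M (\<Union>\<gamma>\<in>carrier \<Gamma>. {y \<in> gr \<gamma>. p y = \<zero>\<^bsub>N\<^esub>})"
  shows "grading K \<Gamma> N (\<lambda>\<gamma>. p ` gr \<gamma>)"
proof -
  note M = grading_module[OF gr]
  interpret N: module K N by fact
  let ?U = "\<Union>\<gamma>\<in>carrier \<Gamma>. {y \<in> gr \<gamma>. p y = \<zero>\<^bsub>N\<^esub>}"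
  have U: "?U \<subseteq> carrier M" using grading_carrier[OF gr] by blast
  have "\<exists>g\<in>linear_maps K N N. \<forall>x\<in>carrier M. g (p x) = p (graded_proj K \<Gamma> M gr \<gamma> x)"
    if \<gamma>: "\<gamma> \<in> carrier \<Gamma>" for \<gamma>
  proof (rule linear_map_factor[OF M N N p])
    note pr = graded_proj[OF gr \<gamma>]
    show pL: "(\<lambda>x. p (graded_proj K \<Gamma> M gr \<gamma> x)) \<in> linear_maps K M N"
      by (rule linear_map_comp[OF pr(1) p(1)])
    fix x assume x: "x \<in> carrier M" and "p x = \<zero>\<^bsub>N\<^esub>"
    from M ker[OF this] U show "p (graded_proj K \<Gamma> M gr \<gamma> x) = \<zero>\<^bsub>N\<^esub>"
    proof (induction rule: lin_span_induct)
      case (base s)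
      then show ?case using pr(2) linear_map_zero[OF M N p(1)] by auto
    qed (simp_all add: linear_map_zero[OF M N pL] linear_map_add[OF pL] linear_map_smult[OF pL])
  qed
  then have "\<forall>\<gamma>. \<exists>g. \<gamma> \<in> carrier \<Gamma> \<longrightarrow> g \<in> linear_maps K N N \<and> (\<forall>x\<in>carrier M. g (p x) = p (graded_proj K \<Gamma> M gr \<gamma> x))"
    by blast
  then obtain g where g: "\<And>\<gamma>. \<gamma> \<in> carrier \<Gamma> \<Longrightarrow> g \<gamma> \<in> linear_maps K N N"
    "\<And>\<gamma> x. \<gamma> \<in> carrier \<Gamma> \<Longrightarrow> x \<in> carrier M \<Longrightarrow> g \<gamma> (p x) = p (graded_proj K \<Gamma> M gr \<gamma> x)"
    using choice[of "\<lambda>\<gamma> g. \<gamma> \<in> carrier \<Gamma> \<longrightarrow> g \<in> linear_maps K N N \<and> (\<forall>x\<in>carrier M. g (p x) = p (graded_proj K \<Gamma> M gr \<gamma> x))"]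
    by blast
  show ?thesis
  proof (rule gradingI[OF N, where p = g])
    fix \<gamma> assume \<gamma>: "\<gamma> \<in> carrier \<Gamma>"
    note S = grading_submodule[OF gr \<gamma>]
    show "submodule (p ` gr \<gamma>) K N"
    proof (rule submodule_intro[OF N])
      show "p ` gr \<gamma> \<subseteq> carrier N" using p(2) submodule_carrier[OF S] by auto
      show "\<zero>\<^bsub>N\<^esub> \<in> p ` gr \<gamma>" using linear_map_zero[OF M N p(1)] submodule_zero[OF S] by force
      fix a b assume "a \<in> p ` gr \<gamma>" "b \<in> p ` gr \<gamma>"
      then obtain x y where "x \<in> gr \<gamma>" "a = p x" "y \<in> gr \<gamma>" "b = p y" by blast
      then show "a \<oplus>\<^bsub>N\<^esub> b \<in> p ` gr \<gamma>"
        using submodule_carrier[OF S] submodule_add[OF S]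
        by (auto simp: linear_map_add[OF p(1), symmetric])
    next
      fix c a assume c: "c \<in> carrier K" and "a \<in> p ` gr \<gamma>"
      then obtain x where "x \<in> gr \<gamma>" "a = p x" by blast
      then show "c \<odot>\<^bsub>N\<^esub> a \<in> p ` gr \<gamma>"
        using c submodule_carrier[OF S] submodule_smult[OF S]
        by (auto simp: linear_map_smult[OF p(1), symmetric])
    qed
    show "g \<gamma> \<in> linear_maps K N N" by (rule g(1)[OF \<gamma>])
    fix \<delta> y assume \<delta>: "\<delta> \<in> carrier \<Gamma>" and "y \<in> p ` gr \<delta>"
    then obtain x where x: "x \<in> gr \<delta>" "y = p x" by blast
    then show "g \<gamma> y = (if \<delta> = \<gamma> then y else \<zero>\<^bsub>N\<^esub>)"
      using g(2)[OF \<gamma> grading_carrier[OF gr \<delta>]] graded_proj(2)[OF gr \<gamma> \<delta>] linear_map_zero[OF M N p(1)] by auto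
  next
    show "carrier N = lin_span K N (\<Union>\<gamma>\<in>carrier \<Gamma>. p ` gr \<gamma>)"
      using surjective_image_span[OF M N p grading_span[OF gr]] by (simp add: image_UN)
  qed
qed

section \<open>Graded algebras, graded ideals and graded twists\<close>

definition graded_algebra ::
  "('k, 'x) ring_scheme \<Rightarrow> ('g, 'w) monoid_scheme \<Rightarrow> ('k, 'a, 'y) module_scheme \<Rightarrow> ('g \<Rightarrow> 'a set) \<Rightarrow> bool"
  where "graded_algebra K \<Gamma> A gr \<longleftrightarrow> k_algebra K A \<and> comm_group \<Gamma> \<and> grading K \<Gamma> A gr \<and>
    \<one>\<^bsub>A\<^esub> \<in> gr \<one>\<^bsub>\<Gamma>\<^esub> \<and>
    (\<forall>\<gamma>\<in>carrier \<Gamma>. \<forall>\<delta>\<in>carrier \<Gamma>. \<forall>x\<in>gr \<gamma>. \<forall>y\<in>gr \<delta>. x \<otimes>\<^bsub>A\<^esub> y \<in> gr (\<gamma> \<otimes>\<^bsub>\<Gamma>\<^esub> \<delta>))"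

lemma graded_algebraD:
  assumes "graded_algebra K \<Gamma> A gr"
  shows "k_algebra K A" "comm_group \<Gamma>" "grading K \<Gamma> A gr" "\<one>\<^bsub>A\<^esub> \<in> gr \<one>\<^bsub>\<Gamma>\<^esub>"
    "\<gamma> \<in> carrier \<Gamma> \<Longrightarrow> \<delta> \<in> carrier \<Gamma> \<Longrightarrow> x \<in> gr \<gamma> \<Longrightarrow> y \<in> gr \<delta> \<Longrightarrow> x \<otimes>\<^bsub>A\<^esub> y \<in> gr (\<gamma> \<otimes>\<^bsub>\<Gamma>\<^esub> \<delta>)"
  using assms by (auto simp: graded_algebra_def)

text \<open>Graded ideals are defined by additive generation, gradings by linear spans; on sets closed under
  scalars the two agree.\<close>

lemma generate_eq_lin_span:
  assumes M: "module K M" and U: "U \<subseteq> carrier M"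
    and "\<And>c u. c \<in> carrier K \<Longrightarrow> u \<in> U \<Longrightarrow> c \<odot>\<^bsub>M\<^esub> u \<in> U"
  shows "generate (add_monoid M) U = lin_span K M U"
proof
  interpret M: module K M by fact
  note S = lin_span_submodule[OF M U]
  show "generate (add_monoid M) U \<subseteq> lin_span K M U"
    by (rule M.M.add.generate_subgroup_incl[OF lin_span_superset submodule.axioms(1)[OF S]])
  have cl: "x \<in> carrier M" if "x \<in> generate (add_monoid M) U" for x
    using M.M.add.generate_in_carrier[OF U that] .
  have "submodule (generate (add_monoid M) U) K M"
  proof (rule submodule_intro[OF M])
    show "generate (add_monoid M) U \<subseteq> carrier M" using cl by auto
    show "\<zero>\<^bsub>M\<^esub> \<in> generate (add_monoid M) U" using generate.one[of "add_monoid M" U] by simp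
    show "a \<oplus>\<^bsub>M\<^esub> b \<in> generate (add_monoid M) U"
      if "a \<in> generate (add_monoid M) U" "b \<in> generate (add_monoid M) U" for a b
      using generate.eng[OF that] by simp
    show "c \<odot>\<^bsub>M\<^esub> x \<in> generate (add_monoid M) U"
      if c: "c \<in> carrier K" and "x \<in> generate (add_monoid M) U" for c x
      using that(2)
    proof (induction rule: generate.induct)
      case one
      then show ?case using c generate.one[of "add_monoid M" U] by simp
    next
      case (incl h)
      then show ?case using c assms(3) generate.incl by metis
    next
      case (inv h)
      then have "c \<odot>\<^bsub>M\<^esub> (\<ominus>\<^bsub>M\<^esub> h) = \<ominus>\<^bsub>M\<^esub> (c \<odot>\<^bsub>M\<^esub> h)" using c U by (auto simp: M.smult_r_minus)
      then show ?case
        using generate.inv[of "c \<odot>\<^bsub>M\<^esub> h" U "add_monoid M"] assms(3)[OF c inv] by (simp add: a_inv_def)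
    next
      case (eng h1 h2)
      then show ?case
        using generate.eng[OF eng.IH] c cl by (simp add: M.smult_r_distr)
    qed
  qed
  then show "lin_span K M U \<subseteq> generate (add_monoid M) U"
    by (rule lin_span_least) (auto intro: generate.incl)
qed

lemma graded_ideal_iff_span:
  assumes "graded_algebra K \<Gamma> A gr" "ideal J A"
  shows "graded_ideal \<Gamma> A gr J \<longleftrightarrow> J \<subseteq> lin_span K A (\<Union>\<gamma>\<in>carrier \<Gamma>. J \<inter> gr \<gamma>)"
proof -
  note A = graded_algebraD[OF assms(1)]
  note J = ideal_submodule[OF A(1) assms(2)]
  have "generate (add_monoid A) (\<Union>\<gamma>\<in>carrier \<Gamma>. J \<inter> gr \<gamma>) = lin_span K A (\<Union>\<gamma>\<in>carrier \<Gamma>. J \<inter> gr \<gamma>)"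
  proof (rule generate_eq_lin_span[OF k_algebra_module[OF A(1)]])
    show "(\<Union>\<gamma>\<in>carrier \<Gamma>. J \<inter> gr \<gamma>) \<subseteq> carrier A" using submodule_carrier[OF J] by blast
    fix c u assume c: "c \<in> carrier K" and "u \<in> (\<Union>\<gamma>\<in>carrier \<Gamma>. J \<inter> gr \<gamma>)"
    then obtain \<gamma> where "\<gamma> \<in> carrier \<Gamma>" "u \<in> J" "u \<in> gr \<gamma>" by blast
    with c show "c \<odot>\<^bsub>A\<^esub> u \<in> (\<Union>\<gamma>\<in>carrier \<Gamma>. J \<inter> gr \<gamma>)"
      using submodule_smult[OF J] submodule_smult[OF grading_submodule[OF A(3)]] by (intro UN_I IntI)
  qed
  moreover have "lin_span K A (\<Union>\<gamma>\<in>carrier \<Gamma>. J \<inter> gr \<gamma>) \<subseteq> J"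
    by (rule lin_span_least[OF J]) auto
  ultimately show ?thesis using assms(2) by (auto simp: graded_ideal_def)
qed

text \<open>The span \<open>J\<close> of the homogeneous elements of the generated ideal is itself an ideal, since a
  product of homogeneous elements is homogeneous.  As \<open>J\<close> contains \<open>S\<close>, it is the whole ideal.\<close>

lemma genideal_graded:
  assumes "graded_algebra K \<Gamma> A gr" "S \<subseteq> (\<Union>\<gamma>\<in>carrier \<Gamma>. gr \<gamma>)"
  shows "graded_ideal \<Gamma> A gr (Idl\<^bsub>A\<^esub> S)"
proof -
  note A = graded_algebraD[OF assms(1)]
  note M = k_algebra_module[OF A(1)]
  interpret A: k_algebra K A by fact
  interpret \<Gamma>: comm_group \<Gamma> by fact
  have S: "S \<subseteq> carrier A" using assms(2) grading_carrier[OF A(3)] by blast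
  note I = A.genideal_ideal[OF S]
  let ?U = "\<Union>\<gamma>\<in>carrier \<Gamma>. Idl\<^bsub>A\<^esub> S \<inter> gr \<gamma>"
  define J where "J = lin_span K A ?U"
  have U: "?U \<subseteq> carrier A" using grading_carrier[OF A(3)] by blast
  note J = lin_span_submodule[OF M U, folded J_def]
  have "ideal J A"
  proof (rule idealI[OF A.A.ring_axioms submodule.axioms(1)[OF J]])
    fix y x assume y: "y \<in> J" and x: "x \<in> carrier A"
    have "x \<otimes>\<^bsub>A\<^esub> y \<in> J \<and> y \<otimes>\<^bsub>A\<^esub> x \<in> J"
      using M y[unfolded J_def] U
    proof (induction rule: lin_span_induct)
      case (base y)
      then obtain \<gamma> where \<gamma>: "\<gamma> \<in> carrier \<Gamma>" "y \<in> Idl\<^bsub>A\<^esub> S" "y \<in> gr \<gamma>" by blast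
      then have yA: "y \<in> carrier A" using grading_carrier[OF A(3)] by blast
      show ?case
        using A(3) x
      proof (induction rule: grading_induct)
        case (homogeneous \<delta> x)
        then have "x \<in> carrier A" using grading_carrier[OF A(3)] by blast
        then have "x \<otimes>\<^bsub>A\<^esub> y \<in> Idl\<^bsub>A\<^esub> S" "y \<otimes>\<^bsub>A\<^esub> x \<in> Idl\<^bsub>A\<^esub> S"
          using ideal.I_l_closed[OF I \<gamma>(2)] ideal.I_r_closed[OF I \<gamma>(2)] by auto
        moreover have "x \<otimes>\<^bsub>A\<^esub> y \<in> gr (\<delta> \<otimes>\<^bsub>\<Gamma>\<^esub> \<gamma>)" "y \<otimes>\<^bsub>A\<^esub> x \<in> gr (\<gamma> \<otimes>\<^bsub>\<Gamma>\<^esub> \<delta>)"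
          using A(5) homogeneous \<gamma> by auto
        moreover have "\<delta> \<otimes>\<^bsub>\<Gamma>\<^esub> \<gamma> \<in> carrier \<Gamma>" "\<gamma> \<otimes>\<^bsub>\<Gamma>\<^esub> \<delta> \<in> carrier \<Gamma>"
          using homogeneous \<gamma> by auto
        ultimately have "x \<otimes>\<^bsub>A\<^esub> y \<in> ?U" "y \<otimes>\<^bsub>A\<^esub> x \<in> ?U" by blast+
        then show ?case by (intro conjI subsetD[OF lin_span_superset[of ?U K A, folded J_def]])
      qed (use yA in \<open>auto simp: A.A.l_distr A.A.r_distr A.smult_mult_left A.smult_mult_right
            submodule_zero[OF J] submodule_add[OF J] submodule_smult[OF J]\<close>)
    qed (use x in \<open>auto simp: A.A.l_distr A.A.r_distr A.smult_mult_left A.smult_mult_right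
            submodule_zero[OF J] submodule_add[OF J] submodule_smult[OF J]\<close>)
    then show "x \<otimes>\<^bsub>A\<^esub> y \<in> J" "y \<otimes>\<^bsub>A\<^esub> x \<in> J" by auto
  qed
  moreover have "S \<subseteq> ?U"
    using assms(2) A.genideal_self[OF S] by blast
  then have "S \<subseteq> J"
    unfolding J_def using lin_span_superset by (rule subset_trans)
  ultimately have "Idl\<^bsub>A\<^esub> S \<subseteq> J" by (rule A.genideal_minimal)
  then show ?thesis using graded_ideal_iff_span[OF assms(1) I] by (simp only: J_def)
qed

text \<open>A sum of ideals is an ideal, and it is spanned by the homogeneous elements that span its summands.\<close>

lemma sum_graded_ideals:
  assumes "graded_algebra K \<Gamma> A gr" "\<And>J. J \<in> \<J> \<Longrightarrow> graded_ideal \<Gamma> A gr J"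
  shows "graded_ideal \<Gamma> A gr (generate (add_monoid A) (\<Union>\<J>))"
proof -
  note A = graded_algebraD[OF assms(1)]
  note M = k_algebra_module[OF A(1)]
  interpret A: k_algebra K A by fact
  have id: "ideal J A" if "J \<in> \<J>" for J using assms(2)[OF that] by (simp add: graded_ideal_def)
  have U: "\<Union>\<J> \<subseteq> carrier A" using submodule_carrier[OF ideal_submodule[OF A(1) id]] by blast
  let ?T = "generate (add_monoid A) (\<Union>\<J>)"
  have T: "?T = lin_span K A (\<Union>\<J>)"
    by (rule generate_eq_lin_span[OF M U]) (use submodule_smult[OF ideal_submodule[OF A(1) id]] in blast)
  note S = lin_span_submodule[OF M U, folded T]
  have iT: "ideal ?T A"
  proof (rule idealI[OF A.A.ring_axioms submodule.axioms(1)[OF S]])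
    fix y x assume y: "y \<in> ?T" and x: "x \<in> carrier A"
    have "x \<otimes>\<^bsub>A\<^esub> y \<in> ?T \<and> y \<otimes>\<^bsub>A\<^esub> x \<in> ?T"
      using M y[unfolded T] U
    proof (induction rule: lin_span_induct)
      case (base y)
      then obtain J where J: "J \<in> \<J>" "y \<in> J" by blast
      then have "x \<otimes>\<^bsub>A\<^esub> y \<in> \<Union>\<J>" "y \<otimes>\<^bsub>A\<^esub> x \<in> \<Union>\<J>"
        using ideal.I_l_closed[OF id[OF J(1)] J(2) x] ideal.I_r_closed[OF id[OF J(1)] J(2) x] by blast+
      then show ?case by (auto intro: generate.incl)
    qed (use x in \<open>auto simp: A.A.l_distr A.A.r_distr A.smult_mult_left A.smult_mult_right
            submodule_zero[OF S] submodule_add[OF S] submodule_smult[OF S]\<close>)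
    then show "x \<otimes>\<^bsub>A\<^esub> y \<in> ?T" "y \<otimes>\<^bsub>A\<^esub> x \<in> ?T" by auto
  qed
  let ?L = "lin_span K A (\<Union>\<gamma>\<in>carrier \<Gamma>. ?T \<inter> gr \<gamma>)"
  have "J \<subseteq> ?L" if J: "J \<in> \<J>" for J
  proof -
    have "J \<subseteq> lin_span K A (\<Union>\<gamma>\<in>carrier \<Gamma>. J \<inter> gr \<gamma>)"
      using graded_ideal_iff_span[OF assms(1) id[OF J]] assms(2)[OF J] by simp
    also have "\<dots> \<subseteq> ?L"
      by (rule lin_span_mono) (use J in \<open>auto intro: generate.incl\<close>)
    finally show ?thesis .
  qed
  moreover have "submodule ?L K A"
    by (rule lin_span_submodule[OF M]) (use grading_carrier[OF A(3)] in blast)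
  ultimately have "?T \<subseteq> ?L" unfolding T using lin_span_least by (metis Sup_least)
  then show ?thesis using graded_ideal_iff_span[OF assms(1) iT] by simp
qed

lemma quot_graded_algebra:
  assumes "graded_algebra K \<Gamma> A gr" "graded_ideal \<Gamma> A gr I"
  shows "graded_algebra K \<Gamma> (quot_algebra A I) (\<lambda>\<gamma>. (\<lambda>x. I +>\<^bsub>A\<^esub> x) ` gr \<gamma>)"
proof -
  note A = graded_algebraD[OF assms(1)]
  have I: "ideal I A" using assms(2) by (simp add: graded_ideal_def)
  note M = k_algebra_module[OF A(1)]
  note S = ideal_submodule[OF A(1) I]
  have "grading K \<Gamma> (quot_algebra A I) (\<lambda>\<gamma>. (\<lambda>x. I +>\<^bsub>A\<^esub> x) ` gr \<gamma>)"
  proof (rule grading_surjective_image[OF A(3) quot_module[OF M S] quot_projection_linear[OF M S]])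
    fix x assume "x \<in> carrier A" "I +>\<^bsub>A\<^esub> x = zero (quot_algebra A I)"
    then have "x \<in> lin_span K A (\<Union>\<gamma>\<in>carrier \<Gamma>. I \<inter> gr \<gamma>)"
      using graded_ideal_iff_span[OF assms(1) I] assms(2) quot_coset_eq_zero_iff[OF M S] by auto
    also have "\<dots> \<subseteq> lin_span K A (\<Union>\<gamma>\<in>carrier \<Gamma>. {y \<in> gr \<gamma>. I +>\<^bsub>A\<^esub> y = zero (quot_algebra A I)})"
      by (rule lin_span_mono) (use quot_coset_eq_zero_iff[OF M S] submodule_carrier[OF S] in auto)
    finally show "x \<in> lin_span K A (\<Union>\<gamma>\<in>carrier \<Gamma>. {y \<in> gr \<gamma>. I +>\<^bsub>A\<^esub> y = zero (quot_algebra A I)})" .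
  qed (simp add: quot_algebra_simps)
  moreover have "x \<otimes>\<^bsub>quot_algebra A I\<^esub> y \<in> (\<lambda>x. I +>\<^bsub>A\<^esub> x) ` gr (\<gamma> \<otimes>\<^bsub>\<Gamma>\<^esub> \<delta>)"
    if "\<gamma> \<in> carrier \<Gamma>" "\<delta> \<in> carrier \<Gamma>" "x \<in> (\<lambda>x. I +>\<^bsub>A\<^esub> x) ` gr \<gamma>" "y \<in> (\<lambda>x. I +>\<^bsub>A\<^esub> x) ` gr \<delta>" for \<gamma> \<delta> x y
    using that quot_k_algebra(2)[OF A(1) I] grading_carrier[OF A(3)] A(5) by auto
  ultimately show ?thesis
    using quot_k_algebra(1)[OF A(1) I] A(2,4) by (auto simp: graded_algebra_def quot_algebra_simps)
qed

lemma linear_map_sum_of_maps: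
  assumes "module K M" "module K N" "finite I" "\<And>i. i \<in> I \<Longrightarrow> f i \<in> linear_maps K M N"
  shows "(\<lambda>x. \<Oplus>\<^bsub>N\<^esub>i\<in>I. f i x) \<in> linear_maps K M N"
  using assms(3,4)
proof (induction I rule: finite_induct)
  case empty
  interpret N: module K N by fact
  show ?case using linear_map_const_zero[OF assms(2)] by simp
next
  case (insert i I)
  interpret N: module K N by fact
  have "(\<lambda>x. f i x \<oplus>\<^bsub>N\<^esub> (\<Oplus>\<^bsub>N\<^esub>i\<in>I. f i x)) \<in> linear_maps K M N"
    by (rule linear_map_plus[OF assms(2)]) (use insert in auto)
  then show ?case
  proof (rule linear_map_cong[OF assms(1)])
    fix x assume "x \<in> carrier M"
    then show "(\<Oplus>\<^bsub>N\<^esub>i\<in>insert i I. f i x) = f i x \<oplus>\<^bsub>N\<^esub> (\<Oplus>\<^bsub>N\<^esub>i\<in>I. f i x)"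
      using insert linear_map_closed by (intro N.M.finsum_insert) fastforce+
  qed
qed

context
  fixes K :: "('k, 'x) ring_scheme" and \<Gamma> :: "('g, 'w) monoid_scheme"
    and E :: "('k, 'a) module" and gr :: "'g \<Rightarrow> 'a set" and chi
  assumes E: "graded_algebra K \<Gamma> E gr" and chi: "twisting_system K \<Gamma> E gr chi"
begin

interpretation E: k_algebra K E by (rule graded_algebraD(1)[OF E])
interpretation \<Gamma>: comm_group \<Gamma> by (rule graded_algebraD(2)[OF E])

lemma twisting_map:
  assumes "\<gamma> \<in> carrier \<Gamma>"
  shows "chi \<gamma> \<in> linear_maps K E E" "\<And>x. x \<in> carrier E \<Longrightarrow> chi \<gamma> x \<in> carrier E"
    "\<And>x y. x \<in> carrier E \<Longrightarrow> y \<in> carrier E \<Longrightarrow> chi \<gamma> (x \<otimes>\<^bsub>E\<^esub> y) = chi \<gamma> x \<otimes>\<^bsub>E\<^esub> chi \<gamma> y"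
    "chi \<gamma> \<one>\<^bsub>E\<^esub> = \<one>\<^bsub>E\<^esub>" "inj_on (chi \<gamma>) (carrier E)"
    "\<And>\<delta> x. \<delta> \<in> carrier \<Gamma> \<Longrightarrow> x \<in> gr \<delta> \<Longrightarrow> chi \<gamma> x \<in> gr \<delta>"
proof -
  have "chi \<gamma> ` gr \<delta> = gr \<delta>" if "\<delta> \<in> carrier \<Gamma>" for \<delta>
    using chi assms that by (simp add: twisting_system_def)
  then show "\<And>\<delta> x. \<delta> \<in> carrier \<Gamma> \<Longrightarrow> x \<in> gr \<delta> \<Longrightarrow> chi \<gamma> x \<in> gr \<delta>" by blast
qed (use chi assms in \<open>auto simp: twisting_system_def alg_iso_def ring_iso_def ring_hom_def bij_betw_def Pi_iff\<close>)

lemma graded_twist_simps: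
  "carrier (graded_twist \<Gamma> E gr chi) = carrier E" "one (graded_twist \<Gamma> E gr chi) = \<one>\<^bsub>E\<^esub>"
  "add (graded_twist \<Gamma> E gr chi) = add E" "zero (graded_twist \<Gamma> E gr chi) = \<zero>\<^bsub>E\<^esub>"
  "smult (graded_twist \<Gamma> E gr chi) = smult E"
  by (simp_all add: graded_twist_def)

lemma graded_twist_same_space: "same_space E (graded_twist \<Gamma> E gr chi)"
  by (simp add: same_space_def graded_twist_simps)

text \<open>In the right factor this is the extension from components.  In the left factor each summand is
  linear because \<open>chi \<gamma>\<close> is.\<close>

lemma graded_twist_mult_bilinear: "(\<otimes>\<^bsub>graded_twist \<Gamma> E gr chi\<^esub>) \<in> bilinear_maps K E E E"
  and graded_twist_mult_homogeneous: "a \<in> carrier E \<Longrightarrow> \<gamma> \<in> carrier \<Gamma> \<Longrightarrow> b \<in> gr \<gamma> \<Longrightarrow>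
    a \<otimes>\<^bsub>graded_twist \<Gamma> E gr chi\<^esub> b = chi \<gamma> a \<otimes>\<^bsub>E\<^esub> b"
proof -
  note M = k_algebra_module[OF graded_algebraD(1)[OF E]]
  note G = graded_algebraD(3)[OF E]
  note B = k_algebra_mult_bilinear[OF graded_algebraD(1)[OF E]]
  have mult: "(\<otimes>\<^bsub>graded_twist \<Gamma> E gr chi\<^esub>) = (\<lambda>a b. let d = homogeneous_components \<Gamma> E gr b in
       \<Oplus>\<^bsub>E\<^esub>\<gamma>\<in>{\<gamma> \<in> carrier \<Gamma>. d \<gamma> \<noteq> \<zero>\<^bsub>E\<^esub>}. chi \<gamma> a \<otimes>\<^bsub>E\<^esub> d \<gamma>)"
    by (simp add: graded_twist_def)
  have F: "(\<lambda>x. chi \<gamma> a \<otimes>\<^bsub>E\<^esub> x) \<in> linear_maps K E E" if "a \<in> carrier E" "\<gamma> \<in> carrier \<Gamma>" for a \<gamma>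
    using bilinear_map_right[OF B twisting_map(2)[OF that(2,1)]] .
  show "(\<otimes>\<^bsub>graded_twist \<Gamma> E gr chi\<^esub>) \<in> bilinear_maps K E E E"
    unfolding mult
  proof (rule bilinear_mapsI)
    fix a assume a: "a \<in> carrier E"
    show "(\<lambda>b. let d = homogeneous_components \<Gamma> E gr b in
       \<Oplus>\<^bsub>E\<^esub>\<gamma>\<in>{\<gamma> \<in> carrier \<Gamma>. d \<gamma> \<noteq> \<zero>\<^bsub>E\<^esub>}. chi \<gamma> a \<otimes>\<^bsub>E\<^esub> d \<gamma>) \<in> linear_maps K E E"
      by (rule graded_extension(1)[OF G M F[OF a]])
  next
    fix b assume b: "b \<in> carrier E"
    define d where "d = homogeneous_components \<Gamma> E gr b"
    have d: "finite {\<gamma> \<in> carrier \<Gamma>. d \<gamma> \<noteq> \<zero>\<^bsub>E\<^esub>}" "\<And>\<gamma>. \<gamma> \<in> carrier \<Gamma> \<Longrightarrow> d \<gamma> \<in> carrier E"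
      using graded_extension(3)[OF G M linear_map_id b d_def] by auto
    have "(\<lambda>a. \<Oplus>\<^bsub>E\<^esub>\<gamma>\<in>{\<gamma> \<in> carrier \<Gamma>. d \<gamma> \<noteq> \<zero>\<^bsub>E\<^esub>}. chi \<gamma> a \<otimes>\<^bsub>E\<^esub> d \<gamma>) \<in> linear_maps K E E"
    proof (rule linear_map_sum_of_maps[OF M M d(1)])
      fix \<gamma> assume "\<gamma> \<in> {\<gamma> \<in> carrier \<Gamma>. d \<gamma> \<noteq> \<zero>\<^bsub>E\<^esub>}"
      then have \<gamma>: "\<gamma> \<in> carrier \<Gamma>" by simp
      show "(\<lambda>a. chi \<gamma> a \<otimes>\<^bsub>E\<^esub> d \<gamma>) \<in> linear_maps K E E"
        by (rule linear_map_comp[OF twisting_map(1)[OF \<gamma>] bilinear_map_left[OF B d(2)[OF \<gamma>]]])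
    qed
    then show "(\<lambda>a. let d = homogeneous_components \<Gamma> E gr b in
       \<Oplus>\<^bsub>E\<^esub>\<gamma>\<in>{\<gamma> \<in> carrier \<Gamma>. d \<gamma> \<noteq> \<zero>\<^bsub>E\<^esub>}. chi \<gamma> a \<otimes>\<^bsub>E\<^esub> d \<gamma>) \<in> linear_maps K E E"
      by (simp add: d_def Let_def)
  qed
  show "a \<in> carrier E \<Longrightarrow> \<gamma> \<in> carrier \<Gamma> \<Longrightarrow> b \<in> gr \<gamma> \<Longrightarrow>
    a \<otimes>\<^bsub>graded_twist \<Gamma> E gr chi\<^esub> b = chi \<gamma> a \<otimes>\<^bsub>E\<^esub> b"
    unfolding mult using graded_extension(2)[OF G M F] by simp
qed

text \<open>For \<open>b\<close> and \<open>c\<close> homogeneous of degrees \<open>\<beta>\<close> and \<open>\<gamma>\<close>, the product \<open>(a \<star> b) \<star> c\<close> is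
  \<open>chi \<gamma> (chi \<beta> a) (chi \<gamma> b) c\<close> since \<open>chi \<gamma>\<close> is multiplicative, and \<open>a \<star> (b \<star> c)\<close> is
  \<open>chi (\<beta> \<gamma>) a (chi \<gamma> b) c\<close> since \<open>chi \<gamma> b\<close> still has degree \<open>\<beta>\<close>.  They agree because \<open>chi\<close> is a
  homomorphism on a commutative group.\<close>

theorem graded_twist_k_algebra: "k_algebra K (graded_twist \<Gamma> E gr chi)"
proof -
  let ?T = "graded_twist \<Gamma> E gr chi"
  note G = graded_algebraD(3)[OF E]
  note M = k_algebra_module[OF graded_algebraD(1)[OF E]]
  note H = graded_twist_mult_homogeneous
  have one: "\<one>\<^bsub>E\<^esub> \<in> gr \<one>\<^bsub>\<Gamma>\<^esub>" by (rule graded_algebraD(4)[OF E])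
  \<comment> \<open>The map of degree \<open>\<one>\<close> is idempotent and injective, hence the identity; the right unit law
    rests on this.\<close>
  have chi_one: "chi \<one>\<^bsub>\<Gamma>\<^esub> x = x" if x: "x \<in> carrier E" for x
  proof -
    have "chi (\<one>\<^bsub>\<Gamma>\<^esub> \<otimes>\<^bsub>\<Gamma>\<^esub> \<one>\<^bsub>\<Gamma>\<^esub>) x = chi \<one>\<^bsub>\<Gamma>\<^esub> (chi \<one>\<^bsub>\<Gamma>\<^esub> x)"
      using chi x unfolding twisting_system_def by blast
    then have "chi \<one>\<^bsub>\<Gamma>\<^esub> (chi \<one>\<^bsub>\<Gamma>\<^esub> x) = chi \<one>\<^bsub>\<Gamma>\<^esub> x" by simp
    then show ?thesis
      using inj_onD[OF twisting_map(5)[OF \<Gamma>.one_closed]] twisting_map(2)[OF \<Gamma>.one_closed x] x by blast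
  qed
  show ?thesis
  proof (rule k_algebraI_span[OF k_algebra_field[OF graded_algebraD(1)[OF E]]
        module_same_space[OF M graded_twist_same_space]])
    show "(\<otimes>\<^bsub>?T\<^esub>) \<in> bilinear_maps K ?T ?T ?T"
      using graded_twist_mult_bilinear
      by (simp add: bilinear_maps_def graded_twist_simps
          linear_maps_same_space[OF graded_twist_same_space graded_twist_same_space])
    show "carrier ?T = lin_span K ?T (\<Union>\<gamma>\<in>carrier \<Gamma>. gr \<gamma>)"
      using grading_span[OF G]
      by (simp add: graded_twist_simps lin_span_same_space[OF graded_twist_same_space])
    show "\<one>\<^bsub>?T\<^esub> \<in> carrier ?T" by (simp add: graded_twist_simps)
    fix a assume "a \<in> (\<Union>\<gamma>\<in>carrier \<Gamma>. gr \<gamma>)"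
    then obtain \<alpha> where \<alpha>: "\<alpha> \<in> carrier \<Gamma>" "a \<in> gr \<alpha>" by blast
    then have a: "a \<in> carrier E" using grading_carrier[OF G] by blast
    show "\<one>\<^bsub>?T\<^esub> \<otimes>\<^bsub>?T\<^esub> a = a" "a \<otimes>\<^bsub>?T\<^esub> \<one>\<^bsub>?T\<^esub> = a"
      using a \<alpha> one by (simp_all add: graded_twist_simps H[of _ \<alpha>] H[of _ "\<one>\<^bsub>\<Gamma>\<^esub>"] twisting_map chi_one)
    fix b c assume "b \<in> (\<Union>\<gamma>\<in>carrier \<Gamma>. gr \<gamma>)" "c \<in> (\<Union>\<gamma>\<in>carrier \<Gamma>. gr \<gamma>)"
    then obtain \<beta> \<gamma> where \<beta>: "\<beta> \<in> carrier \<Gamma>" "b \<in> gr \<beta>" and \<gamma>: "\<gamma> \<in> carrier \<Gamma>" "c \<in> gr \<gamma>" by blast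
    then have b: "b \<in> carrier E" and c: "c \<in> carrier E" using grading_carrier[OF G] by blast+
    have bc: "chi \<gamma> b \<otimes>\<^bsub>E\<^esub> c \<in> gr (\<beta> \<otimes>\<^bsub>\<Gamma>\<^esub> \<gamma>)"
      using graded_algebraD(5)[OF E] \<beta> \<gamma> twisting_map(6) by blast
    have "a \<otimes>\<^bsub>?T\<^esub> b \<otimes>\<^bsub>?T\<^esub> c = chi \<gamma> (chi \<beta> a \<otimes>\<^bsub>E\<^esub> b) \<otimes>\<^bsub>E\<^esub> c"
      using a b \<beta> \<gamma> twisting_map(2) by (simp add: H[of _ \<beta>] H[of _ \<gamma>])
    also have "\<dots> = chi \<gamma> (chi \<beta> a) \<otimes>\<^bsub>E\<^esub> (chi \<gamma> b \<otimes>\<^bsub>E\<^esub> c)"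
      using a b c \<beta> \<gamma> twisting_map(2) by (simp add: twisting_map(3) E.A.m_assoc)
    also have "chi \<gamma> (chi \<beta> a) = chi (\<beta> \<otimes>\<^bsub>\<Gamma>\<^esub> \<gamma>) a"
      using chi a \<beta> \<gamma> \<Gamma>.m_comm[OF \<beta>(1) \<gamma>(1)] by (simp add: twisting_system_def)
    also have "\<dots> \<otimes>\<^bsub>E\<^esub> (chi \<gamma> b \<otimes>\<^bsub>E\<^esub> c) = a \<otimes>\<^bsub>?T\<^esub> (b \<otimes>\<^bsub>?T\<^esub> c)"
      using a b \<beta> \<gamma> bc by (simp add: H[of _ \<gamma>] H[of _ "\<beta> \<otimes>\<^bsub>\<Gamma>\<^esub> \<gamma>"])
    finally show "a \<otimes>\<^bsub>?T\<^esub> b \<otimes>\<^bsub>?T\<^esub> c = a \<otimes>\<^bsub>?T\<^esub> (b \<otimes>\<^bsub>?T\<^esub> c)" .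
  qed
qed

end

section \<open>Tensor products\<close>

lemma linear_map_minus:
  assumes "module K M" "module K N" "f \<in> linear_maps K M N" "x \<in> carrier M" "y \<in> carrier M"
  shows "f (x \<ominus>\<^bsub>M\<^esub> y) = f x \<ominus>\<^bsub>N\<^esub> f y"
proof -
  interpret M: module K M by fact
  interpret N: module K N by fact
  have "x \<ominus>\<^bsub>M\<^esub> y = x \<oplus>\<^bsub>M\<^esub> (\<ominus>\<^bsub>K\<^esub> \<one>\<^bsub>K\<^esub>) \<odot>\<^bsub>M\<^esub> y"
    using assms(5) by (simp add: a_minus_def M.smult_l_minus)
  then show ?thesis
    using assms(3-5) by (simp add: linear_mapD[OF assms(3)] N.smult_l_minus a_minus_def)
qed

lemma bilinear_map_cong:
  assumes "module K A" "module K B" "f \<in> bilinear_maps K A B P"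
    and "\<And>a b. a \<in> carrier A \<Longrightarrow> b \<in> carrier B \<Longrightarrow> g a b = f a b"
  shows "g \<in> bilinear_maps K A B P"
  using linear_map_cong[OF assms(2) bilinear_map_right[OF assms(3)]]
    linear_map_cong[OF assms(1) bilinear_map_left[OF assms(3)]] assms(4)
  by (intro bilinear_mapsI) auto

lemma bilinear_map_plus:
  assumes "module K P" "f \<in> bilinear_maps K A B P" "g \<in> bilinear_maps K A B P"
  shows "(\<lambda>a b. f a b \<oplus>\<^bsub>P\<^esub> g a b) \<in> bilinear_maps K A B P"
  using linear_map_plus[OF assms(1) bilinear_map_right[OF assms(2)] bilinear_map_right[OF assms(3)]]
    linear_map_plus[OF assms(1) bilinear_map_left[OF assms(2)] bilinear_map_left[OF assms(3)]]
  by (intro bilinear_mapsI)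

lemma bilinear_map_scale:
  assumes "module K P" "f \<in> bilinear_maps K A B P" "c \<in> carrier K"
  shows "(\<lambda>a b. c \<odot>\<^bsub>P\<^esub> f a b) \<in> bilinear_maps K A B P"
  using linear_map_scale[OF assms(1) bilinear_map_right[OF assms(2)] assms(3)]
    linear_map_scale[OF assms(1) bilinear_map_left[OF assms(2)] assms(3)]
  by (intro bilinear_mapsI)

lemma bilinear_map_flip: "f \<in> bilinear_maps K A B P \<Longrightarrow> (\<lambda>b a. f a b) \<in> bilinear_maps K B A P"
  by (auto simp: bilinear_maps_def)

lemma bilinear_map_in: "f \<in> bilinear_maps K A B P \<Longrightarrow> a \<in> carrier A \<Longrightarrow> b \<in> carrier B \<Longrightarrow> f a b \<in> carrier P"
  using linear_map_closed[OF bilinear_map_right] .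

text \<open>The parameters \<open>x\<close> for which \<open>(a, b) \<mapsto> h a b x\<close> is bilinear form a subspace.  This is needed
  because the product on a tensor product is a lift nested in another one: the inner lift has to be
  bilinear in the variables of the outer.\<close>

lemma bilinear_map_parameter:
  assumes A: "module K A" and B: "module K B" and P: "module K P" and M: "module K M"
    and S: "carrier M = lin_span K M S"
    and lin: "\<And>a b. a \<in> carrier A \<Longrightarrow> b \<in> carrier B \<Longrightarrow> h a b \<in> linear_maps K M P"
    and base: "\<And>s. s \<in> S \<Longrightarrow> (\<lambda>a b. h a b s) \<in> bilinear_maps K A B P"
    and x: "x \<in> carrier M"
  shows "(\<lambda>a b. h a b x) \<in> bilinear_maps K A B P"
proof -
  have "S \<subseteq> carrier M" using lin_span_superset[of S K M] S by simp
  with M x[unfolded S] show ?thesis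
  proof (induction rule: lin_span_induct)
    case zero
    have "(\<lambda>a b. \<zero>\<^bsub>P\<^esub>) \<in> bilinear_maps K A B P"
      by (intro bilinear_mapsI linear_map_const_zero[OF P])
    then show ?case
      by (rule bilinear_map_cong[OF A B]) (use linear_map_zero[OF M P lin] in auto)
  next
    case (add x y)
    show ?case
      by (rule bilinear_map_cong[OF A B bilinear_map_plus[OF P add(3,4)]])
        (use linear_map_add[OF lin add(1,2)] in auto)
  next
    case (smult c x)
    show ?case
      by (rule bilinear_map_cong[OF A B bilinear_map_scale[OF P smult(3,1)]])
        (use linear_map_smult[OF lin smult(1,2)] in auto)
  qed (rule base)
qed

context
  fixes K :: "('k, 'x) ring_scheme" and A :: "('k, 'a, 'y) module_scheme"
    and B :: "('k, 'b, 'z) module_scheme"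
  assumes A: "module K A" and B: "module K B"
begin

interpretation A: module K A by (rule A)
interpretation B: module K B by (rule B)

private abbreviation (input) "Fp \<equiv> free_module K (carrier A \<times> carrier B)"

lemma free_module_pairs: "module K (free_module K (carrier A \<times> carrier B))"
  by (rule free_module_module[OF A.R.is_cring])

lemma single_pair:
  "a \<in> carrier A \<Longrightarrow> b \<in> carrier B \<Longrightarrow> single K (a, b) \<in> carrier (free_module K (carrier A \<times> carrier B))"
  by (rule single_in_free_module[OF A.R.is_cring]) simp

interpretation Fp: module K Fp by (rule free_module_pairs)

lemma tensor_relations_carrier: "tensor_relations K A B \<subseteq> carrier Fp"
  by (auto simp: tensor_relations_def Let_def single_pair)

lemma tensor_kernel_submodule: "submodule (tensor_kernel K A B) K Fp"
  unfolding tensor_kernel_def by (rule lin_span_submodule[OF free_module_pairs tensor_relations_carrier])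

lemma tensor_relation_in_kernel: "x \<in> tensor_relations K A B \<Longrightarrow> x \<in> tensor_kernel K A B"
  unfolding tensor_kernel_def using lin_span_superset by (rule subsetD)

lemma tensor_space_module: "module K (tensor_space K A B)"
  unfolding tensor_space_def by (rule quot_module[OF free_module_pairs tensor_kernel_submodule])

lemma tensor_projection_linear:
  "(\<lambda>r. tensor_kernel K A B +>\<^bsub>Fp\<^esub> r) \<in> linear_maps K Fp (tensor_space K A B)"
  unfolding tensor_space_def by (rule quot_projection_linear[OF free_module_pairs tensor_kernel_submodule])

lemma tensor_space_carrier: "carrier (tensor_space K A B) = (\<lambda>r. tensor_kernel K A B +>\<^bsub>Fp\<^esub> r) ` carrier Fp"
  by (simp add: tensor_space_def quot_algebra_simps)

lemma tensor_coset_eqI: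
  assumes "x \<in> carrier Fp" "y \<in> carrier Fp" "x \<ominus>\<^bsub>Fp\<^esub> y \<in> tensor_relations K A B"
  shows "tensor_kernel K A B +>\<^bsub>Fp\<^esub> x = tensor_kernel K A B +>\<^bsub>Fp\<^esub> y"
proof -
  have "x = (x \<ominus>\<^bsub>Fp\<^esub> y) \<oplus>\<^bsub>Fp\<^esub> y"
    using assms(1,2) by (simp add: a_minus_def Fp.M.a_assoc Fp.M.l_neg)
  then show ?thesis
    using quot_coset_eq_iff[OF free_module_pairs tensor_kernel_submodule assms(1,2)]
      tensor_relation_in_kernel[OF assms(3)] by blast
qed

lemma pure_tensor_bilinear: "pure_tensor K A B \<in> bilinear_maps K A B (tensor_space K A B)"
proof (intro bilinear_mapsI linear_mapsI)
  note L = tensor_projection_linear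
  note sp = single_pair
  fix a b assume a: "a \<in> carrier A" and b: "b \<in> carrier B"
  show "pure_tensor K A B a b \<in> carrier (tensor_space K A B)"
    unfolding pure_tensor_def by (rule linear_map_closed[OF L sp[OF a b]])
  then show "pure_tensor K A B a b \<in> carrier (tensor_space K A B)" .
  {
    fix b' assume b': "b' \<in> carrier B"
    show "pure_tensor K A B a (b \<oplus>\<^bsub>B\<^esub> b') = pure_tensor K A B a b \<oplus>\<^bsub>tensor_space K A B\<^esub> pure_tensor K A B a b'"
      unfolding pure_tensor_def linear_map_add[OF L sp[OF a b] sp[OF a b'], symmetric]
    proof (rule tensor_coset_eqI)
      show "single K (a, b \<oplus>\<^bsub>B\<^esub> b') \<ominus>\<^bsub>Fp\<^esub> (single K (a, b) \<oplus>\<^bsub>Fp\<^esub> single K (a, b')) \<in> tensor_relations K A B"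
        unfolding tensor_relations_def Let_def using a b b' by blast
    qed (use a b b' sp in auto)
  }
  {
    fix a' assume a': "a' \<in> carrier A"
    show "pure_tensor K A B (a \<oplus>\<^bsub>A\<^esub> a') b = pure_tensor K A B a b \<oplus>\<^bsub>tensor_space K A B\<^esub> pure_tensor K A B a' b"
      unfolding pure_tensor_def linear_map_add[OF L sp[OF a b] sp[OF a' b], symmetric]
    proof (rule tensor_coset_eqI)
      show "single K (a \<oplus>\<^bsub>A\<^esub> a', b) \<ominus>\<^bsub>Fp\<^esub> (single K (a, b) \<oplus>\<^bsub>Fp\<^esub> single K (a', b)) \<in> tensor_relations K A B"
        unfolding tensor_relations_def Let_def using a b a' by blast
    qed (use a b a' sp in auto)
  }
  fix c assume c: "c \<in> carrier K"
  show "pure_tensor K A B a (c \<odot>\<^bsub>B\<^esub> b) = c \<odot>\<^bsub>tensor_space K A B\<^esub> pure_tensor K A B a b"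
    unfolding pure_tensor_def linear_map_smult[OF L c sp[OF a b], symmetric]
  proof (rule tensor_coset_eqI)
    show "single K (a, c \<odot>\<^bsub>B\<^esub> b) \<ominus>\<^bsub>Fp\<^esub> (c \<odot>\<^bsub>Fp\<^esub> single K (a, b)) \<in> tensor_relations K A B"
      unfolding tensor_relations_def Let_def using a b c by blast
  qed (use a b c sp in auto)
  show "pure_tensor K A B (c \<odot>\<^bsub>A\<^esub> a) b = c \<odot>\<^bsub>tensor_space K A B\<^esub> pure_tensor K A B a b"
    unfolding pure_tensor_def linear_map_smult[OF L c sp[OF a b], symmetric]
  proof (rule tensor_coset_eqI)
    show "single K (c \<odot>\<^bsub>A\<^esub> a, b) \<ominus>\<^bsub>Fp\<^esub> (c \<odot>\<^bsub>Fp\<^esub> single K (a, b)) \<in> tensor_relations K A B"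
      unfolding tensor_relations_def Let_def using a b c by blast
  qed (use a b c sp in auto)
qed

lemmas pure_tensor_in = bilinear_map_in[OF pure_tensor_bilinear]

lemma tensor_space_span:
  "carrier (tensor_space K A B) =
    lin_span K (tensor_space K A B) {pure_tensor K A B a b | a b. a \<in> carrier A \<and> b \<in> carrier B}"
proof -
  have eq: "{pure_tensor K A B a b | a b. a \<in> carrier A \<and> b \<in> carrier B} =
      (\<lambda>r. tensor_kernel K A B +>\<^bsub>Fp\<^esub> r) ` single K ` (carrier A \<times> carrier B)"
    by (force simp: pure_tensor_def)
  show ?thesis
    unfolding eq
    by (rule surjective_image_span[OF free_module_pairs tensor_space_module tensor_projection_linear
          tensor_space_carrier[symmetric] free_module_span[OF A.R.is_cring]])
qed

text \<open>One factor at a time: for fixed \<open>s\<close> the map \<open>b \<mapsto> s \<otimes> b\<close> carries the span of \<open>U\<close> into the span of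
  the given tensors, and then so does \<open>a \<mapsto> a \<otimes> b\<close> for the span of \<open>S\<close>.\<close>

lemma tensor_space_span_of:
  assumes S: "carrier A = lin_span K A S" and U: "carrier B = lin_span K B U"
  shows "carrier (tensor_space K A B) =
    lin_span K (tensor_space K A B) {pure_tensor K A B s u | s u. s \<in> S \<and> u \<in> U}"
proof (rule lin_span_eq_carrierI[OF tensor_space_module _ tensor_space_span])
  let ?T = "tensor_space K A B"
  let ?W = "{pure_tensor K A B s u | s u. s \<in> S \<and> u \<in> U}"
  have SA: "S \<subseteq> carrier A" and UB: "U \<subseteq> carrier B"
    using S U lin_span_superset[of S K A] lin_span_superset[of U K B] by auto
  then show W: "?W \<subseteq> carrier ?T" using pure_tensor_in by auto
  note LW = lin_span_submodule[OF tensor_space_module W]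
  have LWc: "lin_span K ?T ?W \<subseteq> carrier ?T" using submodule_carrier[OF LW] by auto
  have 1: "pure_tensor K A B s b \<in> lin_span K ?T ?W" if s: "s \<in> S" and b: "b \<in> carrier B" for s b
  proof (rule linear_image_span[OF B tensor_space_module bilinear_map_right[OF pure_tensor_bilinear] UB _ W])
    show "s \<in> carrier A" using s SA by auto
    show "pure_tensor K A B s ` U \<subseteq> ?W" using s by auto
    show "b \<in> lin_span K B U" using b U by simp
  qed
  have 2: "pure_tensor K A B a b \<in> lin_span K ?T ?W" if a: "a \<in> carrier A" and b: "b \<in> carrier B" for a b
  proof -
    have "pure_tensor K A B a b \<in> lin_span K ?T (lin_span K ?T ?W)"
    proof (rule linear_image_span[OF A tensor_space_module bilinear_map_left[OF pure_tensor_bilinear b] SA _ LWc])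
      show "(\<lambda>a. pure_tensor K A B a b) ` S \<subseteq> lin_span K ?T ?W" using 1[OF _ b] by (rule image_subsetI)
      show "a \<in> lin_span K A S" using a S by simp
    qed
    also have "\<dots> \<subseteq> lin_span K ?T ?W" by (rule lin_span_least[OF LW order_refl])
    finally show ?thesis .
  qed
  show "{pure_tensor K A B a b | a b. a \<in> carrier A \<and> b \<in> carrier B} \<subseteq> lin_span K ?T ?W"
    using 2 by blast
qed

text \<open>The linear extension of \<open>f\<close> to the free module kills the tensor relations because \<open>f\<close> is
  bilinear.  It is therefore constant on every coset, and \<open>the_elem\<close> returns that constant.\<close>

lemma tensor_lift_coset:
  assumes P: "module K P" and f: "(\<lambda>a b. f (a, b)) \<in> bilinear_maps K A B P" and r: "r \<in> carrier Fp"
  shows "tensor_lift K P f (tensor_kernel K A B +>\<^bsub>Fp\<^esub> r) = free_extend K P f r"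
proof -
  interpret P: module K P by fact
  have fP: "f \<in> carrier A \<times> carrier B \<rightarrow> carrier P"
    using bilinear_map_in[OF f] by auto
  note L = free_extend_linear[OF P fP]
  note Ls = free_extend_single[OF P fP]
  note Fm = free_module_pairs
  have "free_extend K P f x = \<zero>\<^bsub>P\<^esub>" if "x \<in> tensor_relations K A B" for x
  proof -
    note m = linear_map_minus[OF Fm P L] and ad = linear_map_add[OF L] and sm = linear_map_smult[OF L]
    have fin: "f (a, b) \<in> carrier P" if "a \<in> carrier A" "b \<in> carrier B" for a b
      using bilinear_map_in[OF f that] .
    have diff: "u \<ominus>\<^bsub>P\<^esub> u = \<zero>\<^bsub>P\<^esub>" if "u \<in> carrier P" for u
      using that by (simp add: a_minus_def P.M.r_neg)
    note fl = bilinear_map_left[OF f] and fr = bilinear_map_right[OF f]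
    from that show ?thesis
      unfolding tensor_relations_def Let_def
      by (auto simp: m ad sm Ls single_pair fin linear_map_add[OF fl] linear_map_add[OF fr]
          linear_map_smult[OF fl] linear_map_smult[OF fr] diff)
  qed
  moreover have "submodule {x \<in> carrier Fp. free_extend K P f x = \<zero>\<^bsub>P\<^esub>} K Fp"
    by (rule submodule_intro[OF Fm]) (auto simp: linear_mapD[OF L] linear_map_zero[OF Fm P L])
  ultimately have "tensor_kernel K A B \<subseteq> {x \<in> carrier Fp. free_extend K P f x = \<zero>\<^bsub>P\<^esub>}"
    unfolding tensor_kernel_def using tensor_relations_carrier by (intro lin_span_least) auto
  then have L0: "i \<in> carrier Fp" "free_extend K P f i = \<zero>\<^bsub>P\<^esub>" if "i \<in> tensor_kernel K A B" for i
    using that by auto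
  have const: "free_extend K P f x = free_extend K P f r" if x: "x \<in> tensor_kernel K A B +>\<^bsub>Fp\<^esub> r" for x
  proof -
    obtain i where i: "i \<in> tensor_kernel K A B" "x = i \<oplus>\<^bsub>Fp\<^esub> r"
      using x by (auto simp: a_r_coset_def')
    then show ?thesis
      using L0[OF i(1)] linear_map_add[OF L _ r] linear_map_closed[OF L r] by simp
  qed
  have rin: "r \<in> tensor_kernel K A B +>\<^bsub>Fp\<^esub> r"
    using submodule_zero[OF tensor_kernel_submodule] Fp.M.l_zero[OF r]
    unfolding a_r_coset_def' by (auto intro!: bexI)
  have "free_extend K P f ` (tensor_kernel K A B +>\<^bsub>Fp\<^esub> r) =
      (\<lambda>_. free_extend K P f r) ` (tensor_kernel K A B +>\<^bsub>Fp\<^esub> r)"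
    by (rule image_cong[OF refl const])
  also have "\<dots> = {free_extend K P f r}" by (rule image_constant[OF rin])
  finally have "free_extend K P f ` (tensor_kernel K A B +>\<^bsub>Fp\<^esub> r) = {free_extend K P f r}" .
  then show ?thesis
    unfolding tensor_lift_def free_extend_def[symmetric] by (metis the_elem_eq)
qed

text \<open>The universal property of the tensor product.\<close>

lemma tensor_lift_linear:
  assumes P: "module K P" and f: "(\<lambda>a b. f (a, b)) \<in> bilinear_maps K A B P"
  shows "tensor_lift K P f \<in> linear_maps K (tensor_space K A B) P"
    and "a \<in> carrier A \<Longrightarrow> b \<in> carrier B \<Longrightarrow> tensor_lift K P f (pure_tensor K A B a b) = f (a, b)"
proof -
  have fP: "f \<in> carrier A \<times> carrier B \<rightarrow> carrier P"
    using bilinear_map_in[OF f] by auto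
  note L = free_extend_linear[OF P fP]
  note C = tensor_lift_coset[OF P f]
  note TL = tensor_projection_linear
  show "tensor_lift K P f \<in> linear_maps K (tensor_space K A B) P"
  proof (rule linear_mapsI)
    fix x assume "x \<in> carrier (tensor_space K A B)"
    then obtain r where r: "r \<in> carrier Fp" "x = tensor_kernel K A B +>\<^bsub>Fp\<^esub> r"
      using tensor_space_carrier by auto
    then show "tensor_lift K P f x \<in> carrier P" by (simp add: C linear_map_closed[OF L])
    show "tensor_lift K P f (c \<odot>\<^bsub>tensor_space K A B\<^esub> x) = c \<odot>\<^bsub>P\<^esub> tensor_lift K P f x" if c: "c \<in> carrier K" for c
      unfolding r(2) linear_map_smult[OF TL c r(1), symmetric]
      using r c by (simp add: C linear_map_smult[OF L])
    fix y assume "y \<in> carrier (tensor_space K A B)"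
    then obtain s where s: "s \<in> carrier Fp" "y = tensor_kernel K A B +>\<^bsub>Fp\<^esub> s"
      using tensor_space_carrier by auto
    show "tensor_lift K P f (x \<oplus>\<^bsub>tensor_space K A B\<^esub> y) = tensor_lift K P f x \<oplus>\<^bsub>P\<^esub> tensor_lift K P f y"
      unfolding r(2) s(2) linear_map_add[OF TL r(1) s(1), symmetric]
      using r s by (simp add: C linear_map_add[OF L])
  qed
  show "a \<in> carrier A \<Longrightarrow> b \<in> carrier B \<Longrightarrow> tensor_lift K P f (pure_tensor K A B a b) = f (a, b)"
    unfolding pure_tensor_def by (simp add: C single_pair free_extend_single[OF P fP])
qed

lemma tensor_ext:
  assumes "module K P" "f \<in> linear_maps K (tensor_space K A B) P" "g \<in> linear_maps K (tensor_space K A B) P"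
    and "carrier A = lin_span K A S" "carrier B = lin_span K B U"
    and "\<And>s u. s \<in> S \<Longrightarrow> u \<in> U \<Longrightarrow> f (pure_tensor K A B s u) = g (pure_tensor K A B s u)"
    and "x \<in> carrier (tensor_space K A B)"
  shows "f x = g x"
  by (rule linear_maps_eqI[OF tensor_space_module assms(1) tensor_space_span_of[OF assms(4,5)] assms(2,3) _ assms(7)])
    (use assms(6) in auto)

end

lemma tensor_map:
  assumes "module K A" "module K B" and C: "module K C" and D: "module K D"
    and f: "f \<in> linear_maps K A C" and g: "g \<in> linear_maps K B D"
  shows "tensor_map K C D f g \<in> linear_maps K (tensor_space K A B) (tensor_space K C D)"
    and "a \<in> carrier A \<Longrightarrow> b \<in> carrier B \<Longrightarrow>
      tensor_map K C D f g (pure_tensor K A B a b) = pure_tensor K C D (f a) (g b)"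
proof -
  have "(\<lambda>a b. (case (a, b) of (a, b) \<Rightarrow> pure_tensor K C D (f a) (g b))) \<in> bilinear_maps K A B (tensor_space K C D)"
    using bilinear_map_comp[OF pure_tensor_bilinear[OF C D] f g linear_map_id] by simp
  from tensor_lift_linear[OF assms(1,2) tensor_space_module[OF C D] this]
  show "tensor_map K C D f g \<in> linear_maps K (tensor_space K A B) (tensor_space K C D)"
    and "a \<in> carrier A \<Longrightarrow> b \<in> carrier B \<Longrightarrow>
      tensor_map K C D f g (pure_tensor K A B a b) = pure_tensor K C D (f a) (g b)"
    unfolding tensor_map_def by auto
qed

text \<open>Both the ordinary and the twisted multiplication of \<open>A \<otimes> B\<close> are nested lifts of a map that is
  linear in each of its four arguments.\<close>

lemma tensor_double_lift:
  assumes A: "module K A" and B: "module K B" and A2: "module K A2" and B2: "module K B2" and P: "module K P"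
    and G2: "\<And>a b. a \<in> carrier A \<Longrightarrow> b \<in> carrier B \<Longrightarrow> G a b \<in> bilinear_maps K A2 B2 P"
    and G1: "\<And>a b. a \<in> carrier A2 \<Longrightarrow> b \<in> carrier B2 \<Longrightarrow> (\<lambda>a' b'. G a' b' a b) \<in> bilinear_maps K A B P"
  shows "(\<lambda>x y. tensor_lift K P (\<lambda>(a, b). tensor_lift K P (\<lambda>(a', b'). G a b a' b') y) x)
      \<in> bilinear_maps K (tensor_space K A B) (tensor_space K A2 B2) P"
    and "a \<in> carrier A \<Longrightarrow> b \<in> carrier B \<Longrightarrow> a' \<in> carrier A2 \<Longrightarrow> b' \<in> carrier B2 \<Longrightarrow>
      tensor_lift K P (\<lambda>(a, b). tensor_lift K P (\<lambda>(a', b'). G a b a' b') (pure_tensor K A2 B2 a' b'))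
        (pure_tensor K A B a b) = G a b a' b'"
proof -
  note T2 = tensor_lift_linear[OF A2 B2 P] tensor_space_module[OF A2 B2] tensor_space_span[OF A2 B2]
  note T1 = tensor_lift_linear[OF A B P] tensor_space_module[OF A B] tensor_space_span[OF A B]
  define h where "h a b = tensor_lift K P (\<lambda>(a', b'). G a b a' b')" for a b
  have hl: "h a b \<in> linear_maps K (tensor_space K A2 B2) P" if "a \<in> carrier A" "b \<in> carrier B" for a b
    unfolding h_def using T2(1)[of "\<lambda>(a', b'). G a b a' b'"] G2[OF that] by simp
  have hp: "h a b (pure_tensor K A2 B2 a' b') = G a b a' b'"
    if "a \<in> carrier A" "b \<in> carrier B" "a' \<in> carrier A2" "b' \<in> carrier B2" for a b a' b'
    unfolding h_def using T2(2)[of "\<lambda>(a', b'). G a b a' b'"] G2[OF that(1,2)] that by simp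
  \<comment> \<open>The inner lift, at a fixed second argument, is bilinear, so that it can be lifted in turn.\<close>
  have hb: "(\<lambda>a b. h a b y) \<in> bilinear_maps K A B P" if y: "y \<in> carrier (tensor_space K A2 B2)" for y
  proof (rule bilinear_map_parameter[OF A B P T2(3,4) hl _ y])
    fix s assume "s \<in> {pure_tensor K A2 B2 a b | a b. a \<in> carrier A2 \<and> b \<in> carrier B2}"
    then obtain a' b' where s: "s = pure_tensor K A2 B2 a' b'" "a' \<in> carrier A2" "b' \<in> carrier B2" by blast
    show "(\<lambda>a b. h a b s) \<in> bilinear_maps K A B P"
      by (rule bilinear_map_cong[OF A B G1[OF s(2,3)]]) (use hp s in auto)
  qed
  define m where "m x y = tensor_lift K P (\<lambda>(a, b). h a b y) x" for x y
  have ml: "(\<lambda>x. m x y) \<in> linear_maps K (tensor_space K A B) P"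
    and mp: "\<And>a b. a \<in> carrier A \<Longrightarrow> b \<in> carrier B \<Longrightarrow> m (pure_tensor K A B a b) y = h a b y"
    if y: "y \<in> carrier (tensor_space K A2 B2)" for y
    unfolding m_def using T1(1,2)[of "\<lambda>(a, b). h a b y"] hb[OF y] by auto
  have "(\<lambda>y x. m x y) \<in> bilinear_maps K (tensor_space K A2 B2) (tensor_space K A B) P"
  proof (rule bilinear_mapsI)
    fix x assume x: "x \<in> carrier (tensor_space K A B)"
    have sub: "{pure_tensor K A B a b | a b. a \<in> carrier A \<and> b \<in> carrier B} \<subseteq> carrier (tensor_space K A B)"
      using pure_tensor_in[OF A B] by auto
    from T1(3) x[unfolded T1(4)] sub
    show "(\<lambda>y. m x y) \<in> linear_maps K (tensor_space K A2 B2) P"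
    proof (induction rule: lin_span_induct)
      case (base s)
      then obtain a b where s: "s = pure_tensor K A B a b" "a \<in> carrier A" "b \<in> carrier B" by blast
      show ?case by (rule linear_map_cong[OF T2(3) hl[OF s(2,3)]]) (use mp s in auto)
    next
      case zero
      show ?case
        by (rule linear_map_cong[OF T2(3) linear_map_const_zero[OF P]])
          (rule linear_map_zero[OF T1(3) P ml])
    next
      case (add x y)
      show ?case
        by (rule linear_map_cong[OF T2(3) linear_map_plus[OF P add(3,4)]])
          (use linear_map_add[OF ml add(1,2)] in auto)
    next
      case (smult c x)
      show ?case
        by (rule linear_map_cong[OF T2(3) linear_map_scale[OF P smult(3,1)]])
          (use linear_map_smult[OF ml smult(1,2)] in auto)
    qed
  qed (rule ml)
  then have mb: "m \<in> bilinear_maps K (tensor_space K A B) (tensor_space K A2 B2) P"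
    by (rule bilinear_map_flip)
  then show "(\<lambda>x y. tensor_lift K P (\<lambda>(a, b). tensor_lift K P (\<lambda>(a', b'). G a b a' b') y) x)
      \<in> bilinear_maps K (tensor_space K A B) (tensor_space K A2 B2) P"
    unfolding m_def h_def .
  assume a: "a \<in> carrier A" "b \<in> carrier B" "a' \<in> carrier A2" "b' \<in> carrier B2"
  have "pure_tensor K A2 B2 a' b' \<in> carrier (tensor_space K A2 B2)"
    by (rule pure_tensor_in[OF A2 B2 a(3,4)])
  then have "m (pure_tensor K A B a b) (pure_tensor K A2 B2 a' b') = G a b a' b'"
    using mp hp a by simp
  then show "tensor_lift K P (\<lambda>(a, b). tensor_lift K P (\<lambda>(a', b'). G a b a' b') (pure_tensor K A2 B2 a' b'))
        (pure_tensor K A B a b) = G a b a' b'"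
    unfolding m_def h_def .
qed

section \<open>Algebra structures on the tensor product\<close>

lemma tensor_algebra_same_space: "same_space (tensor_space K A B) (tensor_algebra K A B)"
  and tensor_algebra_one: "one (tensor_algebra K A B) = pure_tensor K A B \<one>\<^bsub>A\<^esub> \<one>\<^bsub>B\<^esub>"
  by (simp_all add: same_space_def tensor_algebra_def)

lemma twisted_tensor_same_space: "same_space (tensor_space K A B) (twisted_tensor_algebra K A B tau)"
  and twisted_tensor_one: "one (twisted_tensor_algebra K A B tau) = pure_tensor K A B \<one>\<^bsub>A\<^esub> \<one>\<^bsub>B\<^esub>"
  by (simp_all add: same_space_def twisted_tensor_algebra_def)

context
  fixes K :: "('k, 'x) ring_scheme" and A :: "('k, 'a, 'y) module_scheme"
    and B :: "('k, 'b, 'z) module_scheme"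
  assumes A: "k_algebra K A" and B: "k_algebra K B"
begin

interpretation A: k_algebra K A by (rule A)
interpretation B: k_algebra K B by (rule B)

private abbreviation (input) "TAB \<equiv> tensor_space K A B"

private lemmas AM = k_algebra_module[OF A]
private lemmas BM = k_algebra_module[OF B]
private lemmas TM = tensor_space_module[OF k_algebra_module[OF A] k_algebra_module[OF B]]
private lemmas pure_bil = pure_tensor_bilinear[OF k_algebra_module[OF A] k_algebra_module[OF B]]
private lemmas mA = k_algebra_mult_bilinear[OF A]
private lemmas mB = k_algebra_mult_bilinear[OF B]

lemma tensor_algebra_mult:
  shows "(\<otimes>\<^bsub>tensor_algebra K A B\<^esub>) \<in> bilinear_maps K TAB TAB TAB"
    and "a \<in> carrier A \<Longrightarrow> b \<in> carrier B \<Longrightarrow> a' \<in> carrier A \<Longrightarrow> b' \<in> carrier B \<Longrightarrow>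
      pure_tensor K A B a b \<otimes>\<^bsub>tensor_algebra K A B\<^esub> pure_tensor K A B a' b' =
      pure_tensor K A B (a \<otimes>\<^bsub>A\<^esub> a') (b \<otimes>\<^bsub>B\<^esub> b')"
proof -
  have G2: "(\<lambda>a' b'. pure_tensor K A B (a \<otimes>\<^bsub>A\<^esub> a') (b \<otimes>\<^bsub>B\<^esub> b')) \<in> bilinear_maps K A B TAB"
    if "a \<in> carrier A" "b \<in> carrier B" for a b
    by (rule bilinear_map_comp[OF pure_bil bilinear_map_right[OF mA that(1)] bilinear_map_right[OF mB that(2)] linear_map_id])
  have G1: "(\<lambda>a' b'. pure_tensor K A B (a' \<otimes>\<^bsub>A\<^esub> a) (b' \<otimes>\<^bsub>B\<^esub> b)) \<in> bilinear_maps K A B TAB"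
    if "a \<in> carrier A" "b \<in> carrier B" for a b
    by (rule bilinear_map_comp[OF pure_bil bilinear_map_left[OF mA that(1)] bilinear_map_left[OF mB that(2)] linear_map_id])
  have m: "(\<otimes>\<^bsub>tensor_algebra K A B\<^esub>) = (\<lambda>x y. tensor_lift K TAB (\<lambda>(a, b). tensor_lift K TAB (\<lambda>(a', b').
      pure_tensor K A B (a \<otimes>\<^bsub>A\<^esub> a') (b \<otimes>\<^bsub>B\<^esub> b')) y) x)"
    by (simp add: tensor_algebra_def)
  note D = tensor_double_lift[OF AM BM AM BM TM,
      where G = "\<lambda>a b a' b'. pure_tensor K A B (a \<otimes>\<^bsub>A\<^esub> a') (b \<otimes>\<^bsub>B\<^esub> b')", OF G2 G1]
  show "(\<otimes>\<^bsub>tensor_algebra K A B\<^esub>) \<in> bilinear_maps K TAB TAB TAB"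
    unfolding m by (rule D(1)) assumption+
  show "a \<in> carrier A \<Longrightarrow> b \<in> carrier B \<Longrightarrow> a' \<in> carrier A \<Longrightarrow> b' \<in> carrier B \<Longrightarrow>
      pure_tensor K A B a b \<otimes>\<^bsub>tensor_algebra K A B\<^esub> pure_tensor K A B a' b' =
      pure_tensor K A B (a \<otimes>\<^bsub>A\<^esub> a') (b \<otimes>\<^bsub>B\<^esub> b')"
    unfolding m by (rule D(2))
qed

lemma tensor_algebra_k_algebra: "k_algebra K (tensor_algebra K A B)"
proof -
  let ?E = "tensor_algebra K A B"
  note ss = tensor_algebra_same_space[of K A B]
  note P = pure_tensor_in[OF AM BM]
  show ?thesis
  proof (rule k_algebraI_span[OF k_algebra_field[OF A] module_same_space[OF TM ss]])
    show "(\<otimes>\<^bsub>?E\<^esub>) \<in> bilinear_maps K ?E ?E ?E"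
      using tensor_algebra_mult(1) ss
      by (simp add: bilinear_maps_def linear_maps_same_space[OF ss ss] same_space_def)
    show "\<one>\<^bsub>?E\<^esub> \<in> carrier ?E"
      using P ss by (simp add: tensor_algebra_one same_space_def)
    show "carrier ?E = lin_span K ?E {pure_tensor K A B a b | a b. a \<in> carrier A \<and> b \<in> carrier B}"
      using tensor_space_span[OF AM BM] ss unfolding lin_span_same_space[OF ss] same_space_def by simp
    fix s assume "s \<in> {pure_tensor K A B a b | a b. a \<in> carrier A \<and> b \<in> carrier B}"
    then obtain a b where s: "s = pure_tensor K A B a b" "a \<in> carrier A" "b \<in> carrier B" by blast
    show "\<one>\<^bsub>?E\<^esub> \<otimes>\<^bsub>?E\<^esub> s = s" "s \<otimes>\<^bsub>?E\<^esub> \<one>\<^bsub>?E\<^esub> = s"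
      using s by (simp_all add: tensor_algebra_one tensor_algebra_mult(2))
    fix t u assume "t \<in> {pure_tensor K A B a b | a b. a \<in> carrier A \<and> b \<in> carrier B}"
      and "u \<in> {pure_tensor K A B a b | a b. a \<in> carrier A \<and> b \<in> carrier B}"
    then obtain a' b' a'' b'' where "t = pure_tensor K A B a' b'" "a' \<in> carrier A" "b' \<in> carrier B"
      "u = pure_tensor K A B a'' b''" "a'' \<in> carrier A" "b'' \<in> carrier B" by blast
    with s show "s \<otimes>\<^bsub>?E\<^esub> t \<otimes>\<^bsub>?E\<^esub> u = s \<otimes>\<^bsub>?E\<^esub> (t \<otimes>\<^bsub>?E\<^esub> u)"
      by (simp add: tensor_algebra_mult(2) A.A.m_assoc B.A.m_assoc)
  qed
qed

text \<open>The product depends linearly on \<open>z = tau (b \<otimes> a')\<close>.  For its bilinearity in the outer arguments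
  \<open>a\<close> and \<open>b'\<close> it is therefore enough to let \<open>z\<close> be a pure tensor \<open>c \<otimes> d\<close>, where the value is
  \<open>a c \<otimes> d b'\<close>.\<close>

lemma twisted_tensor_mult:
  assumes tau: "tau \<in> linear_maps K (tensor_space K B A) TAB"
  shows "(\<otimes>\<^bsub>twisted_tensor_algebra K A B tau\<^esub>) \<in> bilinear_maps K TAB TAB TAB"
    and "a \<in> carrier A \<Longrightarrow> b \<in> carrier B \<Longrightarrow> a' \<in> carrier A \<Longrightarrow> b' \<in> carrier B \<Longrightarrow>
      pure_tensor K A B a b \<otimes>\<^bsub>twisted_tensor_algebra K A B tau\<^esub> pure_tensor K A B a' b' =
      tensor_map K A B (\<lambda>c. a \<otimes>\<^bsub>A\<^esub> c) (\<lambda>d. d \<otimes>\<^bsub>B\<^esub> b') (tau (pure_tensor K B A b a'))"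
proof -
  define G where "G a b a' b' = tensor_map K A B (\<lambda>c. a \<otimes>\<^bsub>A\<^esub> c) (\<lambda>d. d \<otimes>\<^bsub>B\<^esub> b') (tau (pure_tensor K B A b a'))" for a b a' b'
  note tm = tensor_map[OF AM BM AM BM bilinear_map_right[OF mA] bilinear_map_left[OF mB]]
  \<comment> \<open>Linearity in the outer arguments, for an arbitrary value \<open>z\<close> of the twisting map.\<close>
  have tb: "(\<lambda>a b'. tensor_map K A B (\<lambda>c. a \<otimes>\<^bsub>A\<^esub> c) (\<lambda>d. d \<otimes>\<^bsub>B\<^esub> b') z) \<in> bilinear_maps K A B TAB"
    if z: "z \<in> carrier TAB" for z
  proof (rule bilinear_map_parameter[OF AM BM TM TM tensor_space_span[OF AM BM] tm(1) _ z])
    fix s assume "s \<in> {pure_tensor K A B a b | a b. a \<in> carrier A \<and> b \<in> carrier B}"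
    then obtain c d where s: "s = pure_tensor K A B c d" "c \<in> carrier A" "d \<in> carrier B" by blast
    have "(\<lambda>a b'. pure_tensor K A B (a \<otimes>\<^bsub>A\<^esub> c) (d \<otimes>\<^bsub>B\<^esub> b')) \<in> bilinear_maps K A B TAB"
      by (rule bilinear_map_comp[OF pure_bil bilinear_map_left[OF mA s(2)] bilinear_map_right[OF mB s(3)] linear_map_id])
    then show "(\<lambda>a b'. tensor_map K A B (\<lambda>c. a \<otimes>\<^bsub>A\<^esub> c) (\<lambda>d. d \<otimes>\<^bsub>B\<^esub> b') s) \<in> bilinear_maps K A B TAB"
      by (rule bilinear_map_cong[OF AM BM]) (use s tm(2) in auto)
  qed
  note pBA = pure_tensor_bilinear[OF BM AM]
  have tp: "tau (pure_tensor K B A b a') \<in> carrier TAB" if "b \<in> carrier B" "a' \<in> carrier A" for b a'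
    using linear_map_closed[OF tau bilinear_map_in[OF pBA that]] .
  have tbil: "(\<lambda>b a'. tau (pure_tensor K B A b a')) \<in> bilinear_maps K B A TAB"
    using bilinear_map_comp[OF pBA linear_map_id linear_map_id tau] .
  have G2: "G a b \<in> bilinear_maps K A B TAB" if a: "a \<in> carrier A" and b: "b \<in> carrier B" for a b
  proof (rule bilinear_mapsI)
    show "G a b a' \<in> linear_maps K B TAB" if a': "a' \<in> carrier A" for a'
      unfolding G_def using bilinear_map_right[OF tb[OF tp[OF b a']] a] .
    show "(\<lambda>a'. G a b a' b') \<in> linear_maps K A TAB" if b': "b' \<in> carrier B" for b'
      unfolding G_def by (rule linear_map_comp[OF bilinear_map_right[OF tbil b] tm(1)[OF a b']])
  qed
  have G1: "(\<lambda>a b. G a b a' b') \<in> bilinear_maps K A B TAB" if a': "a' \<in> carrier A" and b': "b' \<in> carrier B" for a' b'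
  proof (rule bilinear_mapsI)
    show "(\<lambda>b. G a b a' b') \<in> linear_maps K B TAB" if a: "a \<in> carrier A" for a
      unfolding G_def by (rule linear_map_comp[OF bilinear_map_left[OF tbil a'] tm(1)[OF a b']])
    show "(\<lambda>a. G a b a' b') \<in> linear_maps K A TAB" if b: "b \<in> carrier B" for b
      unfolding G_def using bilinear_map_left[OF tb[OF tp[OF b a']] b'] .
  qed
  have m: "(\<otimes>\<^bsub>twisted_tensor_algebra K A B tau\<^esub>) =
      (\<lambda>x y. tensor_lift K TAB (\<lambda>(a, b). tensor_lift K TAB (\<lambda>(a', b'). G a b a' b') y) x)"
    by (simp add: twisted_tensor_algebra_def G_def)
  note D = tensor_double_lift[OF AM BM AM BM TM, where G = G, OF G2 G1]
  show "(\<otimes>\<^bsub>twisted_tensor_algebra K A B tau\<^esub>) \<in> bilinear_maps K TAB TAB TAB"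
    unfolding m by (rule D(1)) assumption+
  show "a \<in> carrier A \<Longrightarrow> b \<in> carrier B \<Longrightarrow> a' \<in> carrier A \<Longrightarrow> b' \<in> carrier B \<Longrightarrow>
      pure_tensor K A B a b \<otimes>\<^bsub>twisted_tensor_algebra K A B tau\<^esub> pure_tensor K A B a' b' =
      tensor_map K A B (\<lambda>c. a \<otimes>\<^bsub>A\<^esub> c) (\<lambda>d. d \<otimes>\<^bsub>B\<^esub> b') (tau (pure_tensor K B A b a'))"
    unfolding m G_def[symmetric] by (rule D(2))
qed

end

section \<open>The grading of a tensor product\<close>

lemma pure_tensor_homogeneous:
  assumes "a \<in> grA \<alpha>" "b \<in> grB \<beta>"
  shows "pure_tensor K A B a b \<in> tensor_grading K A B grA grB (\<alpha>, \<beta>)"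
proof -
  have "pure_tensor K A B a b \<in> {pure_tensor K A B a b | a b. a \<in> grA \<alpha> \<and> b \<in> grB \<beta>}"
    using assms by blast
  then show ?thesis unfolding tensor_grading_def prod.case using lin_span_superset by (rule rev_subsetD)
qed

text \<open>The tensor product of the projections of degrees \<open>\<alpha>\<close> and \<open>\<beta>\<close> is a projection of degree
  \<open>(\<alpha>, \<beta>)\<close>.\<close>

lemma tensor_grading_grading:
  assumes A: "grading K \<Gamma> A grA" and B: "grading K \<Delta> B grB"
  shows "grading K (\<Gamma> \<times>\<times> \<Delta>) (tensor_space K A B) (tensor_grading K A B grA grB)"
proof -
  let ?T = "tensor_space K A B"
  let ?gr = "tensor_grading K A B grA grB"
  note AM = grading_module[OF A] and BM = grading_module[OF B]
  note TM = tensor_space_module[OF AM BM]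
  interpret TM: module K ?T by (rule TM)
  have gen: "{pure_tensor K A B a b | a b. a \<in> grA \<alpha> \<and> b \<in> grB \<beta>} \<subseteq> carrier ?T"
    if "\<alpha> \<in> carrier \<Gamma>" "\<beta> \<in> carrier \<Delta>" for \<alpha> \<beta>
    using pure_tensor_in[OF AM BM] grading_carrier[OF A that(1)] grading_carrier[OF B that(2)] by blast
  have sub: "submodule (?gr \<gamma>) K ?T" if "\<gamma> \<in> carrier (\<Gamma> \<times>\<times> \<Delta>)" for \<gamma>
    using lin_span_submodule[OF TM gen] that by (auto simp: tensor_grading_def)
  define p where "p = (\<lambda>(\<alpha>, \<beta>). tensor_map K A B (graded_proj K \<Gamma> A grA \<alpha>) (graded_proj K \<Delta> B grB \<beta>))"
  show ?thesis
  proof (rule gradingI[OF TM sub, where p = p])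
    have "{pure_tensor K A B s u | s u. s \<in> (\<Union>\<alpha>\<in>carrier \<Gamma>. grA \<alpha>) \<and> u \<in> (\<Union>\<beta>\<in>carrier \<Delta>. grB \<beta>)}
        \<subseteq> (\<Union>\<gamma>\<in>carrier (\<Gamma> \<times>\<times> \<Delta>). ?gr \<gamma>)"
      using pure_tensor_homogeneous[of _ grA _ _ grB] by fastforce
    then have "{pure_tensor K A B s u | s u. s \<in> (\<Union>\<alpha>\<in>carrier \<Gamma>. grA \<alpha>) \<and> u \<in> (\<Union>\<beta>\<in>carrier \<Delta>. grB \<beta>)}
        \<subseteq> lin_span K ?T (\<Union>\<gamma>\<in>carrier (\<Gamma> \<times>\<times> \<Delta>). ?gr \<gamma>)"
      using lin_span_superset by (rule subset_trans)
    moreover have "(\<Union>\<gamma>\<in>carrier (\<Gamma> \<times>\<times> \<Delta>). ?gr \<gamma>) \<subseteq> carrier ?T"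
      using submodule_carrier[OF sub] by blast
    ultimately show "carrier ?T = lin_span K ?T (\<Union>\<gamma>\<in>carrier (\<Gamma> \<times>\<times> \<Delta>). ?gr \<gamma>)"
      by (intro lin_span_eq_carrierI[OF TM _ tensor_space_span_of[OF AM BM grading_span[OF A] grading_span[OF B]]])
  next
    fix \<gamma> assume "\<gamma> \<in> carrier (\<Gamma> \<times>\<times> \<Delta>)"
    then obtain \<alpha> \<beta> where \<gamma>: "\<gamma> = (\<alpha>, \<beta>)" "\<alpha> \<in> carrier \<Gamma>" "\<beta> \<in> carrier \<Delta>" by auto
    note pA = graded_proj[OF A \<gamma>(2)] and pB = graded_proj[OF B \<gamma>(3)]
    note tm = tensor_map[OF AM BM AM BM pA(1) pB(1)]
    note bil = pure_tensor_bilinear[OF AM BM]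
    show "p \<gamma> \<in> linear_maps K ?T ?T" unfolding p_def \<gamma> prod.case by (rule tm(1))
    fix \<delta> x assume "\<delta> \<in> carrier (\<Gamma> \<times>\<times> \<Delta>)" and x: "x \<in> ?gr \<delta>"
    then obtain \<alpha>' \<beta>' where \<delta>: "\<delta> = (\<alpha>', \<beta>')" "\<alpha>' \<in> carrier \<Gamma>" "\<beta>' \<in> carrier \<Delta>" by auto
    have xs: "x \<in> lin_span K ?T {pure_tensor K A B a b | a b. a \<in> grA \<alpha>' \<and> b \<in> grB \<beta>'}"
      using x by (simp add: \<delta> tensor_grading_def)
    show "p \<gamma> x = (if \<delta> = \<gamma> then x else \<zero>\<^bsub>?T\<^esub>)"
      unfolding p_def \<gamma>(1) \<delta>(1) prod.case
      using TM xs gen[OF \<delta>(2,3)]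
    proof (induction rule: lin_span_induct)
      case (base s)
      then obtain a b where s: "s = pure_tensor K A B a b" "a \<in> grA \<alpha>'" "b \<in> grB \<beta>'" by blast
      then have ab: "a \<in> carrier A" "b \<in> carrier B"
        using grading_carrier[OF A \<delta>(2)] grading_carrier[OF B \<delta>(3)] by auto
      show ?case
        using s ab linear_map_zero[OF BM TM bilinear_map_right[OF bil ab(1)]]
          linear_map_zero[OF AM TM bilinear_map_left[OF bil ab(2)]]
          linear_map_zero[OF BM TM bilinear_map_right[OF bil, of "\<zero>\<^bsub>A\<^esub>"]]
          module.axioms(2)[OF AM, THEN abelian_group.axioms(1), THEN abelian_monoid.zero_closed]
        by (auto simp: tm(2) pA(2)[OF \<delta>(2)] pB(2)[OF \<delta>(3)])
    next
      case zero
      show ?case using linear_map_zero[OF TM TM tm(1)] by simp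
    qed (auto simp: linear_mapD[OF tm(1)])
  qed
qed

lemma tensor_graded_algebra:
  assumes A: "graded_algebra K \<Gamma> A grA" and B: "graded_algebra K \<Delta> B grB"
  shows "graded_algebra K (\<Gamma> \<times>\<times> \<Delta>) (tensor_algebra K A B) (tensor_grading K A B grA grB)"
proof -
  note A' = graded_algebraD[OF A] and B' = graded_algebraD[OF B]
  let ?T = "tensor_space K A B" and ?E = "tensor_algebra K A B"
  let ?gr = "tensor_grading K A B grA grB"
  interpret A: k_algebra K A by fact
  interpret B: k_algebra K B by fact
  note AM = k_algebra_module[OF A'(1)] and BM = k_algebra_module[OF B'(1)]
  note TM = tensor_space_module[OF AM BM]
  note G = tensor_grading_grading[OF A'(3) B'(3)]
  note mult = tensor_algebra_mult[OF A'(1) B'(1)]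
  interpret \<Gamma>: comm_group \<Gamma> by fact
  interpret \<Delta>: comm_group \<Delta> by fact
  have "comm_group (\<Gamma> \<times>\<times> \<Delta>)"
    by (rule group.group_comm_groupI[OF DirProd_group[OF \<Gamma>.is_group \<Delta>.is_group]])
      (auto simp: \<Gamma>.m_comm \<Delta>.m_comm)
  moreover have "x \<otimes>\<^bsub>?E\<^esub> y \<in> ?gr (\<gamma> \<otimes>\<^bsub>\<Gamma> \<times>\<times> \<Delta>\<^esub> \<delta>)"
    if "\<gamma> \<in> carrier (\<Gamma> \<times>\<times> \<Delta>)" and "\<delta> \<in> carrier (\<Gamma> \<times>\<times> \<Delta>)" and x: "x \<in> ?gr \<gamma>" and y: "y \<in> ?gr \<delta>"
    for \<gamma> \<delta> x y
  proof -
    obtain \<alpha> \<beta> where \<gamma>: "\<gamma> = (\<alpha>, \<beta>)" "\<alpha> \<in> carrier \<Gamma>" "\<beta> \<in> carrier \<Delta>"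
      using \<open>\<gamma> \<in> carrier (\<Gamma> \<times>\<times> \<Delta>)\<close> by auto
    obtain \<alpha>' \<beta>' where \<delta>: "\<delta> = (\<alpha>', \<beta>')" "\<alpha>' \<in> carrier \<Gamma>" "\<beta>' \<in> carrier \<Delta>"
      using \<open>\<delta> \<in> carrier (\<Gamma> \<times>\<times> \<Delta>)\<close> by auto
    let ?X = "{pure_tensor K A B a b | a b. a \<in> grA \<alpha> \<and> b \<in> grB \<beta>}"
    let ?Y = "{pure_tensor K A B a b | a b. a \<in> grA \<alpha>' \<and> b \<in> grB \<beta>'}"
    have xs: "x \<in> lin_span K ?T ?X" and ys: "y \<in> lin_span K ?T ?Y"
      using x y by (simp_all add: \<gamma> \<delta> tensor_grading_def)
    have yT: "y \<in> carrier ?T" using grading_carrier[OF G that(2) y] .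
    have S: "submodule (?gr (\<gamma> \<otimes>\<^bsub>\<Gamma> \<times>\<times> \<Delta>\<^esub> \<delta>)) K ?T"
      by (rule grading_submodule[OF G]) (simp add: \<gamma> \<delta>)
    have XT: "?X \<subseteq> carrier ?T" and YT: "?Y \<subseteq> carrier ?T"
      using pure_tensor_in[OF AM BM] grading_carrier[OF A'(3)] grading_carrier[OF B'(3)] \<gamma> \<delta> by blast+
    note L = bilinear_map_left[OF mult(1) yT]
    from TM xs XT show ?thesis
    proof (induction rule: lin_span_induct)
      case (base s)
      then obtain a b where s: "s = pure_tensor K A B a b" "a \<in> grA \<alpha>" "b \<in> grB \<beta>" by blast
      have sT: "s \<in> carrier ?T" using base XT by auto
      note R = bilinear_map_right[OF mult(1) sT]
      from TM ys YT show ?case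
      proof (induction rule: lin_span_induct)
        case (base t)
        then obtain a' b' where t: "t = pure_tensor K A B a' b'" "a' \<in> grA \<alpha>'" "b' \<in> grB \<beta>'" by blast
        have "s \<otimes>\<^bsub>?E\<^esub> t = pure_tensor K A B (a \<otimes>\<^bsub>A\<^esub> a') (b \<otimes>\<^bsub>B\<^esub> b')"
          unfolding s(1) t(1)
          by (rule mult(2)[OF grading_carrier[OF A'(3) \<gamma>(2) s(2)] grading_carrier[OF B'(3) \<gamma>(3) s(3)]
                grading_carrier[OF A'(3) \<delta>(2) t(2)] grading_carrier[OF B'(3) \<delta>(3) t(3)]])
        then show ?case
          using s t \<gamma> \<delta> A'(5) B'(5) by (auto intro!: pure_tensor_homogeneous)
      qed (auto simp: linear_mapD[OF R] linear_map_zero[OF TM TM R]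
          submodule_zero[OF S] submodule_add[OF S] submodule_smult[OF S])
    qed (auto simp: linear_mapD[OF L] linear_map_zero[OF TM TM L]
          submodule_zero[OF S] submodule_add[OF S] submodule_smult[OF S])
  qed
  moreover have "\<one>\<^bsub>?E\<^esub> \<in> ?gr \<one>\<^bsub>\<Gamma> \<times>\<times> \<Delta>\<^esub>"
    using A'(4) B'(4) by (simp add: tensor_algebra_one pure_tensor_homogeneous)
  ultimately show ?thesis
    using tensor_algebra_k_algebra[OF A'(1) B'(1)] grading_same_space[OF G tensor_algebra_same_space]
    by (simp add: graded_algebra_def)
qed

section \<open>Twisting by a bicharacter\<close>

lemma graded_scaling_exists:
  assumes gr: "grading K \<Gamma> M gr" and v: "\<And>\<gamma>. \<gamma> \<in> carrier \<Gamma> \<Longrightarrow> v \<gamma> \<in> carrier K"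
  shows "\<exists>f\<in>linear_maps K M M. \<forall>\<gamma>\<in>carrier \<Gamma>. \<forall>x\<in>gr \<gamma>. f x = v \<gamma> \<odot>\<^bsub>M\<^esub> x"
proof -
  note M = grading_module[OF gr]
  have sc: "(\<lambda>x. v \<gamma> \<odot>\<^bsub>M\<^esub> x) \<in> linear_maps K M M" if "\<gamma> \<in> carrier \<Gamma>" for \<gamma>
    by (rule linear_map_scale[OF M linear_map_id v[OF that]])
  note ext = graded_extension[OF gr M, where F = "\<lambda>\<gamma> x. v \<gamma> \<odot>\<^bsub>M\<^esub> x", OF sc]
  show ?thesis
    by (rule bexI[OF _ ext(1)], intro ballI, rule ext(2))
qed

text \<open>A character of the grading group acts by scalars on the components.  Multiplicativity of the map is
  that of the character, and the inverse character gives the inverse map.\<close>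

lemma character_automorphism:
  assumes E: "graded_algebra K \<Gamma> E gr"
    and w: "\<And>\<gamma>. \<gamma> \<in> carrier \<Gamma> \<Longrightarrow> w \<gamma> \<in> Units K"
    and hom: "\<And>\<gamma> \<delta>. \<gamma> \<in> carrier \<Gamma> \<Longrightarrow> \<delta> \<in> carrier \<Gamma> \<Longrightarrow> w (\<gamma> \<otimes>\<^bsub>\<Gamma>\<^esub> \<delta>) = w \<gamma> \<otimes>\<^bsub>K\<^esub> w \<delta>"
  shows "\<exists>f\<in>alg_iso K E E. \<forall>\<gamma>\<in>carrier \<Gamma>. \<forall>x\<in>gr \<gamma>. f x = w \<gamma> \<odot>\<^bsub>E\<^esub> x"
proof -
  note E' = graded_algebraD[OF E]
  interpret E: k_algebra K E by fact
  interpret \<Gamma>: comm_group \<Gamma> by fact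
  note M = k_algebra_module[OF E'(1)]
  note span = grading_span[OF E'(3)]
  note gcarr = grading_carrier[OF E'(3)]
  have wK: "w \<gamma> \<in> carrier K" "inv\<^bsub>K\<^esub> w \<gamma> \<in> carrier K" if "\<gamma> \<in> carrier \<Gamma>" for \<gamma>
    using w[OF that] by auto
  have "\<exists>f\<in>linear_maps K E E. \<forall>\<gamma>\<in>carrier \<Gamma>. \<forall>x\<in>gr \<gamma>. f x = w \<gamma> \<odot>\<^bsub>E\<^esub> x"
    by (rule graded_scaling_exists[OF E'(3) wK(1)])
  then obtain f where f: "f \<in> linear_maps K E E"
      "\<And>\<gamma> x. \<gamma> \<in> carrier \<Gamma> \<Longrightarrow> x \<in> gr \<gamma> \<Longrightarrow> f x = w \<gamma> \<odot>\<^bsub>E\<^esub> x"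
    by blast
  have "\<exists>g\<in>linear_maps K E E. \<forall>\<gamma>\<in>carrier \<Gamma>. \<forall>x\<in>gr \<gamma>. g x = (inv\<^bsub>K\<^esub> w \<gamma>) \<odot>\<^bsub>E\<^esub> x"
    by (rule graded_scaling_exists[OF E'(3) wK(2)])
  then obtain g where g: "g \<in> linear_maps K E E"
      "\<And>\<gamma> x. \<gamma> \<in> carrier \<Gamma> \<Longrightarrow> x \<in> gr \<gamma> \<Longrightarrow> g x = (inv\<^bsub>K\<^esub> w \<gamma>) \<odot>\<^bsub>E\<^esub> x"
    by blast
  have gf: "g (f x) = x" and fg: "f (g x) = x" if x: "x \<in> carrier E" for x
  proof -
    have "g (f s) = s \<and> f (g s) = s" if s: "s \<in> (\<Union>\<gamma>\<in>carrier \<Gamma>. gr \<gamma>)" for s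
    proof -
      obtain \<gamma> where \<gamma>: "\<gamma> \<in> carrier \<Gamma>" "s \<in> gr \<gamma>" using s by blast
      then have "s \<in> carrier E" by (rule gcarr)
      then show ?thesis
        using \<gamma> f(2)[OF \<gamma>] g(2)[OF \<gamma>] wK[OF \<gamma>(1)] w[OF \<gamma>(1)]
        by (simp add: linear_map_smult[OF f(1)] linear_map_smult[OF g(1)] E.smult_assoc1[symmetric])
    qed
    then show "g (f x) = x" "f (g x) = x"
      using linear_maps_eqI[OF M M span linear_map_comp[OF f(1) g(1)] linear_map_id _ x]
        linear_maps_eqI[OF M M span linear_map_comp[OF g(1) f(1)] linear_map_id _ x] by simp_all
  qed
  have mult: "f (x \<otimes>\<^bsub>E\<^esub> y) = f x \<otimes>\<^bsub>E\<^esub> f y" if "x \<in> carrier E" "y \<in> carrier E" for x y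
  proof (rule bilinear_maps_eqI[OF M M M span span _ _ _ that])
    note b = k_algebra_mult_bilinear[OF E'(1)]
    show "(\<lambda>x y. f (x \<otimes>\<^bsub>E\<^esub> y)) \<in> bilinear_maps K E E E"
      by (rule bilinear_map_comp[OF b linear_map_id linear_map_id f(1)])
    show "(\<lambda>x y. f x \<otimes>\<^bsub>E\<^esub> f y) \<in> bilinear_maps K E E E"
      by (rule bilinear_map_comp[OF b f(1) f(1) linear_map_id])
    fix s t assume "s \<in> (\<Union>\<gamma>\<in>carrier \<Gamma>. gr \<gamma>)" "t \<in> (\<Union>\<gamma>\<in>carrier \<Gamma>. gr \<gamma>)"
    then obtain \<gamma> \<delta> where \<gamma>: "\<gamma> \<in> carrier \<Gamma>" "s \<in> gr \<gamma>" and \<delta>: "\<delta> \<in> carrier \<Gamma>" "t \<in> gr \<delta>" by blast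
    then have "s \<in> carrier E" "t \<in> carrier E" using gcarr by blast+
    then show "f (s \<otimes>\<^bsub>E\<^esub> t) = f s \<otimes>\<^bsub>E\<^esub> f t"
      using f(2)[OF \<Gamma>.m_closed[OF \<gamma>(1) \<delta>(1)] E'(5)[OF \<gamma>(1) \<delta>(1) \<gamma>(2) \<delta>(2)]] f(2)[OF \<gamma>] f(2)[OF \<delta>]
        hom[OF \<gamma>(1) \<delta>(1)] wK[OF \<gamma>(1)] wK[OF \<delta>(1)]
      by (simp add: E.smult_mult_left E.smult_mult_right E.smult_assoc1[symmetric] E.K.m_comm)
  qed
  \<comment> \<open>An idempotent unit is \<open>\<one>\<close>.\<close>
  have w1: "w \<one>\<^bsub>\<Gamma>\<^esub> = \<one>\<^bsub>K\<^esub>"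
  proof -
    note u = w[OF \<Gamma>.one_closed]
    have "w \<one>\<^bsub>\<Gamma>\<^esub> \<otimes>\<^bsub>K\<^esub> w \<one>\<^bsub>\<Gamma>\<^esub> = w \<one>\<^bsub>\<Gamma>\<^esub> \<otimes>\<^bsub>K\<^esub> \<one>\<^bsub>K\<^esub>" using hom[of "\<one>\<^bsub>\<Gamma>\<^esub>" "\<one>\<^bsub>\<Gamma>\<^esub>"] wK by simp
    then show ?thesis
      using E.K.Units_l_cancel[OF u wK(1)[OF \<Gamma>.one_closed] E.K.one_closed] by blast
  qed
  have "f \<one>\<^bsub>E\<^esub> = \<one>\<^bsub>E\<^esub>" using f(2)[OF \<Gamma>.one_closed E'(4)] w1 by simp
  moreover have "bij_betw f (carrier E) (carrier E)"
    by (rule bij_betw_byWitness[where f' = g])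
      (use gf fg linear_map_closed[OF f(1)] linear_map_closed[OF g(1)] in auto)
  ultimately have "f \<in> alg_iso K E E"
    using f(1) mult linear_mapD[OF f(1)] by (auto simp: alg_iso_def ring_iso_def ring_hom_def)
  with f(2) show ?thesis by blast
qed

definition bicharacter ::
  "('k, 'x) ring_scheme \<Rightarrow> ('h, 'v) monoid_scheme \<Rightarrow> ('g, 'w) monoid_scheme \<Rightarrow> ('h \<Rightarrow> 'g \<Rightarrow> 'k) \<Rightarrow> bool"
  where "bicharacter K \<Delta> \<Gamma> \<omega> \<longleftrightarrow>
    (\<forall>\<beta>\<in>carrier \<Delta>. \<forall>\<alpha>\<in>carrier \<Gamma>. \<omega> \<beta> \<alpha> \<in> Units K) \<and>
    (\<forall>\<beta>\<in>carrier \<Delta>. \<forall>\<beta>'\<in>carrier \<Delta>. \<forall>\<alpha>\<in>carrier \<Gamma>. \<omega> (\<beta> \<otimes>\<^bsub>\<Delta>\<^esub> \<beta>') \<alpha> = \<omega> \<beta> \<alpha> \<otimes>\<^bsub>K\<^esub> \<omega> \<beta>' \<alpha>) \<and>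
    (\<forall>\<beta>\<in>carrier \<Delta>. \<forall>\<alpha>\<in>carrier \<Gamma>. \<forall>\<alpha>'\<in>carrier \<Gamma>. \<omega> \<beta> (\<alpha> \<otimes>\<^bsub>\<Gamma>\<^esub> \<alpha>') = \<omega> \<beta> \<alpha> \<otimes>\<^bsub>K\<^esub> \<omega> \<beta> \<alpha>')"

text \<open>Rescale the components of \<open>B \<otimes> A\<close>, then interchange the factors.\<close>

lemma bicharacter_flip_exists:
  assumes A: "grading K \<Gamma> A grA" and B: "grading K \<Delta> B grB"
    and \<omega>: "\<And>\<beta> \<alpha>. \<beta> \<in> carrier \<Delta> \<Longrightarrow> \<alpha> \<in> carrier \<Gamma> \<Longrightarrow> \<omega> \<beta> \<alpha> \<in> carrier K"
  shows "\<exists>tau\<in>linear_maps K (tensor_space K B A) (tensor_space K A B).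
    \<forall>\<alpha>\<in>carrier \<Gamma>. \<forall>\<beta>\<in>carrier \<Delta>. \<forall>a\<in>grA \<alpha>. \<forall>b\<in>grB \<beta>.
      tau (pure_tensor K B A b a) = \<omega> \<beta> \<alpha> \<odot>\<^bsub>tensor_space K A B\<^esub> pure_tensor K A B a b"
proof -
  let ?T = "tensor_space K A B" and ?T' = "tensor_space K B A"
  note AM = grading_module[OF A] and BM = grading_module[OF B]
  note TM = tensor_space_module[OF AM BM] and TM' = tensor_space_module[OF BM AM]
  note G = tensor_grading_grading[OF B A]
  have "(\<lambda>b a. (\<lambda>(b, a). pure_tensor K A B a b) (b, a)) \<in> bilinear_maps K B A ?T"
    using bilinear_map_flip[OF pure_tensor_bilinear[OF AM BM]] by simp
  note sw = tensor_lift_linear[OF BM AM TM this]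
  have "(case \<gamma> of (\<beta>, \<alpha>) \<Rightarrow> \<omega> \<beta> \<alpha>) \<in> carrier K" if "\<gamma> \<in> carrier (\<Delta> \<times>\<times> \<Gamma>)" for \<gamma>
    using \<omega> that by auto
  from graded_scaling_exists[OF G, of "\<lambda>\<gamma>. case \<gamma> of (\<beta>, \<alpha>) \<Rightarrow> \<omega> \<beta> \<alpha>", OF this]
  obtain f where f: "f \<in> linear_maps K ?T' ?T'"
    "\<And>\<gamma> x. \<gamma> \<in> carrier (\<Delta> \<times>\<times> \<Gamma>) \<Longrightarrow> x \<in> tensor_grading K B A grB grA \<gamma> \<Longrightarrow>
      f x = (case \<gamma> of (\<beta>, \<alpha>) \<Rightarrow> \<omega> \<beta> \<alpha>) \<odot>\<^bsub>?T'\<^esub> x" by blast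
  show ?thesis
  proof (rule bexI[OF _ linear_map_comp[OF f(1) sw(1)]], intro ballI)
    fix \<alpha> \<beta> a b assume g: "\<alpha> \<in> carrier \<Gamma>" "\<beta> \<in> carrier \<Delta>" "a \<in> grA \<alpha>" "b \<in> grB \<beta>"
    have ab: "a \<in> carrier A" "b \<in> carrier B" using g grading_carrier[OF A] grading_carrier[OF B] by blast+
    have "f (pure_tensor K B A b a) = \<omega> \<beta> \<alpha> \<odot>\<^bsub>?T'\<^esub> pure_tensor K B A b a"
      using f(2)[OF _ pure_tensor_homogeneous[of b grB \<beta> a grA \<alpha>]] g by simp
    then show "tensor_lift K ?T (\<lambda>(b, a). pure_tensor K A B a b) (f (pure_tensor K B A b a)) =
        \<omega> \<beta> \<alpha> \<odot>\<^bsub>?T\<^esub> pure_tensor K A B a b"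
      using sw(2)[OF ab(2,1)] linear_map_smult[OF sw(1) \<omega>[OF g(2,1)] pure_tensor_in[OF BM AM ab(2,1)]] by simp
  qed
qed

text \<open>For fixed \<open>\<alpha>\<close>, the function \<open>(\<alpha>', \<beta>') \<mapsto> \<omega> \<beta>' \<alpha>\<close> is a character of the grading group of
  \<open>A \<otimes> B\<close>.\<close>

lemma bicharacter_automorphism_exists:
  assumes A: "graded_algebra K \<Gamma> A grA" and B: "graded_algebra K \<Delta> B grB"
    and \<omega>: "bicharacter K \<Delta> \<Gamma> \<omega>" and \<alpha>: "\<alpha> \<in> carrier \<Gamma>"
  shows "\<exists>f\<in>alg_iso K (tensor_algebra K A B) (tensor_algebra K A B).
    \<forall>\<alpha>'\<in>carrier \<Gamma>. \<forall>\<beta>'\<in>carrier \<Delta>. \<forall>a\<in>grA \<alpha>'. \<forall>b\<in>grB \<beta>'.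
      f (pure_tensor K A B a b) = \<omega> \<beta>' \<alpha> \<odot>\<^bsub>tensor_algebra K A B\<^esub> pure_tensor K A B a b"
proof -
  have u: "(case \<gamma> of (\<alpha>', \<beta>') \<Rightarrow> \<omega> \<beta>' \<alpha>) \<in> Units K" if "\<gamma> \<in> carrier (\<Gamma> \<times>\<times> \<Delta>)" for \<gamma>
    using \<omega> \<alpha> that by (auto simp: bicharacter_def)
  have "(case \<gamma> \<otimes>\<^bsub>\<Gamma> \<times>\<times> \<Delta>\<^esub> \<delta> of (\<alpha>', \<beta>') \<Rightarrow> \<omega> \<beta>' \<alpha>) =
      (case \<gamma> of (\<alpha>', \<beta>') \<Rightarrow> \<omega> \<beta>' \<alpha>) \<otimes>\<^bsub>K\<^esub> (case \<delta> of (\<alpha>', \<beta>') \<Rightarrow> \<omega> \<beta>' \<alpha>)"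
    if "\<gamma> \<in> carrier (\<Gamma> \<times>\<times> \<Delta>)" "\<delta> \<in> carrier (\<Gamma> \<times>\<times> \<Delta>)" for \<gamma> \<delta>
    using \<omega> \<alpha> that by (auto simp: bicharacter_def)
  from character_automorphism[OF tensor_graded_algebra[OF A B],
      of "\<lambda>\<gamma>. case \<gamma> of (\<alpha>', \<beta>') \<Rightarrow> \<omega> \<beta>' \<alpha>", OF u this]
  obtain f where f: "f \<in> alg_iso K (tensor_algebra K A B) (tensor_algebra K A B)"
    "\<And>\<gamma> x. \<gamma> \<in> carrier (\<Gamma> \<times>\<times> \<Delta>) \<Longrightarrow> x \<in> tensor_grading K A B grA grB \<gamma> \<Longrightarrow>
      f x = (case \<gamma> of (\<alpha>', \<beta>') \<Rightarrow> \<omega> \<beta>' \<alpha>) \<odot>\<^bsub>tensor_algebra K A B\<^esub> x"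
    by blast
  then show ?thesis
    using pure_tensor_homogeneous[of _ grA _ _ grB] by (intro bexI[OF _ f(1)] ballI) fastforce
qed

context
  fixes K :: "('k, 'x) ring_scheme" and A :: "('k, 'a, 'y) module_scheme" and B :: "('k, 'b, 'z) module_scheme"
    and \<Gamma> :: "('g, 'w) monoid_scheme" and \<Delta> :: "('h, 'v) monoid_scheme"
    and grA grB \<omega> tau chi
  assumes A: "graded_algebra K \<Gamma> A grA" and B: "graded_algebra K \<Delta> B grB"
    and \<omega>: "bicharacter K \<Delta> \<Gamma> \<omega>"
    and tau: "tau \<in> linear_maps K (tensor_space K B A) (tensor_space K A B)"
    and tau_homogeneous: "\<And>\<alpha> \<beta> a b. \<alpha> \<in> carrier \<Gamma> \<Longrightarrow> \<beta> \<in> carrier \<Delta> \<Longrightarrow> a \<in> grA \<alpha> \<Longrightarrow> b \<in> grB \<beta> \<Longrightarrow>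
      tau (pure_tensor K B A b a) = \<omega> \<beta> \<alpha> \<odot>\<^bsub>tensor_space K A B\<^esub> pure_tensor K A B a b"
    and chi: "\<And>\<alpha> \<beta>. \<alpha> \<in> carrier \<Gamma> \<Longrightarrow> \<beta> \<in> carrier \<Delta> \<Longrightarrow>
      chi (\<alpha>, \<beta>) \<in> alg_iso K (tensor_algebra K A B) (tensor_algebra K A B)"
    and chi_homogeneous: "\<And>\<alpha> \<beta> \<alpha>' \<beta>' a b. \<alpha> \<in> carrier \<Gamma> \<Longrightarrow> \<beta> \<in> carrier \<Delta> \<Longrightarrow>
      \<alpha>' \<in> carrier \<Gamma> \<Longrightarrow> \<beta>' \<in> carrier \<Delta> \<Longrightarrow> a \<in> grA \<alpha>' \<Longrightarrow> b \<in> grB \<beta>' \<Longrightarrow>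
      chi (\<alpha>, \<beta>) (pure_tensor K A B a b) = \<omega> \<beta>' \<alpha> \<odot>\<^bsub>tensor_algebra K A B\<^esub> pure_tensor K A B a b"
begin

private abbreviation (input) "EAB \<equiv> tensor_algebra K A B"
private abbreviation (input) "grAB \<equiv> tensor_grading K A B grA grB"

private lemmas gradedA = graded_algebraD[OF A]
private lemmas gradedB = graded_algebraD[OF B]
private lemmas moduleA = k_algebra_module[OF graded_algebraD(1)[OF A]]
private lemmas moduleB = k_algebra_module[OF graded_algebraD(1)[OF B]]
private lemmas moduleT = tensor_space_module[OF k_algebra_module[OF graded_algebraD(1)[OF A]]
    k_algebra_module[OF graded_algebraD(1)[OF B]]]
private lemmas gradedE = tensor_graded_algebra[OF A B]

interpretation EAB: k_algebra K EAB by (rule graded_algebraD(1)[OF gradedE])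

text \<open>Each \<open>chi \<gamma>\<close> multiplies every component by a unit, and these units are multiplicative in \<open>\<gamma>\<close>
  because \<open>\<omega>\<close> is multiplicative in its second argument.\<close>

lemma bicharacter_twisting_system: "twisting_system K (\<Gamma> \<times>\<times> \<Delta>) EAB grAB chi"
proof -
  note G = graded_algebraD(3)[OF gradedE]
  note EM = k_algebra_module[OF graded_algebraD(1)[OF gradedE]]
  have lin: "chi \<gamma> \<in> linear_maps K EAB EAB" if "\<gamma> \<in> carrier (\<Gamma> \<times>\<times> \<Delta>)" for \<gamma>
    using chi that by (auto simp: alg_iso_def)
  have u: "\<omega> \<beta> \<alpha> \<in> Units K" "\<omega> \<beta> \<alpha> \<in> carrier K" "inv\<^bsub>K\<^esub> (\<omega> \<beta> \<alpha>) \<in> carrier K"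
    if "\<alpha> \<in> carrier \<Gamma>" "\<beta> \<in> carrier \<Delta>" for \<alpha> \<beta>
    using \<omega> that by (auto simp: bicharacter_def)
  have hom: "chi \<gamma> x = \<omega> (snd \<delta>) (fst \<gamma>) \<odot>\<^bsub>EAB\<^esub> x"
    if \<gamma>: "\<gamma> \<in> carrier (\<Gamma> \<times>\<times> \<Delta>)" and \<delta>: "\<delta> \<in> carrier (\<Gamma> \<times>\<times> \<Delta>)" and x: "x \<in> grAB \<delta>" for \<gamma> \<delta> x
  proof -
    let ?X = "{pure_tensor K A B a b | a b. a \<in> grA (fst \<delta>) \<and> b \<in> grB (snd \<delta>)}"
    have "x \<in> lin_span K (tensor_space K A B) ?X"
      using x by (simp add: tensor_grading_def split_beta)
    then have xs: "x \<in> lin_span K EAB ?X"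
      unfolding lin_span_same_space[OF tensor_algebra_same_space] .
    have X: "?X \<subseteq> carrier EAB"
    proof
      fix s assume "s \<in> ?X"
      then obtain a b where "s = pure_tensor K A B a b" "a \<in> grA (fst \<delta>)" "b \<in> grB (snd \<delta>)" by blast
      then have "s \<in> grAB \<delta>"
        using pure_tensor_homogeneous[of a grA "fst \<delta>" b grB "snd \<delta>" K A B] by simp
      then show "s \<in> carrier EAB" by (rule grading_carrier[OF G \<delta>])
    qed
    have sc: "(\<lambda>x. \<omega> (snd \<delta>) (fst \<gamma>) \<odot>\<^bsub>EAB\<^esub> x) \<in> linear_maps K EAB EAB"
      by (rule linear_map_scale[OF EM linear_map_id]) (use u \<gamma> \<delta> in auto)
    from EM xs X show ?thesis
    proof (induction rule: lin_span_induct)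
      case (base s)
      then show ?case using chi_homogeneous[of "fst \<gamma>" "snd \<gamma>" "fst \<delta>" "snd \<delta>"] \<gamma> \<delta> by auto
    next
      case zero
      then show ?case by (simp add: linear_map_zero[OF EM EM lin[OF \<gamma>]] linear_map_zero[OF EM EM sc])
    next
      case (add x y)
      then show ?case by (simp add: linear_map_add[OF lin[OF \<gamma>]] linear_map_add[OF sc])
    next
      case (smult c x)
      then show ?case by (simp add: linear_map_smult[OF lin[OF \<gamma>]] linear_map_smult[OF sc])
    qed
  qed
  have img: "chi \<gamma> ` grAB \<delta> = grAB \<delta>"
    if \<gamma>: "\<gamma> \<in> carrier (\<Gamma> \<times>\<times> \<Delta>)" and \<delta>: "\<delta> \<in> carrier (\<Gamma> \<times>\<times> \<Delta>)" for \<gamma> \<delta>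
  proof
    note S = grading_submodule[OF G \<delta>]
    have w: "\<omega> (snd \<delta>) (fst \<gamma>) \<in> Units K" "\<omega> (snd \<delta>) (fst \<gamma>) \<in> carrier K" "inv\<^bsub>K\<^esub> (\<omega> (snd \<delta>) (fst \<gamma>)) \<in> carrier K"
      using u \<gamma> \<delta> by auto
    show "chi \<gamma> ` grAB \<delta> \<subseteq> grAB \<delta>"
      using hom[OF \<gamma> \<delta>] submodule_smult[OF S w(2)] by auto
    show "grAB \<delta> \<subseteq> chi \<gamma> ` grAB \<delta>"
    proof
      fix x assume x: "x \<in> grAB \<delta>"
      have "inv\<^bsub>K\<^esub> (\<omega> (snd \<delta>) (fst \<gamma>)) \<odot>\<^bsub>EAB\<^esub> x \<in> grAB \<delta>" by (rule submodule_smult[OF S w(3) x])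
      moreover from this have "chi \<gamma> (inv\<^bsub>K\<^esub> (\<omega> (snd \<delta>) (fst \<gamma>)) \<odot>\<^bsub>EAB\<^esub> x) = x"
        using hom[OF \<gamma> \<delta>] w submodule_carrier[OF S x] by (simp add: EAB.smult_assoc1[symmetric])
      ultimately show "x \<in> chi \<gamma> ` grAB \<delta>" by force
    qed
  qed
  have comp: "chi (\<gamma> \<otimes>\<^bsub>\<Gamma> \<times>\<times> \<Delta>\<^esub> \<gamma>') x = chi \<gamma> (chi \<gamma>' x)"
    if \<gamma>: "\<gamma> \<in> carrier (\<Gamma> \<times>\<times> \<Delta>)" and \<gamma>': "\<gamma>' \<in> carrier (\<Gamma> \<times>\<times> \<Delta>)" and x: "x \<in> carrier EAB" for \<gamma> \<gamma>' x
  proof -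
    interpret G: comm_group "\<Gamma> \<times>\<times> \<Delta>" by (rule graded_algebraD(2)[OF gradedE])
    note \<gamma>\<gamma>' = G.m_closed[OF \<gamma> \<gamma>']
    show ?thesis
    proof (rule linear_maps_eqI[OF EM EM grading_span[OF G] lin[OF \<gamma>\<gamma>'] linear_map_comp[OF lin[OF \<gamma>'] lin[OF \<gamma>]] _ x])
      fix s assume "s \<in> (\<Union>\<delta>\<in>carrier (\<Gamma> \<times>\<times> \<Delta>). grAB \<delta>)"
      then obtain \<delta> where \<delta>: "\<delta> \<in> carrier (\<Gamma> \<times>\<times> \<Delta>)" "s \<in> grAB \<delta>" by blast
      have sE: "s \<in> carrier EAB" by (rule grading_carrier[OF G \<delta>])
      have sc: "\<omega> (snd \<delta>) (fst \<gamma>) \<in> carrier K" "\<omega> (snd \<delta>) (fst \<gamma>') \<in> carrier K"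
        using u \<gamma> \<gamma>' \<delta> by auto
      have "\<omega> (snd \<delta>) (fst (\<gamma> \<otimes>\<^bsub>\<Gamma> \<times>\<times> \<Delta>\<^esub> \<gamma>')) = \<omega> (snd \<delta>) (fst \<gamma>') \<otimes>\<^bsub>K\<^esub> \<omega> (snd \<delta>) (fst \<gamma>)"
        using \<omega> \<gamma> \<gamma>' \<delta> sc EAB.K.m_comm by (auto simp: bicharacter_def)
      then show "chi (\<gamma> \<otimes>\<^bsub>\<Gamma> \<times>\<times> \<Delta>\<^esub> \<gamma>') s = chi \<gamma> (chi \<gamma>' s)"
        using hom[OF \<gamma>\<gamma>' \<delta>] hom[OF \<gamma> \<delta>] hom[OF \<gamma>' \<delta>] sc sE
        by (simp add: linear_map_smult[OF lin[OF \<gamma>]] EAB.smult_assoc1)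
    qed
  qed
  show ?thesis
    unfolding twisting_system_def using chi img comp by auto
qed

text \<open>The heart of the matter.  Take \<open>a, b, a', b'\<close> homogeneous, with \<open>b\<close> of degree \<open>\<beta>\<close> and \<open>a'\<close> of
  degree \<open>\<alpha>'\<close>.  In the graded twist, \<open>chi\<close> scales the left factor \<open>a \<otimes> b\<close> by \<open>\<omega> \<beta> \<alpha>'\<close>; in the
  twisted tensor product, \<open>tau\<close> scales \<open>b \<otimes> a'\<close> by the same unit when it interchanges the two.
  Either way the product of \<open>a \<otimes> b\<close> and \<open>a' \<otimes> b'\<close> is \<open>\<omega> \<beta> \<alpha>' (a a' \<otimes> b b')\<close>, and such pure
  tensors span.\<close>

lemma graded_twist_eq_twisted_tensor:
  assumes "x \<in> carrier (tensor_space K A B)" "y \<in> carrier (tensor_space K A B)"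
  shows "x \<otimes>\<^bsub>graded_twist (\<Gamma> \<times>\<times> \<Delta>) EAB grAB chi\<^esub> y = x \<otimes>\<^bsub>twisted_tensor_algebra K A B tau\<^esub> y"
proof -
  let ?T = "tensor_space K A B"
  note ss = tensor_algebra_same_space[of K A B]
  interpret A: k_algebra K A by (rule gradedA(1))
  interpret B: k_algebra K B by (rule gradedB(1))
  note tw = twisted_tensor_mult[OF gradedA(1) gradedB(1) tau]
  note span = tensor_space_span_of[OF moduleA moduleB grading_span[OF gradedA(3)] grading_span[OF gradedB(3)]]
  have gb: "(\<otimes>\<^bsub>graded_twist (\<Gamma> \<times>\<times> \<Delta>) EAB grAB chi\<^esub>) \<in> bilinear_maps K ?T ?T ?T"
    using graded_twist_mult_bilinear[OF gradedE bicharacter_twisting_system] ss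
    by (simp add: bilinear_maps_def linear_maps_same_space[OF ss ss] same_space_def)
  show ?thesis
  proof (rule bilinear_maps_eqI[OF moduleT moduleT moduleT span span gb tw(1) _ assms])
    fix s t
    assume "s \<in> {pure_tensor K A B s u | s u. s \<in> (\<Union>\<alpha>\<in>carrier \<Gamma>. grA \<alpha>) \<and> u \<in> (\<Union>\<beta>\<in>carrier \<Delta>. grB \<beta>)}"
    then obtain \<alpha> \<beta> a b where s: "s = pure_tensor K A B a b" and g: "\<alpha> \<in> carrier \<Gamma>" "\<beta> \<in> carrier \<Delta>" "a \<in> grA \<alpha>" "b \<in> grB \<beta>"
      by blast
    assume "t \<in> {pure_tensor K A B s u | s u. s \<in> (\<Union>\<alpha>\<in>carrier \<Gamma>. grA \<alpha>) \<and> u \<in> (\<Union>\<beta>\<in>carrier \<Delta>. grB \<beta>)}"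
    then obtain \<alpha>' \<beta>' a' b' where t: "t = pure_tensor K A B a' b'" and g': "\<alpha>' \<in> carrier \<Gamma>" "\<beta>' \<in> carrier \<Delta>" "a' \<in> grA \<alpha>'" "b' \<in> grB \<beta>'"
      by blast
    have ab: "a \<in> carrier A" "b \<in> carrier B" "a' \<in> carrier A" "b' \<in> carrier B"
      using g g' grading_carrier[OF gradedA(3)] grading_carrier[OF gradedB(3)] by blast+
    have w: "\<omega> \<beta> \<alpha>' \<in> carrier K" using \<omega> g g' by (auto simp: bicharacter_def)
    note P = pure_tensor_in[OF moduleA moduleB]
    have PE: "pure_tensor K A B c d \<in> carrier EAB" if "c \<in> carrier A" "d \<in> carrier B" for c d
      using P[OF that] ss by (simp add: same_space_def)
    have smE: "smult EAB = smult ?T" using ss by (simp add: same_space_def)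
    have "s \<otimes>\<^bsub>graded_twist (\<Gamma> \<times>\<times> \<Delta>) EAB grAB chi\<^esub> t = chi (\<alpha>', \<beta>') s \<otimes>\<^bsub>EAB\<^esub> t"
      by (rule graded_twist_mult_homogeneous[OF gradedE bicharacter_twisting_system])
        (use s t ab g' PE pure_tensor_homogeneous[of a' grA \<alpha>' b' grB \<beta>'] in auto)
    also have "\<dots> = \<omega> \<beta> \<alpha>' \<odot>\<^bsub>EAB\<^esub> (s \<otimes>\<^bsub>EAB\<^esub> t)"
      using chi_homogeneous[OF g'(1,2) g] w PE ab s t by (simp add: EAB.smult_mult_left)
    also have "s \<otimes>\<^bsub>EAB\<^esub> t = pure_tensor K A B (a \<otimes>\<^bsub>A\<^esub> a') (b \<otimes>\<^bsub>B\<^esub> b')"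
      unfolding s t by (rule tensor_algebra_mult(2)[OF gradedA(1) gradedB(1) ab])
    finally have L: "s \<otimes>\<^bsub>graded_twist (\<Gamma> \<times>\<times> \<Delta>) EAB grAB chi\<^esub> t =
        \<omega> \<beta> \<alpha>' \<odot>\<^bsub>?T\<^esub> pure_tensor K A B (a \<otimes>\<^bsub>A\<^esub> a') (b \<otimes>\<^bsub>B\<^esub> b')"
      by (simp only: smE)
    note tm = tensor_map[OF moduleA moduleB moduleA moduleB bilinear_map_right[OF k_algebra_mult_bilinear[OF gradedA(1)] ab(1)]
        bilinear_map_left[OF k_algebra_mult_bilinear[OF gradedB(1)] ab(4)]]
    have "s \<otimes>\<^bsub>twisted_tensor_algebra K A B tau\<^esub> t =
        tensor_map K A B (\<lambda>c. a \<otimes>\<^bsub>A\<^esub> c) (\<lambda>d. d \<otimes>\<^bsub>B\<^esub> b') (tau (pure_tensor K B A b a'))"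
      unfolding s t by (rule tw(2)[OF ab])
    also have "\<dots> = \<omega> \<beta> \<alpha>' \<odot>\<^bsub>?T\<^esub> pure_tensor K A B (a \<otimes>\<^bsub>A\<^esub> a') (b \<otimes>\<^bsub>B\<^esub> b')"
      using tau_homogeneous[OF g'(1) g(2) g'(3) g(4)] linear_map_smult[OF tm(1) w P[OF ab(3,2)]] tm(2)[OF ab(3,2)]
      by simp
    finally show "s \<otimes>\<^bsub>graded_twist (\<Gamma> \<times>\<times> \<Delta>) EAB grAB chi\<^esub> t = s \<otimes>\<^bsub>twisted_tensor_algebra K A B tau\<^esub> t"
      using L by simp
  qed
qed

theorem graded_twist_iso_twisted_tensor:
  shows "k_algebra K (graded_twist (\<Gamma> \<times>\<times> \<Delta>) EAB grAB chi)"
    and "k_algebra K (twisted_tensor_algebra K A B tau)"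
    and "(\<lambda>x. x) \<in> alg_iso K (graded_twist (\<Gamma> \<times>\<times> \<Delta>) EAB grAB chi) (twisted_tensor_algebra K A B tau)"
proof -
  let ?G = "graded_twist (\<Gamma> \<times>\<times> \<Delta>) EAB grAB chi" and ?W = "twisted_tensor_algebra K A B tau"
  show G: "k_algebra K ?G"
    by (rule graded_twist_k_algebra[OF gradedE bicharacter_twisting_system])
  note st = graded_twist_simps[OF gradedE bicharacter_twisting_system]
  have same: "carrier ?G = carrier (tensor_space K A B)" "carrier ?W = carrier (tensor_space K A B)" "add ?W = add ?G" "zero ?W = zero ?G"
    "smult ?W = smult ?G" "one ?W = one ?G"
    using tensor_algebra_same_space[of K A B] twisted_tensor_same_space[of K A B tau]
    by (simp_all add: st same_space_def tensor_algebra_one twisted_tensor_one)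
  show "k_algebra K ?W"
    by (rule k_algebra_surjective_image[OF G, where p = "\<lambda>x. x"])
      (use same graded_twist_eq_twisted_tensor in simp_all)
  interpret G: k_algebra K ?G by (rule G)
  show "(\<lambda>x. x) \<in> alg_iso K ?G ?W"
    using same graded_twist_eq_twisted_tensor
    by (auto simp: alg_iso_def linear_maps_def ring_iso_def ring_hom_def bij_betw_def)
qed

end

section \<open>Gradings of free algebras by word degree\<close>

text \<open>The projection of degree \<open>\<gamma>\<close> restricts a function on words to the words of degree \<open>\<gamma>\<close>.\<close>

lemma free_algebra_graded:
  assumes K: "field K" and \<Gamma>: "comm_group \<Gamma>"
    and deg: "\<And>w. w \<in> lists G \<Longrightarrow> deg w \<in> carrier \<Gamma>" "deg [] = \<one>\<^bsub>\<Gamma>\<^esub>"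
      "\<And>u v. deg (u @ v) = deg u \<otimes>\<^bsub>\<Gamma>\<^esub> deg v"
  shows "graded_algebra K \<Gamma> (free_algebra K G)
    (\<lambda>\<gamma>. {f \<in> carrier (free_algebra K G). \<forall>w. f w \<noteq> \<zero>\<^bsub>K\<^esub> \<longrightarrow> deg w = \<gamma>})"
proof -
  let ?F = "free_algebra K G"
  let ?gr = "\<lambda>\<gamma>. {f \<in> carrier ?F. \<forall>w. f w \<noteq> \<zero>\<^bsub>K\<^esub> \<longrightarrow> deg w = \<gamma>}"
  interpret K: field K by (rule K)
  note A = free_algebra_k_algebra[OF K, of G]
  note M = k_algebra_module[OF A]
  interpret F: k_algebra K ?F by (rule A)
  have V: "f x \<in> carrier K" if "f \<in> carrier ?F" for f x
    using free_module_value[OF K.is_cring] that by (simp add: free_algebra_simps)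
  note ops = free_algebra_simps free_module_simps(2-4)
  have sub: "submodule (?gr \<gamma>) K ?F" for \<gamma>
  proof (rule submodule_intro[OF M])
    show "\<zero>\<^bsub>?F\<^esub> \<in> ?gr \<gamma>" using F.M.zero_closed by (simp add: ops)
  next
    fix f g assume fg: "f \<in> ?gr \<gamma>" "g \<in> ?gr \<gamma>"
    then have "f w \<in> carrier K" "g w \<in> carrier K" for w using V by auto
    then have "(f \<oplus>\<^bsub>?F\<^esub> g) w \<noteq> \<zero>\<^bsub>K\<^esub> \<longrightarrow> deg w = \<gamma>" for w
      using fg by (cases "f w = \<zero>\<^bsub>K\<^esub>") (auto simp: ops)
    then show "f \<oplus>\<^bsub>?F\<^esub> g \<in> ?gr \<gamma>" using fg by simp
  next
    fix c f assume c: "c \<in> carrier K" and f: "f \<in> ?gr \<gamma>"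
    have "(c \<odot>\<^bsub>?F\<^esub> f) w \<noteq> \<zero>\<^bsub>K\<^esub> \<longrightarrow> deg w = \<gamma>" for w
      using c f by (cases "f w = \<zero>\<^bsub>K\<^esub>") (auto simp: ops)
    then show "c \<odot>\<^bsub>?F\<^esub> f \<in> ?gr \<gamma>" using c f by simp
  qed auto
  define p where "p \<gamma> f = (\<lambda>w. if deg w = \<gamma> then f w else \<zero>\<^bsub>K\<^esub>)" for \<gamma> and f :: "_ \<Rightarrow> 'a"
  have "grading K \<Gamma> ?F ?gr"
  proof (rule gradingI[OF M sub, where p = p])
    have "single K ` lists G \<subseteq> (\<Union>\<gamma>\<in>carrier \<Gamma>. ?gr \<gamma>)"
    proof
      fix f assume "f \<in> single K ` lists G"
      then obtain w where w: "w \<in> lists G" "f = single K w" by auto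
      then have "f \<in> ?gr (deg w)"
        using single_in_free_module[OF K.is_cring w(1)] by (simp add: free_algebra_simps single_def)
      then show "f \<in> (\<Union>\<gamma>\<in>carrier \<Gamma>. ?gr \<gamma>)" using deg(1)[OF w(1)] by blast
    qed
    then have "single K ` lists G \<subseteq> lin_span K ?F (\<Union>\<gamma>\<in>carrier \<Gamma>. ?gr \<gamma>)"
      using lin_span_superset by (rule subset_trans)
    then show "carrier ?F = lin_span K ?F (\<Union>\<gamma>\<in>carrier \<Gamma>. ?gr \<gamma>)"
      by (intro lin_span_eq_carrierI[OF M _ free_algebra_span[OF K.is_cring]]) auto
  next
    fix \<gamma>
    show "p \<gamma> \<in> linear_maps K ?F ?F"
    proof (rule linear_mapsI)
      fix f assume f: "f \<in> carrier ?F"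
      then have "finite {x. f x \<noteq> \<zero>\<^bsub>K\<^esub>}" by (simp add: free_algebra_simps free_module_simps)
      then have "finite {x. p \<gamma> f x \<noteq> \<zero>\<^bsub>K\<^esub>}" by (rule rev_finite_subset) (auto simp: p_def)
      then show "p \<gamma> f \<in> carrier ?F"
        using f by (auto simp: free_algebra_simps free_module_simps p_def)
    qed (auto simp: p_def ops fun_eq_iff)
    fix \<delta> f assume "f \<in> ?gr \<delta>"
    then have "f w = \<zero>\<^bsub>K\<^esub>" if "deg w \<noteq> \<delta>" for w using that by auto
    then show "p \<gamma> f = (if \<delta> = \<gamma> then f else \<zero>\<^bsub>?F\<^esub>)"
      by (auto simp: p_def ops fun_eq_iff)
  qed
  moreover have "f \<otimes>\<^bsub>?F\<^esub> g \<in> ?gr (\<gamma> \<otimes>\<^bsub>\<Gamma>\<^esub> \<delta>)" if f: "f \<in> ?gr \<gamma>" and g: "g \<in> ?gr \<delta>" for \<gamma> \<delta> f g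
  proof -
    have "deg w = \<gamma> \<otimes>\<^bsub>\<Gamma>\<^esub> \<delta>" if "(f \<otimes>\<^bsub>?F\<^esub> g) w \<noteq> \<zero>\<^bsub>K\<^esub>" for w
    proof -
      have "\<exists>i. f (take i w) \<noteq> \<zero>\<^bsub>K\<^esub> \<and> g (drop i w) \<noteq> \<zero>\<^bsub>K\<^esub>"
        by (rule free_algebra_mult_nonzero[OF K.is_cring _ _ that]) (use f g in auto)
      then obtain i where "f (take i w) \<noteq> \<zero>\<^bsub>K\<^esub>" "g (drop i w) \<noteq> \<zero>\<^bsub>K\<^esub>" by blast
      then have "deg (take i w) = \<gamma>" "deg (drop i w) = \<delta>" using f g by auto
      then show ?thesis using deg(3)[of "take i w" "drop i w"] by simp
    qed
    moreover have "f \<otimes>\<^bsub>?F\<^esub> g \<in> carrier ?F" using f g by (intro F.A.m_closed) auto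
    ultimately show ?thesis by blast
  qed
  moreover have "\<one>\<^bsub>?F\<^esub> \<in> ?gr \<one>\<^bsub>\<Gamma>\<^esub>"
    using F.A.one_closed deg(2) by (simp add: free_algebra_simps(5) single_def)
  ultimately show ?thesis
    using A \<Gamma> unfolding graded_algebra_def by blast
qed

section \<open>The grading of a twisted generalized Weyl algebra\<close>

lemma int_lattice_carrier: "carrier (int_lattice n) = ({1..n} \<rightarrow>\<^sub>E UNIV)"
  and int_lattice_one: "\<one>\<^bsub>int_lattice n\<^esub> = (\<lambda>l\<in>{1..n}. 0)"
  and int_lattice_mult: "\<alpha> \<otimes>\<^bsub>int_lattice n\<^esub> \<beta> = (\<lambda>l\<in>{1..n}. \<alpha> l + \<beta> l)"
  by (simp_all add: int_lattice_def)

lemma int_lattice_comm_group: "comm_group (int_lattice n)"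
  by (rule group.group_comm_groupI) (auto simp: int_lattice_def intro!: restrict_ext)

definition signed_gen :: "int \<Rightarrow> 'r tgw_gen"
  where "signed_gen u = (if u > 0 then XPos (nat \<bar>u\<bar>) else XNeg (nat \<bar>u\<bar>))"

text \<open>The degree of the monomial \<open>X\<^sub>u\<close>, computed from the indices alone.  Unlike \<open>word_degree\<close> it does not
  mention the coefficient algebra.\<close>

definition signed_degree :: "nat \<Rightarrow> int list \<Rightarrow> nat \<Rightarrow> int"
  where "signed_degree n us = (\<lambda>l\<in>{1..n}. \<Sum>u\<leftarrow>us. if nat \<bar>u\<bar> = l then sgn u else 0)"

lemma word_degree_signed:
  assumes "us \<in> lists (signed_indices n)"
  shows "word_degree n (map signed_gen us :: 'r tgw_gen list) = signed_degree n us"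
proof -
  have "(\<Sum>u\<leftarrow>us. gen_degree (signed_gen u :: 'r tgw_gen) l) = (\<Sum>u\<leftarrow>us. if nat \<bar>u\<bar> = l then sgn u else 0)" for l
    by (rule arg_cong[where f = sum_list], rule map_cong[OF refl])
      (use assms in \<open>auto simp: signed_gen_def signed_indices_def sgn_if in_lists_conv_set\<close>)
  then show ?thesis by (simp add: word_degree_def signed_degree_def comp_def)
qed

lemma signed_degree_carrier: "signed_degree n us \<in> carrier (int_lattice n)"
  by (simp add: signed_degree_def int_lattice_carrier)

lemma signed_degree_Nil: "signed_degree n [] = \<one>\<^bsub>int_lattice n\<^esub>"
  by (simp add: signed_degree_def int_lattice_one)

lemma signed_degree_append:
  "signed_degree n (us @ vs) = signed_degree n us \<otimes>\<^bsub>int_lattice n\<^esub> signed_degree n vs"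
  by (auto simp: signed_degree_def int_lattice_mult intro!: restrict_ext)

definition tgw_free_grading :: "('k, 'x) ring_scheme \<Rightarrow> ('k, 'r) tgw_data
    \<Rightarrow> (nat \<Rightarrow> int) \<Rightarrow> ('r tgw_gen list \<Rightarrow> 'k) set"
  where "tgw_free_grading K D \<alpha> =
    {f \<in> carrier (tgw_free K D). \<forall>w. f w \<noteq> \<zero>\<^bsub>K\<^esub> \<longrightarrow> word_degree (tgw_rank D) w = \<alpha>}"

context tgw_datum
begin

context
begin

private abbreviation (input) "R \<equiv> tgw_base D"
private abbreviation (input) "F \<equiv> tgw_free K D"
private abbreviation (input) "n \<equiv> tgw_rank D"
private abbreviation (input) "gens \<equiv> tgw_gens D"

lemma tgw_free_graded: "graded_algebra K (int_lattice n) F (tgw_free_grading K D)"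
proof -
  have "graded_algebra K (int_lattice n) (free_algebra K gens)
    (\<lambda>\<gamma>. {f \<in> carrier (free_algebra K gens). \<forall>w. f w \<noteq> \<zero>\<^bsub>K\<^esub> \<longrightarrow> word_degree n w = \<gamma>})"
    by (rule free_algebra_graded[OF K.field_axioms int_lattice_comm_group])
      (auto simp: word_degree_def int_lattice_carrier int_lattice_one int_lattice_mult intro!: restrict_ext)
  then show ?thesis unfolding tgw_free_def tgw_free_grading_def .
qed

private lemmas FG = graded_algebraD[OF tgw_free_graded]
private lemmas FM = k_algebra_module[OF graded_algebraD(1)[OF tgw_free_graded]]

lemma single_homogeneous:
  assumes "w \<in> lists gens"
  shows "single K w \<in> tgw_free_grading K D (word_degree n w)"
  using single_in_free_module[OF K.is_cring assms]
  by (simp add: tgw_free_grading_def tgw_free_def free_algebra_simps single_def)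

lemma single_in_tgw_free: "w \<in> lists gens \<Longrightarrow> single K w \<in> carrier F"
  using single_homogeneous by (simp add: tgw_free_grading_def)

lemma single_mult: "single K u \<otimes>\<^bsub>F\<^esub> single K v = single K (u @ v)"
  unfolding tgw_free_def by (rule free_algebra_mult_single[OF K.is_cring])

lemma tgw_gensI:
  "r \<in> carrier R \<Longrightarrow> Coeff r \<in> gens" "i \<in> {1..n} \<Longrightarrow> XPos i \<in> gens" "i \<in> {1..n} \<Longrightarrow> XNeg i \<in> gens"
  by (auto simp: tgw_gens_def)

lemma signed_gen_in: "u \<in> signed_indices n \<Longrightarrow> signed_gen u \<in> gens"
  by (auto simp: signed_indices_def signed_gen_def intro!: tgw_gensI)

lemma sigma_closed:
  assumes "i \<in> {1..n}" "r \<in> carrier R"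
  shows "tgw_sigma D i r \<in> carrier R" "inv_into (carrier R) (tgw_sigma D i) r \<in> carrier R"
proof -
  have "bij_betw (tgw_sigma D i) (carrier R) (carrier R)"
    using sigma_aut[OF assms(1)] by (simp add: alg_iso_def ring_iso_def)
  then have "tgw_sigma D i ` carrier R = carrier R" by (simp add: bij_betw_def)
  then show "tgw_sigma D i r \<in> carrier R" "inv_into (carrier R) (tgw_sigma D i) r \<in> carrier R"
    using assms(2) inv_into_into[of r "tgw_sigma D i" "carrier R"] by auto
qed

text \<open>Every defining relation equates combinations of words of one degree: coefficients have degree zero,
  and \<open>X\<^sub>i\<^sup>+\<close> and \<open>X\<^sub>i\<^sup>-\<close> have opposite degrees.\<close>

lemma tgw_relations_homogeneous: "tgw_relations K D \<subseteq> (\<Union>\<gamma>\<in>carrier (int_lattice n). tgw_free_grading K D \<gamma>)"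
proof
  fix x assume "x \<in> tgw_relations K D"
  have S: "submodule (tgw_free_grading K D (word_degree n w)) K F" for w
    by (rule grading_submodule[OF FG(3)]) (simp add: word_degree_def int_lattice_carrier)
  have hom: "single K w \<ominus>\<^bsub>F\<^esub> y \<in> (\<Union>\<gamma>\<in>carrier (int_lattice n). tgw_free_grading K D \<gamma>)"
    if "w \<in> lists gens" "y \<in> tgw_free_grading K D (word_degree n w)" for w y
  proof (rule UN_I)
    show "word_degree n w \<in> carrier (int_lattice n)" by (simp add: word_degree_def int_lattice_carrier)
    show "single K w \<ominus>\<^bsub>F\<^esub> y \<in> tgw_free_grading K D (word_degree n w)"
      using single_homogeneous[OF that(1)] that(2) S[of w] module.submoduleE(3,5)[OF FM S[of w]]
      by (simp add: a_minus_def)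
  qed
  have t: "tgw_t D i \<in> carrier R" if "i \<in> {1..n}" for i
    using t_central[OF that] by (simp add: ring_center_def)
  have mu: "tgw_mu D i j \<in> carrier K" if "i \<in> {1..n}" "j \<in> {1..n}" for i j
    using mu_units[OF that] K.Units_closed by blast
  have deg: "single K v \<in> tgw_free_grading K D (word_degree n w)"
    if "v \<in> lists gens" "word_degree n v = word_degree n w" for v w
    using single_homogeneous[OF that(1)] that(2) by simp
  note intros = hom deg submodule_add[OF S] submodule_smult[OF S]
  from \<open>x \<in> tgw_relations K D\<close>
  show "x \<in> (\<Union>\<gamma>\<in>carrier (int_lattice n). tgw_free_grading K D \<gamma>)"
  proof cases
    case (coeff_add r s)
    show ?thesis unfolding coeff_add(1)
      by (intro intros) (use coeff_add in \<open>auto intro!: tgw_gensI simp: word_degree_def\<close>)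
  next
    case (coeff_smult c r)
    show ?thesis unfolding coeff_smult(1)
      by (intro intros) (use coeff_smult in \<open>auto intro!: tgw_gensI simp: word_degree_def\<close>)
  next
    case (coeff_mult r s)
    show ?thesis unfolding coeff_mult(1)
      by (intro intros) (use coeff_mult in \<open>auto intro!: tgw_gensI simp: word_degree_def\<close>)
  next
    case coeff_one
    show ?thesis unfolding coeff_one(1)
      by (intro intros) (auto intro!: tgw_gensI simp: word_degree_def)
  next
    case (X_pos_coeff i r)
    show ?thesis unfolding X_pos_coeff(1)
      by (intro intros) (use X_pos_coeff sigma_closed in \<open>auto intro!: tgw_gensI simp: word_degree_def\<close>)
  next
    case (X_neg_coeff i r)
    show ?thesis unfolding X_neg_coeff(1)
      by (intro intros) (use X_neg_coeff sigma_closed in \<open>auto intro!: tgw_gensI simp: word_degree_def\<close>)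
  next
    case (X_neg_pos i)
    show ?thesis unfolding X_neg_pos(1)
      by (intro intros) (use X_neg_pos t in \<open>auto intro!: tgw_gensI simp: word_degree_def intro!: restrict_ext\<close>)
  next
    case (X_pos_neg i)
    show ?thesis unfolding X_pos_neg(1)
      by (intro intros) (use X_pos_neg t sigma_closed in \<open>auto intro!: tgw_gensI simp: word_degree_def intro!: restrict_ext\<close>)
  next
    case (X_mixed i j)
    show ?thesis unfolding X_mixed(1)
      by (intro intros) (use X_mixed mu in \<open>auto intro!: tgw_gensI simp: word_degree_def intro!: restrict_ext\<close>)
  qed
qed

lemma tgw_ideal_graded: "graded_ideal (int_lattice n) F (tgw_free_grading K D) (tgw_ideal K D)"
  unfolding tgw_ideal_def by (rule genideal_graded[OF tgw_free_graded tgw_relations_homogeneous])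

lemma tgwc_graded: "graded_algebra K (int_lattice n) (tgwc K D) (tgwc_grading K D)"
  using quot_graded_algebra[OF tgw_free_graded tgw_ideal_graded]
  unfolding tgwc_def tgwc_grading_def[abs_def] tgw_free_grading_def .

lemma tgw_radical_graded: "graded_ideal (int_lattice n) (tgwc K D) (tgwc_grading K D) (tgw_radical K D)"
  unfolding tgw_radical_def by (rule sum_graded_ideals[OF tgwc_graded]) simp

theorem tgwa_graded: "graded_algebra K (int_lattice n) (tgwa K D) (tgwa_grading K D)"
  using quot_graded_algebra[OF tgwc_graded tgw_radical_graded]
  unfolding tgwa_def tgwa_grading_def[abs_def] .

private lemmas CG = graded_algebraD[OF tgwc_graded]
private lemmas CM = k_algebra_module[OF graded_algebraD(1)[OF tgwc_graded]]
private lemmas AG = graded_algebraD[OF tgwa_graded]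
private lemmas AM = k_algebra_module[OF graded_algebraD(1)[OF tgwa_graded]]

lemma tgw_ideals: "ideal (tgw_ideal K D) F" "ideal (tgw_radical K D) (tgwc K D)"
  using tgw_ideal_graded tgw_radical_graded by (simp_all add: graded_ideal_def)

lemma tgwa_class_hom:
  shows "tgwa_class K D \<in> linear_maps K F (tgwa K D)"
    and "tgwa_class K D ` carrier F = carrier (tgwa K D)"
    and "x \<in> carrier F \<Longrightarrow> y \<in> carrier F \<Longrightarrow>
      tgwa_class K D (x \<otimes>\<^bsub>F\<^esub> y) = tgwa_class K D x \<otimes>\<^bsub>tgwa K D\<^esub> tgwa_class K D y"
    and "tgwa_class K D (single K []) = \<one>\<^bsub>tgwa K D\<^esub>"
    and "f \<in> tgw_free_grading K D \<alpha> \<Longrightarrow> tgwa_class K D f \<in> tgwa_grading K D \<alpha>"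
proof -
  note I1 = ideal_submodule[OF FG(1) tgw_ideals(1)] and I2 = ideal_submodule[OF CG(1) tgw_ideals(2)]
  note p1 = quot_projection_linear[OF FM I1, folded tgwc_def]
  note p2 = quot_projection_linear[OF CM I2, folded tgwa_def]
  show "tgwa_class K D \<in> linear_maps K F (tgwa K D)"
    using linear_map_comp[OF p1 p2] by (simp add: tgwa_class_def[abs_def])
  have c1: "carrier (tgwc K D) = (\<lambda>x. tgw_ideal K D +>\<^bsub>F\<^esub> x) ` carrier F"
    and c2: "carrier (tgwa K D) = (\<lambda>x. tgw_radical K D +>\<^bsub>tgwc K D\<^esub> x) ` carrier (tgwc K D)"
    by (simp_all add: tgwc_def tgwa_def quot_algebra_simps)
  show "tgwa_class K D ` carrier F = carrier (tgwa K D)"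
    unfolding c1 c2 by (simp add: image_image tgwa_class_def)
  show "x \<in> carrier F \<Longrightarrow> y \<in> carrier F \<Longrightarrow>
      tgwa_class K D (x \<otimes>\<^bsub>F\<^esub> y) = tgwa_class K D x \<otimes>\<^bsub>tgwa K D\<^esub> tgwa_class K D y"
    using quot_k_algebra(2)[OF FG(1) tgw_ideals(1), folded tgwc_def]
      quot_k_algebra(2)[OF CG(1) tgw_ideals(2), folded tgwa_def] c1 by (simp add: tgwa_class_def)
  show "tgwa_class K D (single K []) = \<one>\<^bsub>tgwa K D\<^esub>"
    by (simp add: tgwa_class_def tgwa_def tgwc_def quot_algebra_simps tgw_free_def free_algebra_simps(5))
  show "f \<in> tgw_free_grading K D \<alpha> \<Longrightarrow> tgwa_class K D f \<in> tgwa_grading K D \<alpha>"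
    by (simp add: tgwa_class_def tgwa_grading_def tgwc_grading_def tgw_free_grading_def)
qed

lemma tgwa_class_relation:
  assumes "x \<ominus>\<^bsub>F\<^esub> y \<in> tgw_relations K D" "x \<in> carrier F" "y \<in> carrier F"
  shows "tgwa_class K D x = tgwa_class K D y"
proof -
  interpret F: k_algebra K F by (rule FG(1))
  have "tgw_relations K D \<subseteq> carrier F"
    using tgw_relations_homogeneous by (auto simp: tgw_free_grading_def)
  then have "x \<ominus>\<^bsub>F\<^esub> y \<in> tgw_ideal K D"
    unfolding tgw_ideal_def using assms(1) F.genideal_self by blast
  moreover have "x = (x \<ominus>\<^bsub>F\<^esub> y) \<oplus>\<^bsub>F\<^esub> y"
    using assms(2,3) by (simp add: a_minus_def F.M.a_assoc F.M.l_neg)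
  ultimately have "tgw_ideal K D +>\<^bsub>F\<^esub> x = tgw_ideal K D +>\<^bsub>F\<^esub> y"
    using quot_coset_eq_iff[OF FM ideal_submodule[OF FG(1) tgw_ideals(1)] assms(2,3)] by blast
  then show ?thesis by (simp add: tgwa_class_def)
qed

lemma tgwa_class_word_append:
  "u \<in> lists gens \<Longrightarrow> v \<in> lists gens \<Longrightarrow>
    tgwa_class K D (single K (u @ v)) = tgwa_class K D (single K u) \<otimes>\<^bsub>tgwa K D\<^esub> tgwa_class K D (single K v)"
  using tgwa_class_hom(3)[OF single_in_tgw_free single_in_tgw_free] by (simp add: single_mult)

lemma tgwa_X_word_eq:
  assumes "us \<in> lists (signed_indices n)"
  shows "tgwa_X_word K D us = tgwa_class K D (single K (map signed_gen us))"
  using assms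
proof (induction us)
  case Nil
  then show ?case by (simp add: tgwa_X_word_def tgwa_class_hom(4))
next
  case (Cons u us)
  have "map signed_gen us \<in> lists gens" using Cons signed_gen_in by (auto simp: in_lists_conv_set)
  moreover have "[signed_gen u] \<in> lists gens" using Cons signed_gen_in by auto
  moreover have "tgwa_X K D u = tgwa_class K D (single K [signed_gen u])"
    by (simp add: tgwa_X_def signed_gen_def)
  ultimately show ?case
    using Cons tgwa_class_word_append[of "[signed_gen u]" "map signed_gen us"]
    by (simp add: tgwa_X_word_def)
qed

lemma tgwa_monomial_eq:
  assumes "r \<in> carrier R" "us \<in> lists (signed_indices n)"
  shows "tgwa_coeff K D r \<otimes>\<^bsub>tgwa K D\<^esub> tgwa_X_word K D us =
    tgwa_class K D (single K (Coeff r # map signed_gen us))"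
proof -
  have "map signed_gen us \<in> lists gens" using assms signed_gen_in by (auto simp: in_lists_conv_set)
  moreover have "[Coeff r] \<in> lists gens" using assms tgw_gensI by auto
  ultimately show ?thesis
    using tgwa_class_word_append[of "[Coeff r]" "map signed_gen us"] assms
    by (simp add: tgwa_coeff_def tgwa_X_word_eq)
qed

lemma tgwa_monomial_homogeneous:
  assumes "r \<in> carrier R" "us \<in> lists (signed_indices n)"
  shows "tgwa_coeff K D r \<otimes>\<^bsub>tgwa K D\<^esub> tgwa_X_word K D us \<in> tgwa_grading K D (signed_degree n us)"
proof -
  have w: "Coeff r # map signed_gen us \<in> lists gens"
    using assms signed_gen_in tgw_gensI by (auto simp: in_lists_conv_set)
  have "word_degree n (Coeff r # map signed_gen us) = word_degree n (map signed_gen us :: 'r tgw_gen list)"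
    by (simp add: word_degree_def)
  then have "word_degree n (Coeff r # map signed_gen us) = signed_degree n us"
    using word_degree_signed[OF assms(2)] by metis
  then show ?thesis
    using tgwa_class_hom(5)[OF single_homogeneous[OF w]] by (simp add: tgwa_monomial_eq[OF assms])
qed

text \<open>A coefficient moves to the left of a generator at the price of applying \<open>\<sigma>\<^sub>i\<close> or its inverse.\<close>

lemma tgwa_X_coeff:
  assumes "u \<in> signed_indices n" "r \<in> carrier R"
  shows "\<exists>r'\<in>carrier R. tgwa_class K D (single K [signed_gen u, Coeff r]) =
    tgwa_class K D (single K [Coeff r', signed_gen u])"
proof (cases "u > 0")
  case True
  then have i: "nat \<bar>u\<bar> \<in> {1..n}" using assms by (auto simp: signed_indices_def)
  show ?thesis
    using True tgwa_class_relation[OF tgw_relations.X_pos_coeff[OF i assms(2)]]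
      single_in_tgw_free sigma_closed(1)[OF i assms(2)] tgw_gensI i assms(2)
    by (intro bexI[of _ "tgw_sigma D (nat \<bar>u\<bar>) r"]) (auto simp: signed_gen_def)
next
  case False
  then have i: "nat \<bar>u\<bar> \<in> {1..n}" using assms by (auto simp: signed_indices_def)
  show ?thesis
    using False tgwa_class_relation[OF tgw_relations.X_neg_coeff[OF i assms(2)]]
      single_in_tgw_free sigma_closed(2)[OF i assms(2)] tgw_gensI i assms(2)
    by (intro bexI[of _ "inv_into (carrier R) (tgw_sigma D (nat \<bar>u\<bar>)) r"]) (auto simp: signed_gen_def)
qed

lemma tgw_gens_cases:
  assumes "g \<in> gens"
  obtains (coeff) r where "g = Coeff r" "r \<in> carrier R"
    | (signed) u where "g = signed_gen u" "u \<in> signed_indices n"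
proof -
  have signed_ex: "XPos i = signed_gen (int i) \<and> int i \<in> signed_indices n"
    "XNeg i = signed_gen (- int i) \<and> - int i \<in> signed_indices n" if "i \<in> {1..n}" for i
    using that by (auto simp: signed_gen_def signed_indices_def)
  from assms consider r where "g = Coeff r" "r \<in> carrier R"
    | i where "i \<in> {1..n}" "g = XPos i" | i where "i \<in> {1..n}" "g = XNeg i"
    by (auto simp: tgw_gens_def)
  then show ?thesis
  proof cases
    case 1
    then show ?thesis by (rule coeff)
  next
    case 2
    then show ?thesis using signed signed_ex(1) by blast
  next
    case 3
    then show ?thesis using signed signed_ex(2) by blast
  qed
qed

text \<open>By induction on the word, keeping a single coefficient at the left end: a new coefficient is
  multiplied into it, and it is moved past a new generator.\<close>

lemma tgwa_word_normal_form:
  assumes "w \<in> lists gens"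
  shows "\<exists>r\<in>carrier R. \<exists>us\<in>lists (signed_indices n).
    tgwa_class K D (single K w) = tgwa_class K D (single K (Coeff r # map signed_gen us))"
  using assms
proof (induction w)
  case Nil
  have "tgwa_class K D (single K [Coeff \<one>\<^bsub>R\<^esub>]) = tgwa_class K D (single K [])"
    by (rule tgwa_class_relation[OF tgw_relations.coeff_one])
      (auto intro!: single_in_tgw_free tgw_gensI)
  then show ?case by (intro bexI[of _ "\<one>\<^bsub>R\<^esub>"] bexI[of _ "[]"]) auto
next
  case (Cons g w)
  then obtain r us where r: "r \<in> carrier R" and us: "us \<in> lists (signed_indices n)"
    and IH: "tgwa_class K D (single K w) = tgwa_class K D (single K (Coeff r # map signed_gen us))" by blast
  have us': "map signed_gen us \<in> lists gens" using us signed_gen_in by (auto simp: in_lists_conv_set)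
  have c: "Coeff r \<in> gens" using r tgw_gensI by blast
  note app = tgwa_class_word_append
  have g: "[g] \<in> lists gens" and w: "w \<in> lists gens" using Cons.hyps by auto
  have "tgwa_class K D (single K (g # w)) = tgwa_class K D (single K [g]) \<otimes>\<^bsub>tgwa K D\<^esub> tgwa_class K D (single K w)"
    using app[OF g w] by simp
  also have "\<dots> = tgwa_class K D (single K (([g] @ [Coeff r]) @ map signed_gen us))"
    unfolding IH using app[OF g, of "Coeff r # map signed_gen us"] c us' by simp
  also have "\<dots> = tgwa_class K D (single K [g, Coeff r]) \<otimes>\<^bsub>tgwa K D\<^esub> tgwa_class K D (single K (map signed_gen us))"
    using app[of "[g, Coeff r]", OF _ us'] g c by simp
  finally have eq: "tgwa_class K D (single K (g # w)) =
      tgwa_class K D (single K [g, Coeff r]) \<otimes>\<^bsub>tgwa K D\<^esub> tgwa_class K D (single K (map signed_gen us))" .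
  have "g \<in> gens" using g by simp
  then show ?case
  proof (cases rule: tgw_gens_cases)
    case (coeff s)
    then have sr: "s \<otimes>\<^bsub>R\<^esub> r \<in> carrier R" using r by simp
    have "tgwa_class K D (single K [Coeff (s \<otimes>\<^bsub>R\<^esub> r)]) = tgwa_class K D (single K [Coeff s, Coeff r])"
      by (rule tgwa_class_relation[OF tgw_relations.coeff_mult])
        (use coeff r sr in \<open>auto intro!: single_in_tgw_free tgw_gensI\<close>)
    then have "tgwa_class K D (single K (g # w)) = tgwa_class K D (single K ([Coeff (s \<otimes>\<^bsub>R\<^esub> r)] @ map signed_gen us))"
      using eq app[of "[Coeff (s \<otimes>\<^bsub>R\<^esub> r)]", OF _ us'] tgw_gensI(1)[OF sr] coeff by simp
    then show ?thesis using sr us by auto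
  next
    case (signed u)
    then obtain r' where r': "r' \<in> carrier R" "tgwa_class K D (single K [g, Coeff r]) =
        tgwa_class K D (single K [Coeff r', g])" using tgwa_X_coeff r by blast
    then have "tgwa_class K D (single K (g # w)) = tgwa_class K D (single K (Coeff r' # map signed_gen (u # us)))"
      using eq app[of "[Coeff r', g]", OF _ us'] tgw_gensI(1)[OF r'(1)] g signed by simp
    then show ?thesis using r' us signed by (metis lists.Cons)
  qed
qed

text \<open>The classes of words span, being images of a basis, and each of them is a monomial.\<close>

theorem tgwa_monomial_span:
  "carrier (tgwa K D) = lin_span K (tgwa K D)
    {tgwa_coeff K D r \<otimes>\<^bsub>tgwa K D\<^esub> tgwa_X_word K D us | r us. r \<in> carrier R \<and> us \<in> lists (signed_indices n)}"
    (is "_ = lin_span K _ ?S")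
proof (rule lin_span_eq_carrierI[OF AM])
  show "?S \<subseteq> carrier (tgwa K D)"
    using tgwa_monomial_homogeneous grading_carrier[OF AG(3) signed_degree_carrier] by blast
  show "carrier (tgwa K D) = lin_span K (tgwa K D) (tgwa_class K D ` single K ` lists gens)"
    by (rule surjective_image_span[OF FM AM tgwa_class_hom(1,2)])
      (unfold tgw_free_def, rule free_algebra_span[OF K.is_cring])
  have "tgwa_class K D ` single K ` lists gens \<subseteq> ?S"
  proof (intro subsetI, elim imageE)
    fix x f w assume w: "x = tgwa_class K D f" "f = single K w" "w \<in> lists gens"
    obtain r us where "r \<in> carrier R" "us \<in> lists (signed_indices n)"
      "tgwa_class K D (single K w) = tgwa_class K D (single K (Coeff r # map signed_gen us))"
      using tgwa_word_normal_form[OF w(3)] by blast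
    then have "x = tgwa_coeff K D r \<otimes>\<^bsub>tgwa K D\<^esub> tgwa_X_word K D us"
        and "r \<in> carrier R" "us \<in> lists (signed_indices n)"
      using w tgwa_monomial_eq by simp_all
    then show "x \<in> ?S" by blast
  qed
  then show "tgwa_class K D ` single K ` lists gens \<subseteq> lin_span K (tgwa K D) ?S"
    using lin_span_superset by (rule subset_trans)
qed

lemma tgwa_coeff_one: "tgwa_coeff K D \<one>\<^bsub>R\<^esub> = \<one>\<^bsub>tgwa K D\<^esub>"
proof -
  have "tgwa_class K D (single K [Coeff \<one>\<^bsub>R\<^esub>]) = tgwa_class K D (single K [])"
    by (rule tgwa_class_relation[OF tgw_relations.coeff_one])
      (auto intro!: single_in_tgw_free tgw_gensI)
  then show ?thesis by (simp add: tgwa_coeff_def tgwa_class_hom(4))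
qed

lemma tgwa_coeff_in: "r \<in> carrier R \<Longrightarrow> tgwa_coeff K D r \<in> carrier (tgwa K D)"
  and tgwa_X_in: "u \<in> signed_indices n \<Longrightarrow> tgwa_X K D u \<in> carrier (tgwa K D)"
  and tgwa_X_word_in: "us \<in> lists (signed_indices n) \<Longrightarrow> tgwa_X_word K D us \<in> carrier (tgwa K D)"
proof -
  note cl = linear_map_closed[OF tgwa_class_hom(1) single_in_tgw_free]
  show "r \<in> carrier R \<Longrightarrow> tgwa_coeff K D r \<in> carrier (tgwa K D)"
    unfolding tgwa_coeff_def by (rule cl) (simp add: tgw_gensI)
  show "u \<in> signed_indices n \<Longrightarrow> tgwa_X K D u \<in> carrier (tgwa K D)"
    unfolding tgwa_X_def signed_gen_def[symmetric] by (rule cl) (simp add: signed_gen_in)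
  show "us \<in> lists (signed_indices n) \<Longrightarrow> tgwa_X_word K D us \<in> carrier (tgwa K D)"
    unfolding tgwa_X_word_eq by (rule cl) (auto simp: signed_gen_in in_lists_conv_set)
qed

end

end

section \<open>The bicharacter of a parameter matrix\<close>

text \<open>Reduces integer powers of units to those in the group of units, where the laws of exponents hold.\<close>

lemma unit_int_pow:
  assumes "field K" "x \<in> Units K"
  shows "x [^]\<^bsub>K\<^esub> (k::int) = x [^]\<^bsub>units_of K\<^esub> k"
proof -
  interpret field K by fact
  have nat: "x [^]\<^bsub>units_of K\<^esub> m = x [^]\<^bsub>K\<^esub> m" "x [^]\<^bsub>K\<^esub> m \<in> Units K" for m :: nat
    using units_of_pow[OF assms(2), of m] monoid.nat_pow_closed[OF group.is_monoid[OF units_group], of x m]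
      assms(2)
    by (simp_all only: units_of_carrier)
  then have "inv\<^bsub>units_of K\<^esub> (x [^]\<^bsub>K\<^esub> m) = inv\<^bsub>K\<^esub> (x [^]\<^bsub>K\<^esub> m)" for m :: nat
    by (intro units_of_inv)
  with nat(1) show ?thesis
    unfolding int_pow_def2[of K] int_pow_def2[of "units_of K"] by (simp only:)
qed

context
  fixes K :: "('k, 'x) ring_scheme"
  assumes K: "field K"
begin

interpretation K: field K by (rule K)
interpretation U: comm_group "units_of K" by (rule K.units_comm_group)

lemma unit_int_pow_Units: "x \<in> Units K \<Longrightarrow> x [^]\<^bsub>K\<^esub> (k::int) \<in> Units K"
  using U.int_pow_closed[of x k] by (simp add: unit_int_pow[OF K] units_of_carrier)

lemma unit_int_pow_add:
  "x \<in> Units K \<Longrightarrow> x [^]\<^bsub>K\<^esub> (a + b :: int) = x [^]\<^bsub>K\<^esub> a \<otimes>\<^bsub>K\<^esub> x [^]\<^bsub>K\<^esub> b"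
  using U.int_pow_mult[of x a b] by (simp add: unit_int_pow[OF K] units_of_carrier units_of_mult)

lemma unit_int_pow_minus:
  "x \<in> Units K \<Longrightarrow> x [^]\<^bsub>K\<^esub> (- a :: int) = (inv\<^bsub>K\<^esub> x) [^]\<^bsub>K\<^esub> a"
  using U.int_pow_neg[of x a] U.int_pow_inv[of x a] K.units_of_inv
  by (simp add: unit_int_pow[OF K] units_of_carrier)

lemma unit_int_pow_one: "x \<in> Units K \<Longrightarrow> x [^]\<^bsub>K\<^esub> (1 :: int) = x"
  using U.int_pow_1[of x] by (simp add: unit_int_pow[OF K] units_of_carrier)

lemma finprod_Units: "(\<And>i. i \<in> I \<Longrightarrow> f i \<in> Units K) \<Longrightarrow> finprod K f I \<in> Units K"
proof (induction I rule: infinite_finite_induct)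
  case (insert i I)
  then have "f \<in> I \<rightarrow> carrier K" "f i \<in> carrier K" by auto
  then show ?case using insert by (simp add: K.finprod_insert)
qed auto

lemma finprod_single:
  assumes "finite I" "i \<in> I" "f i \<in> carrier K" "\<And>j. j \<in> I \<Longrightarrow> j \<noteq> i \<Longrightarrow> f j = \<one>\<^bsub>K\<^esub>"
  shows "finprod K f I = f i"
proof -
  have "finprod K f I = (\<Otimes>\<^bsub>K\<^esub>j\<in>I. if j = i then f i else \<one>\<^bsub>K\<^esub>)"
    by (rule K.finprod_cong') (use assms in auto)
  also have "\<dots> = f i"
    using K.finprod_singleton_swap[OF assms(2,1), of "\<lambda>_. f i"] assms(3) by simp
  finally show ?thesis .
qed

text \<open>Turns a product over positions, as in \<open>q_words\<close>, into a function defined along the list.  The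
  induction runs over initial segments because \<open>{..<Suc k}\<close> adds the last position.\<close>

lemma finprod_list:
  assumes "\<And>x. x \<in> set xs \<Longrightarrow> f x \<in> carrier K" "h [] = \<one>\<^bsub>K\<^esub>"
    "\<And>ys y. set (ys @ [y]) \<subseteq> set xs \<Longrightarrow> h (ys @ [y]) = h ys \<otimes>\<^bsub>K\<^esub> f y" "h xs \<in> carrier K"
  shows "(\<Otimes>\<^bsub>K\<^esub>i\<in>{..<length xs}. f (xs ! i)) = h xs"
proof -
  have "(\<Otimes>\<^bsub>K\<^esub>i\<in>{..<length ys}. f (ys ! i)) = h ys" if "set ys \<subseteq> set xs" for ys
    using that
  proof (induction ys rule: rev_induct)
    case Nil
    then show ?case using assms(2) by simp
  next
    case (snoc y ys)
    have f: "f (ys ! i) \<in> carrier K" if "i < length ys" for i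
      using assms(1) snoc.prems that by (auto simp: subset_iff)
    have fy: "f y \<in> carrier K" using assms(1) snoc.prems by auto
    have "(\<Otimes>\<^bsub>K\<^esub>i\<in>{..<length (ys @ [y])}. f ((ys @ [y]) ! i)) =
        f ((ys @ [y]) ! length ys) \<otimes>\<^bsub>K\<^esub> (\<Otimes>\<^bsub>K\<^esub>i\<in>{..<length ys}. f ((ys @ [y]) ! i))"
      unfolding length_append_singleton lessThan_Suc
      by (rule K.finprod_insert) (use f fy in \<open>auto simp: nth_append\<close>)
    also have "(\<Otimes>\<^bsub>K\<^esub>i\<in>{..<length ys}. f ((ys @ [y]) ! i)) = (\<Otimes>\<^bsub>K\<^esub>i\<in>{..<length ys}. f (ys ! i))"
      by (rule K.finprod_cong') (use f in \<open>auto simp: nth_append\<close>)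
    also have "\<dots> = h ys" using snoc by simp
    finally have eq: "(\<Otimes>\<^bsub>K\<^esub>i\<in>{..<length (ys @ [y])}. f ((ys @ [y]) ! i)) = f y \<otimes>\<^bsub>K\<^esub> h ys" by simp
    have "h ys \<in> carrier K"
      using snoc f by (simp flip: snoc.IH)
    then show ?case using eq assms(3)[OF snoc.prems] fy K.m_comm by simp
  qed
  then show ?thesis by simp
qed

end

lemma signed_index_cases:
  assumes "v \<in> signed_indices n"
  obtains i where "i \<in> {1..n}" "v = int i" | i where "i \<in> {1..n}" "v = - int i"
proof (cases "v > 0")
  case True
  then show ?thesis using assms that(1)[of "nat v"] by (auto simp: signed_indices_def)
next
  case False
  then show ?thesis using assms that(2)[of "nat (- v)"] by (auto simp: signed_indices_def)
qed

text \<open>The bicharacter \<open>(\<beta>, \<alpha>) \<mapsto> \<Prod> q\<^sub>i\<^sub>j\<^bsup>\<beta>\<^sub>i \<alpha>\<^sub>j\<^esup>\<close> on \<open>\<int>\<^sup>n \<times> \<int>\<^sup>m\<close> that governs both twists.\<close>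

definition lattice_pairing ::
  "('k, 'x) ring_scheme \<Rightarrow> (nat \<Rightarrow> nat \<Rightarrow> 'k) \<Rightarrow> nat \<Rightarrow> nat \<Rightarrow> (nat \<Rightarrow> int) \<Rightarrow> (nat \<Rightarrow> int) \<Rightarrow> 'k"
  where "lattice_pairing K q n m \<beta> \<alpha> =
    (\<Otimes>\<^bsub>K\<^esub>i\<in>{1..n}. \<Otimes>\<^bsub>K\<^esub>j\<in>{1..m}. q i j [^]\<^bsub>K\<^esub> (\<beta> i * \<alpha> j))"

context
  fixes K :: "('k, 'x) ring_scheme" and q :: "nat \<Rightarrow> nat \<Rightarrow> 'k" and n m :: nat
  assumes K: "field K" and q: "\<And>i j. i \<in> {1..n} \<Longrightarrow> j \<in> {1..m} \<Longrightarrow> q i j \<in> Units K"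
begin

interpretation K: field K by (rule K)

private abbreviation (input) "Q \<equiv> lattice_pairing K q n m"
private lemmas pU = unit_int_pow_Units[OF K]

lemma lattice_pairing_Units: "Q \<beta> \<alpha> \<in> Units K"
  unfolding lattice_pairing_def by (intro finprod_Units[OF K] pU q)

lemma lattice_pairing_in: "Q \<beta> \<alpha> \<in> carrier K"
  using lattice_pairing_Units K.Units_closed by blast

lemma lattice_pairing_bicharacter: "bicharacter K (int_lattice n) (int_lattice m) Q"
proof -
  have c: "q i j [^]\<^bsub>K\<^esub> (k::int) \<in> carrier K" if "i \<in> {1..n}" "j \<in> {1..m}" for i j k
    using pU[OF q[OF that]] by auto
  have c': "(\<Otimes>\<^bsub>K\<^esub>j\<in>{1..m}. q i j [^]\<^bsub>K\<^esub> (k j :: int)) \<in> carrier K" if "i \<in> {1..n}" for i k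
    by (rule K.finprod_closed) (use c that in auto)
  have "Q (\<beta> \<otimes>\<^bsub>int_lattice n\<^esub> \<beta>') \<alpha> = Q \<beta> \<alpha> \<otimes>\<^bsub>K\<^esub> Q \<beta>' \<alpha>" for \<beta> \<beta>' \<alpha>
  proof -
    have "Q (\<beta> \<otimes>\<^bsub>int_lattice n\<^esub> \<beta>') \<alpha> = (\<Otimes>\<^bsub>K\<^esub>i\<in>{1..n}. \<Otimes>\<^bsub>K\<^esub>j\<in>{1..m}. q i j [^]\<^bsub>K\<^esub> (\<beta> i * \<alpha> j) \<otimes>\<^bsub>K\<^esub> q i j [^]\<^bsub>K\<^esub> (\<beta>' i * \<alpha> j))"
      unfolding lattice_pairing_def
      by (intro K.finprod_cong' refl)
        (use c in \<open>auto simp: int_lattice_mult distrib_right unit_int_pow_add[OF K q] intro!: K.finprod_closed\<close>)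
    also have "\<dots> = (\<Otimes>\<^bsub>K\<^esub>i\<in>{1..n}. (\<Otimes>\<^bsub>K\<^esub>j\<in>{1..m}. q i j [^]\<^bsub>K\<^esub> (\<beta> i * \<alpha> j)) \<otimes>\<^bsub>K\<^esub> (\<Otimes>\<^bsub>K\<^esub>j\<in>{1..m}. q i j [^]\<^bsub>K\<^esub> (\<beta>' i * \<alpha> j)))"
      by (intro K.finprod_cong' refl K.finprod_multf) (use c c' in auto)
    also have "\<dots> = Q \<beta> \<alpha> \<otimes>\<^bsub>K\<^esub> Q \<beta>' \<alpha>"
      unfolding lattice_pairing_def by (rule K.finprod_multf) (use c' in auto)
    finally show ?thesis .
  qed
  moreover have "Q \<beta> (\<alpha> \<otimes>\<^bsub>int_lattice m\<^esub> \<alpha>') = Q \<beta> \<alpha> \<otimes>\<^bsub>K\<^esub> Q \<beta> \<alpha>'" for \<beta> \<alpha> \<alpha>'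
  proof -
    have "Q \<beta> (\<alpha> \<otimes>\<^bsub>int_lattice m\<^esub> \<alpha>') = (\<Otimes>\<^bsub>K\<^esub>i\<in>{1..n}. \<Otimes>\<^bsub>K\<^esub>j\<in>{1..m}. q i j [^]\<^bsub>K\<^esub> (\<beta> i * \<alpha> j) \<otimes>\<^bsub>K\<^esub> q i j [^]\<^bsub>K\<^esub> (\<beta> i * \<alpha>' j))"
      unfolding lattice_pairing_def
      by (intro K.finprod_cong' refl)
        (use c in \<open>auto simp: int_lattice_mult distrib_left unit_int_pow_add[OF K q] intro!: K.finprod_closed\<close>)
    also have "\<dots> = (\<Otimes>\<^bsub>K\<^esub>i\<in>{1..n}. (\<Otimes>\<^bsub>K\<^esub>j\<in>{1..m}. q i j [^]\<^bsub>K\<^esub> (\<beta> i * \<alpha> j)) \<otimes>\<^bsub>K\<^esub> (\<Otimes>\<^bsub>K\<^esub>j\<in>{1..m}. q i j [^]\<^bsub>K\<^esub> (\<beta> i * \<alpha>' j)))"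
      by (intro K.finprod_cong' refl K.finprod_multf) (use c c' in auto)
    also have "\<dots> = Q \<beta> \<alpha> \<otimes>\<^bsub>K\<^esub> Q \<beta> \<alpha>'"
      unfolding lattice_pairing_def by (rule K.finprod_multf) (use c' in auto)
    finally show ?thesis .
  qed
  ultimately show ?thesis
    by (simp add: bicharacter_def lattice_pairing_Units)
qed

lemma lattice_pairing_one_left: "Q \<one>\<^bsub>int_lattice n\<^esub> \<alpha> = \<one>\<^bsub>K\<^esub>"
proof -
  have "Q \<one>\<^bsub>int_lattice n\<^esub> \<alpha> = (\<Otimes>\<^bsub>K\<^esub>i\<in>{1..n}. \<Otimes>\<^bsub>K\<^esub>j\<in>{1..m}. \<one>\<^bsub>K\<^esub>)"
    unfolding lattice_pairing_def by (intro K.finprod_cong' refl) (auto simp: int_lattice_one)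
  then show ?thesis by simp
qed

lemma lattice_pairing_one_right: "Q \<beta> \<one>\<^bsub>int_lattice m\<^esub> = \<one>\<^bsub>K\<^esub>"
proof -
  have "Q \<beta> \<one>\<^bsub>int_lattice m\<^esub> = (\<Otimes>\<^bsub>K\<^esub>i\<in>{1..n}. \<Otimes>\<^bsub>K\<^esub>j\<in>{1..m}. \<one>\<^bsub>K\<^esub>)"
    unfolding lattice_pairing_def by (intro K.finprod_cong' refl) (auto simp: int_lattice_one)
  then show ?thesis by simp
qed

text \<open>The scalars by which the twisting system acts on the generators of the second algebra.\<close>

lemma lattice_pairing_single_left:
  assumes i: "i \<in> {1..n}"
  shows "Q (signed_degree n [int i]) \<alpha> = (\<Otimes>\<^bsub>K\<^esub>j\<in>{1..m}. q i j [^]\<^bsub>K\<^esub> \<alpha> j)"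
    and "Q (signed_degree n [- int i]) \<alpha> = (\<Otimes>\<^bsub>K\<^esub>j\<in>{1..m}. (inv\<^bsub>K\<^esub> q i j) [^]\<^bsub>K\<^esub> \<alpha> j)"
proof -
  have c: "q i j [^]\<^bsub>K\<^esub> (k::int) \<in> carrier K" if "j \<in> {1..m}" for j k
    using pU[OF q[OF i that]] by auto
  have eq: "Q (signed_degree n [v]) \<alpha> = (\<Otimes>\<^bsub>K\<^esub>j\<in>{1..m}. q i j [^]\<^bsub>K\<^esub> (sgn v * \<alpha> j))"
    if v: "nat \<bar>v\<bar> = i" for v
  proof -
    have "Q (signed_degree n [v]) \<alpha> = (\<Otimes>\<^bsub>K\<^esub>j\<in>{1..m}. q i j [^]\<^bsub>K\<^esub> (signed_degree n [v] i * \<alpha> j))"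
      unfolding lattice_pairing_def
    proof (rule finprod_single[OF K _ i])
      fix l assume "l \<in> {1..n}" "l \<noteq> i"
      then have "(\<Otimes>\<^bsub>K\<^esub>j\<in>{1..m}. q l j [^]\<^bsub>K\<^esub> (signed_degree n [v] l * \<alpha> j)) = (\<Otimes>\<^bsub>K\<^esub>j\<in>{1..m}. \<one>\<^bsub>K\<^esub>)"
        using v by (intro K.finprod_cong') (auto simp: signed_degree_def)
      then show "(\<Otimes>\<^bsub>K\<^esub>j\<in>{1..m}. q l j [^]\<^bsub>K\<^esub> (signed_degree n [v] l * \<alpha> j)) = \<one>\<^bsub>K\<^esub>" by simp
    qed (use c in \<open>auto intro!: K.finprod_closed\<close>)
    then show ?thesis using i v by (simp add: signed_degree_def)
  qed
  show "Q (signed_degree n [int i]) \<alpha> = (\<Otimes>\<^bsub>K\<^esub>j\<in>{1..m}. q i j [^]\<^bsub>K\<^esub> \<alpha> j)"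
    using eq[of "int i"] i by simp
  have "Q (signed_degree n [- int i]) \<alpha> = (\<Otimes>\<^bsub>K\<^esub>j\<in>{1..m}. q i j [^]\<^bsub>K\<^esub> (- \<alpha> j))"
    using eq[of "- int i"] i by simp
  also have "\<dots> = (\<Otimes>\<^bsub>K\<^esub>j\<in>{1..m}. (inv\<^bsub>K\<^esub> q i j) [^]\<^bsub>K\<^esub> \<alpha> j)"
    by (rule K.finprod_cong'[OF refl])
      (use K.Units_closed[OF pU[OF K.Units_inv_Units[OF q[OF i]]]] in \<open>auto simp: unit_int_pow_minus[OF K q[OF i]]\<close>)
  finally show "Q (signed_degree n [- int i]) \<alpha> = (\<Otimes>\<^bsub>K\<^esub>j\<in>{1..m}. (inv\<^bsub>K\<^esub> q i j) [^]\<^bsub>K\<^esub> \<alpha> j)" .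
qed

lemma lattice_pairing_single:
  assumes v: "v \<in> signed_indices n" and u: "u \<in> signed_indices m"
  shows "Q (signed_degree n [v]) (signed_degree m [u]) = q_signed K q v u"
proof -
  have j: "nat \<bar>u\<bar> \<in> {1..m}" using u by (auto simp: signed_indices_def)
  let ?d = "\<lambda>j. signed_degree m [u] j"
  have d: "?d j = (if j = nat \<bar>u\<bar> then sgn u else 0)" if "j \<in> {1..m}" for j
    using that by (auto simp: signed_degree_def)
  have s: "(\<Otimes>\<^bsub>K\<^esub>j\<in>{1..m}. x j [^]\<^bsub>K\<^esub> ?d j) = x (nat \<bar>u\<bar>) [^]\<^bsub>K\<^esub> sgn u"
    if x: "\<And>j. j \<in> {1..m} \<Longrightarrow> x j \<in> Units K" for x
  proof -
    have "(\<Otimes>\<^bsub>K\<^esub>j\<in>{1..m}. x j [^]\<^bsub>K\<^esub> ?d j) = x (nat \<bar>u\<bar>) [^]\<^bsub>K\<^esub> ?d (nat \<bar>u\<bar>)"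
      by (rule finprod_single[OF K _ j]) (use pU[OF x] d j in auto)
    then show ?thesis using d[OF j] by simp
  qed
  have one: "x [^]\<^bsub>K\<^esub> (1::int) = x" "x [^]\<^bsub>K\<^esub> (- 1::int) = inv\<^bsub>K\<^esub> x" if "x \<in> Units K" for x
    using unit_int_pow_one[OF K] unit_int_pow_minus[OF K, of x 1] K.Units_inv_Units that by simp_all
  have u0: "u \<noteq> 0" using u by (simp add: signed_indices_def)
  from v show ?thesis
  proof (cases rule: signed_index_cases)
    case (1 i)
    note qi = q[OF 1(1)]
    show ?thesis
      using lattice_pairing_single_left(1)[OF 1(1)] s[of "q i", OF qi] one[OF qi[OF j]] 1 u0
      by (auto simp: q_signed_def sgn_if)
  next
    case (2 i)
    note qi = q[OF 2(1)]
    have "(\<Otimes>\<^bsub>K\<^esub>j\<in>{1..m}. (inv\<^bsub>K\<^esub> q i j) [^]\<^bsub>K\<^esub> ?d j) = (inv\<^bsub>K\<^esub> q i (nat \<bar>u\<bar>)) [^]\<^bsub>K\<^esub> sgn u"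
      by (rule s[of "\<lambda>j. inv\<^bsub>K\<^esub> q i j"]) (use qi in auto)
    then show ?thesis
      using lattice_pairing_single_left(2)[OF 2(1)] one[OF K.Units_inv_Units[OF qi[OF j]]] 2 u0
        K.Units_inv_inv[OF qi[OF j]]
      by (auto simp: q_signed_def sgn_if)
  qed
qed

text \<open>The scalar attached to two words depends on their degrees only.  Both sides are multiplicative in
  each word, so the equality reduces to single letters.\<close>

lemma q_words_eq_lattice_pairing:
  assumes vs: "vs \<in> lists (signed_indices n)" and us: "us \<in> lists (signed_indices m)"
  shows "q_words K q vs us = Q (signed_degree n vs) (signed_degree m us)"
proof -
  note bi = lattice_pairing_bicharacter[unfolded bicharacter_def]
  note carr = signed_degree_carrier
  have qs: "q_signed K q v u \<in> carrier K" if "v \<in> signed_indices n" "u \<in> signed_indices m" for v u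
    using lattice_pairing_single[OF that] lattice_pairing_in by metis
  have inner: "(\<Otimes>\<^bsub>K\<^esub>j\<in>{..<length us}. q_signed K q v (us ! j)) = Q (signed_degree n [v]) (signed_degree m us)"
    if v: "v \<in> signed_indices n" for v
  proof (rule finprod_list[OF K])
    show "q_signed K q v u \<in> carrier K" if "u \<in> set us" for u
      using qs[OF v] us that by auto
    show "Q (signed_degree n [v]) (signed_degree m []) = \<one>\<^bsub>K\<^esub>"
      by (simp add: signed_degree_Nil lattice_pairing_one_right)
    show "Q (signed_degree n [v]) (signed_degree m (ys @ [y])) =
        Q (signed_degree n [v]) (signed_degree m ys) \<otimes>\<^bsub>K\<^esub> q_signed K q v y" if "set (ys @ [y]) \<subseteq> set us" for ys y
    proof -
      have "y \<in> signed_indices m" using that us by auto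
      then show ?thesis
        using bi carr lattice_pairing_single[OF v] by (simp add: signed_degree_append)
    qed
  qed (rule lattice_pairing_in)
  have "q_words K q vs us =
      (\<Otimes>\<^bsub>K\<^esub>i\<in>{..<length vs}. Q (signed_degree n [vs ! i]) (signed_degree m us))"
    unfolding q_words_def
    by (rule K.finprod_cong') (use inner vs lattice_pairing_in in auto)
  also have "\<dots> = Q (signed_degree n vs) (signed_degree m us)"
  proof (rule finprod_list[OF K])
    show "Q (signed_degree n []) (signed_degree m us) = \<one>\<^bsub>K\<^esub>"
      by (simp add: signed_degree_Nil lattice_pairing_one_left)
    show "Q (signed_degree n (ys @ [y])) (signed_degree m us) =
        Q (signed_degree n ys) (signed_degree m us) \<otimes>\<^bsub>K\<^esub> Q (signed_degree n [y]) (signed_degree m us)" for ys y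
      using bi carr by (simp add: signed_degree_append)
  qed (rule lattice_pairing_in)+
  finally show ?thesis .
qed

end

section \<open>The twisting map and the twisting system of two twisted generalized Weyl algebras\<close>

context tgw_datum
begin

lemma tgwa_X_word_Nil: "tgwa_X_word K D [] = \<one>\<^bsub>tgwa K D\<^esub>"
  and tgwa_X_word_Cons: "tgwa_X_word K D (u # us) = tgwa_X K D u \<otimes>\<^bsub>tgwa K D\<^esub> tgwa_X_word K D us"
  by (simp_all add: tgwa_X_word_def)

lemma tgwa_coeff_homogeneous:
  assumes "r \<in> carrier (tgw_base D)"
  shows "tgwa_coeff K D r \<in> tgwa_grading K D \<one>\<^bsub>int_lattice (tgw_rank D)\<^esub>"
proof -
  interpret A: k_algebra K "tgwa K D" by (rule graded_algebraD(1)[OF tgwa_graded])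
  show ?thesis
    using tgwa_monomial_homogeneous[OF assms, of "[]"] tgwa_coeff_in[OF assms]
    by (simp add: tgwa_X_word_Nil signed_degree_Nil)
qed

lemma tgwa_X_homogeneous:
  assumes "u \<in> signed_indices (tgw_rank D)"
  shows "tgwa_X K D u \<in> tgwa_grading K D (signed_degree (tgw_rank D) [u])"
proof -
  interpret A: k_algebra K "tgwa K D" by (rule graded_algebraD(1)[OF tgwa_graded])
  show ?thesis
    using assms tgwa_X_in[OF assms] tgwa_monomial_homogeneous[of "\<one>\<^bsub>tgw_base D\<^esub>" "[u]"]
    by (simp add: tgwa_X_word_Nil tgwa_X_word_Cons tgwa_coeff_one)
qed

end

context
  fixes K :: "('k, 'x) ring_scheme" and D :: "('k, 'r) tgw_data" and D' :: "('k, 's) tgw_data"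
    and q :: "nat \<Rightarrow> nat \<Rightarrow> 'k"
  assumes D: "tgw_datum K D" and D': "tgw_datum K D'"
    and q: "\<And>i j. i \<in> {1..tgw_rank D'} \<Longrightarrow> j \<in> {1..tgw_rank D} \<Longrightarrow> q i j \<in> Units K"
begin

interpretation D: tgw_datum K D by (rule D)
interpretation D': tgw_datum K D' by (rule D')

private abbreviation (input) "AD \<equiv> tgwa K D"
private abbreviation (input) "BD \<equiv> tgwa K D'"
private abbreviation (input) "ED \<equiv> tensor_algebra K AD BD"
private abbreviation (input) "TD \<equiv> tensor_space K AD BD"
private abbreviation (input) "\<Gamma>D \<equiv> int_lattice (tgw_rank D)"
private abbreviation (input) "\<Delta>D \<equiv> int_lattice (tgw_rank D')"
private abbreviation (input) "QD \<equiv> lattice_pairing K q (tgw_rank D') (tgw_rank D)"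

private lemmas fieldK = D.K.field_axioms
private lemmas gradedAD = graded_algebraD[OF D.tgwa_graded]
private lemmas gradedBD = graded_algebraD[OF D'.tgwa_graded]
private lemmas moduleAD = k_algebra_module[OF graded_algebraD(1)[OF D.tgwa_graded]]
private lemmas moduleBD = k_algebra_module[OF graded_algebraD(1)[OF D'.tgwa_graded]]
private lemmas Q_in = lattice_pairing_in[of K "tgw_rank D'" "tgw_rank D" q, OF D.K.field_axioms q]
private lemmas Q_bi = lattice_pairing_bicharacter[of K "tgw_rank D'" "tgw_rank D" q, OF D.K.field_axioms q]

interpretation AD: k_algebra K AD by (rule gradedAD(1))
interpretation BD: k_algebra K BD by (rule gradedBD(1))
interpretation ED: k_algebra K ED by (rule tensor_algebra_k_algebra[OF gradedAD(1) gradedBD(1)])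

text \<open>Monomials are homogeneous, so a map that acts by the bicharacter on homogeneous elements has the
  prescribed values on monomials.  Conversely, monomials span, so those values determine the map, which
  must then be the one constructed from the bicharacter.\<close>

lemma tgwa_twisting_map_iff:
  assumes tau: "tau \<in> linear_maps K (tensor_space K BD AD) TD"
  shows "is_tgwa_twisting_map K D D' q tau \<longleftrightarrow>
    (\<forall>\<alpha>\<in>carrier \<Gamma>D. \<forall>\<beta>\<in>carrier \<Delta>D. \<forall>a\<in>tgwa_grading K D \<alpha>. \<forall>b\<in>tgwa_grading K D' \<beta>.
      tau (pure_tensor K BD AD b a) = QD \<beta> \<alpha> \<odot>\<^bsub>TD\<^esub> pure_tensor K AD BD a b)"
    (is "_ \<longleftrightarrow> ?hom tau")
proof
  have words: "q_words K q vs us = QD (signed_degree (tgw_rank D') vs) (signed_degree (tgw_rank D) us)"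
    if "us \<in> lists (signed_indices (tgw_rank D))" "vs \<in> lists (signed_indices (tgw_rank D'))" for us vs
    using q_words_eq_lattice_pairing[of K "tgw_rank D'" "tgw_rank D" q, OF fieldK q that(2,1)] .
  have mon: "is_tgwa_twisting_map K D D' q t" if "?hom t" "t \<in> linear_maps K (tensor_space K BD AD) TD" for t
    unfolding is_tgwa_twisting_map_def Let_def
    using that D.tgwa_monomial_homogeneous D'.tgwa_monomial_homogeneous words signed_degree_carrier by auto
  show "is_tgwa_twisting_map K D D' q tau" if "?hom tau" by (rule mon[OF that tau])
  assume tm: "is_tgwa_twisting_map K D D' q tau"
  \<comment> \<open>Compare \<open>tau\<close> with the map that does act by the bicharacter.\<close>
  have tau0_exists: "\<exists>tau0\<in>linear_maps K (tensor_space K BD AD) TD. ?hom tau0"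
    by (rule bicharacter_flip_exists[OF gradedAD(3) gradedBD(3) Q_in])
  obtain tau0 where tau0: "tau0 \<in> linear_maps K (tensor_space K BD AD) TD" "?hom tau0"
    using tau0_exists by blast
  have "tau x = tau0 x" if x: "x \<in> carrier (tensor_space K BD AD)" for x
  proof (rule tensor_ext[OF moduleBD moduleAD tensor_space_module[OF moduleAD moduleBD] tau tau0(1)
        D'.tgwa_monomial_span D.tgwa_monomial_span _ x])
    fix x y
    assume "x \<in> {tgwa_coeff K D' r \<otimes>\<^bsub>BD\<^esub> tgwa_X_word K D' us | r us.
        r \<in> carrier (tgw_base D') \<and> us \<in> lists (signed_indices (tgw_rank D'))}"
    then obtain s vs where x: "x = tgwa_coeff K D' s \<otimes>\<^bsub>BD\<^esub> tgwa_X_word K D' vs"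
      "s \<in> carrier (tgw_base D')" "vs \<in> lists (signed_indices (tgw_rank D'))" by blast
    assume "y \<in> {tgwa_coeff K D r \<otimes>\<^bsub>AD\<^esub> tgwa_X_word K D us | r us.
        r \<in> carrier (tgw_base D) \<and> us \<in> lists (signed_indices (tgw_rank D))}"
    then obtain r us where y: "y = tgwa_coeff K D r \<otimes>\<^bsub>AD\<^esub> tgwa_X_word K D us"
      "r \<in> carrier (tgw_base D)" "us \<in> lists (signed_indices (tgw_rank D))" by blast
    show "tau (pure_tensor K BD AD x y) = tau0 (pure_tensor K BD AD x y)"
      unfolding x(1) y(1)
      using tm[unfolded is_tgwa_twisting_map_def Let_def, THEN conjunct2, rule_format, OF y(2) x(2) y(3) x(3)]
        mon[OF tau0(2,1), unfolded is_tgwa_twisting_map_def Let_def, THEN conjunct2, rule_format,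
          OF y(2) x(2) y(3) x(3)]
      by (rule trans[OF _ sym])
  qed
  moreover have "pure_tensor K BD AD b a \<in> carrier (tensor_space K BD AD)"
    if "\<alpha> \<in> carrier \<Gamma>D" "\<beta> \<in> carrier \<Delta>D" "a \<in> tgwa_grading K D \<alpha>" "b \<in> tgwa_grading K D' \<beta>" for \<alpha> \<beta> a b
    using pure_tensor_in[OF moduleBD moduleAD] grading_carrier[OF gradedAD(3)] grading_carrier[OF gradedBD(3)] that by blast
  ultimately show "?hom tau" using tau0(2) by simp
qed

lemma tgwa_twisting_map_exists: "\<exists>tau. is_tgwa_twisting_map K D D' q tau"
proof -
  from bicharacter_flip_exists[OF gradedAD(3) gradedBD(3) Q_in]
  obtain tau where "tau \<in> linear_maps K (tensor_space K BD AD) TD"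
    "\<forall>\<alpha>\<in>carrier \<Gamma>D. \<forall>\<beta>\<in>carrier \<Delta>D. \<forall>a\<in>tgwa_grading K D \<alpha>. \<forall>b\<in>tgwa_grading K D' \<beta>.
      tau (pure_tensor K BD AD b a) = QD \<beta> \<alpha> \<odot>\<^bsub>TD\<^esub> pure_tensor K AD BD a b"
    by (rule bexE)
  then have "is_tgwa_twisting_map K D D' q tau" by (simp only: tgwa_twisting_map_iff)
  then show ?thesis by (rule exI[of _ tau])
qed

text \<open>A tensor of two monomials is a product of elements on which \<open>chi\<close> is prescribed, and \<open>chi\<close> is
  multiplicative.\<close>

lemma tgwa_chi_monomial:
  assumes chi: "is_tgwa_chi K D D' q chi" and \<alpha>: "\<alpha> \<in> carrier \<Gamma>D" and \<beta>: "\<beta> \<in> carrier \<Delta>D"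
    and r: "r \<in> carrier (tgw_base D)" and us: "us \<in> lists (signed_indices (tgw_rank D))"
    and s: "s \<in> carrier (tgw_base D')" and vs: "vs \<in> lists (signed_indices (tgw_rank D'))"
  defines "a \<equiv> tgwa_coeff K D r \<otimes>\<^bsub>AD\<^esub> tgwa_X_word K D us"
    and "b \<equiv> tgwa_coeff K D' s \<otimes>\<^bsub>BD\<^esub> tgwa_X_word K D' vs"
  shows "chi (\<alpha>, \<beta>) (pure_tensor K AD BD a b) =
    QD (signed_degree (tgw_rank D') vs) \<alpha> \<odot>\<^bsub>ED\<^esub> pure_tensor K AD BD a b"
proof -
  let ?p = "pure_tensor K AD BD" and ?f = "chi (\<alpha>, \<beta>)"
  note c = chi[unfolded is_tgwa_chi_def Let_def, rule_format, OF \<alpha> \<beta>]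
  have ss: "same_space TD ED" by (rule tensor_algebra_same_space)
  have P: "?p x y \<in> carrier ED" if "x \<in> carrier AD" "y \<in> carrier BD" for x y
    using pure_tensor_in[OF moduleAD moduleBD that] ss by (simp add: same_space_def)
  note pm = tensor_algebra_mult(2)[OF gradedAD(1) gradedBD(1)]
  have fm: "?f (x \<otimes>\<^bsub>ED\<^esub> y) = ?f x \<otimes>\<^bsub>ED\<^esub> ?f y" if "x \<in> carrier ED" "y \<in> carrier ED" for x y
    using c that by (auto simp: alg_iso_def ring_iso_def ring_hom_def)
  have f1: "?f \<one>\<^bsub>ED\<^esub> = \<one>\<^bsub>ED\<^esub>" using c by (auto simp: alg_iso_def ring_iso_def ring_hom_def)
  have X: "?f (?p (tgwa_X_word K D us) \<one>\<^bsub>BD\<^esub>) = ?p (tgwa_X_word K D us) \<one>\<^bsub>BD\<^esub>"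
    using us
  proof (induction us)
    case Nil
    then show ?case using f1 by (simp add: D.tgwa_X_word_Nil tensor_algebra_one)
  next
    case (Cons u us)
    note i = D.tgwa_X_in[OF Cons.hyps(1)] D.tgwa_X_word_in[OF Cons.hyps(2)] BD.one_closed
    have eq: "?p (tgwa_X_word K D (u # us)) \<one>\<^bsub>BD\<^esub> = ?p (tgwa_X K D u) \<one>\<^bsub>BD\<^esub> \<otimes>\<^bsub>ED\<^esub> ?p (tgwa_X_word K D us) \<one>\<^bsub>BD\<^esub>"
      using i by (simp add: D.tgwa_X_word_Cons pm)
    show ?case unfolding eq using c Cons i fm[OF P P] by auto
  qed
  have Y: "?f (?p \<one>\<^bsub>AD\<^esub> (tgwa_X_word K D' vs)) =
      QD (signed_degree (tgw_rank D') vs) \<alpha> \<odot>\<^bsub>ED\<^esub> ?p \<one>\<^bsub>AD\<^esub> (tgwa_X_word K D' vs)"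
    using vs
  proof (induction vs)
    case Nil
    have "QD \<one>\<^bsub>\<Delta>D\<^esub> \<alpha> = \<one>\<^bsub>K\<^esub>"
      by (rule lattice_pairing_one_left[of K "tgw_rank D'" "tgw_rank D" q, OF fieldK q])
    then show ?case using f1 by (simp add: D'.tgwa_X_word_Nil tensor_algebra_one[symmetric] signed_degree_Nil)
  next
    case (Cons v vs)
    note i = D'.tgwa_X_in[OF Cons.hyps(1)] D'.tgwa_X_word_in[OF Cons.hyps(2)] AD.one_closed
    have eq: "?p \<one>\<^bsub>AD\<^esub> (tgwa_X_word K D' (v # vs)) = ?p \<one>\<^bsub>AD\<^esub> (tgwa_X K D' v) \<otimes>\<^bsub>ED\<^esub> ?p \<one>\<^bsub>AD\<^esub> (tgwa_X_word K D' vs)"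
      using i by (simp add: D'.tgwa_X_word_Cons pm)
    have v: "?f (?p \<one>\<^bsub>AD\<^esub> (tgwa_X K D' v)) = QD (signed_degree (tgw_rank D') [v]) \<alpha> \<odot>\<^bsub>ED\<^esub> ?p \<one>\<^bsub>AD\<^esub> (tgwa_X K D' v)"
      using Cons.hyps(1)
    proof (cases rule: signed_index_cases)
      case (1 i)
      then show ?thesis
        using c lattice_pairing_single_left(1)[of K "tgw_rank D'" "tgw_rank D" q, OF fieldK q 1(1)] by simp
    next
      case (2 i)
      then show ?thesis
        using c lattice_pairing_single_left(2)[of K "tgw_rank D'" "tgw_rank D" q, OF fieldK q 2(1)] by simp
    qed
    have "QD (signed_degree (tgw_rank D') (v # vs)) \<alpha> =
        QD (signed_degree (tgw_rank D') [v]) \<alpha> \<otimes>\<^bsub>K\<^esub> QD (signed_degree (tgw_rank D') vs) \<alpha>"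
      using Q_bi signed_degree_append[of "tgw_rank D'" "[v]" vs] \<alpha> signed_degree_carrier
      by (simp add: bicharacter_def)
    then show ?case
      unfolding eq fm[OF P[OF i(3,1)] P[OF i(3,2)]] v Cons.IH
      using P[OF i(3,1)] P[OF i(3,2)] Q_in
      by (simp add: ED.smult_mult_left ED.smult_mult_right ED.smult_assoc1[symmetric] D.K.m_comm)
  qed
  note i = D.tgwa_coeff_in[OF r] D'.tgwa_coeff_in[OF s] D.tgwa_X_word_in[OF us] D'.tgwa_X_word_in[OF vs]
  let ?Z = "?p (tgwa_X_word K D us) \<one>\<^bsub>BD\<^esub>" and ?W = "?p \<one>\<^bsub>AD\<^esub> (tgwa_X_word K D' vs)"
    and ?C = "?p (tgwa_coeff K D r) (tgwa_coeff K D' s)"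
  have e: "?C \<in> carrier ED" "?Z \<in> carrier ED" "?W \<in> carrier ED" using P i by auto
  have ab: "?p a b = ?C \<otimes>\<^bsub>ED\<^esub> (?Z \<otimes>\<^bsub>ED\<^esub> ?W)"
    using i by (simp add: a_def b_def pm)
  have "?f ?C = ?C" using c r s by blast
  then have "?f (?p a b) = ?C \<otimes>\<^bsub>ED\<^esub> (?Z \<otimes>\<^bsub>ED\<^esub> (QD (signed_degree (tgw_rank D') vs) \<alpha> \<odot>\<^bsub>ED\<^esub> ?W))"
    using X Y e by (simp add: ab fm)
  also have "\<dots> = QD (signed_degree (tgw_rank D') vs) \<alpha> \<odot>\<^bsub>ED\<^esub> (?C \<otimes>\<^bsub>ED\<^esub> (?Z \<otimes>\<^bsub>ED\<^esub> ?W))"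
    using e Q_in by (simp add: ED.smult_mult_right)
  finally show ?thesis using ab by simp
qed

text \<open>As for the twisting map: the values on generators determine the automorphism on monomials, which
  span, so it must be the automorphism constructed from the bicharacter.\<close>

lemma tgwa_chi_iff:
  "is_tgwa_chi K D D' q chi \<longleftrightarrow> (\<forall>\<alpha>\<in>carrier \<Gamma>D. \<forall>\<beta>\<in>carrier \<Delta>D. chi (\<alpha>, \<beta>) \<in> alg_iso K ED ED \<and>
    (\<forall>\<alpha>'\<in>carrier \<Gamma>D. \<forall>\<beta>'\<in>carrier \<Delta>D. \<forall>a\<in>tgwa_grading K D \<alpha>'. \<forall>b\<in>tgwa_grading K D' \<beta>'.
      chi (\<alpha>, \<beta>) (pure_tensor K AD BD a b) = QD \<beta>' \<alpha> \<odot>\<^bsub>ED\<^esub> pure_tensor K AD BD a b))"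
    (is "_ \<longleftrightarrow> (\<forall>\<alpha>\<in>carrier \<Gamma>D. \<forall>\<beta>\<in>carrier \<Delta>D. _ \<and> ?hom \<alpha> (chi (\<alpha>, \<beta>)))")
proof (intro iffI ballI conjI)
  fix \<alpha> \<beta> assume chi: "is_tgwa_chi K D D' q chi" and \<alpha>: "\<alpha> \<in> carrier \<Gamma>D" and \<beta>: "\<beta> \<in> carrier \<Delta>D"
  show iso: "chi (\<alpha>, \<beta>) \<in> alg_iso K ED ED"
    using chi \<alpha> \<beta> by (auto simp: is_tgwa_chi_def Let_def)
  have ss: "same_space TD ED" by (rule tensor_algebra_same_space)
  \<comment> \<open>The automorphism that does act by the bicharacter; the given one agrees with it on monomials.\<close>
  obtain f where f: "f \<in> alg_iso K ED ED" "?hom \<alpha> f"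
    using bicharacter_automorphism_exists[OF D.tgwa_graded D'.tgwa_graded Q_bi \<alpha>] by blast
  have lin: "chi (\<alpha>, \<beta>) \<in> linear_maps K TD TD" "f \<in> linear_maps K TD TD"
    using iso f(1) by (auto simp: alg_iso_def linear_maps_same_space[OF ss ss])
  have eq: "chi (\<alpha>, \<beta>) x = f x" if x: "x \<in> carrier TD" for x
  proof (rule tensor_ext[OF moduleAD moduleBD tensor_space_module[OF moduleAD moduleBD] lin
        D.tgwa_monomial_span D'.tgwa_monomial_span _ x])
    fix a b
    assume "a \<in> {tgwa_coeff K D r \<otimes>\<^bsub>AD\<^esub> tgwa_X_word K D us | r us.
        r \<in> carrier (tgw_base D) \<and> us \<in> lists (signed_indices (tgw_rank D))}"
    then obtain r us where a: "a = tgwa_coeff K D r \<otimes>\<^bsub>AD\<^esub> tgwa_X_word K D us"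
      "r \<in> carrier (tgw_base D)" "us \<in> lists (signed_indices (tgw_rank D))" by blast
    assume "b \<in> {tgwa_coeff K D' r \<otimes>\<^bsub>BD\<^esub> tgwa_X_word K D' us | r us.
        r \<in> carrier (tgw_base D') \<and> us \<in> lists (signed_indices (tgw_rank D'))}"
    then obtain s vs where b: "b = tgwa_coeff K D' s \<otimes>\<^bsub>BD\<^esub> tgwa_X_word K D' vs"
      "s \<in> carrier (tgw_base D')" "vs \<in> lists (signed_indices (tgw_rank D'))" by blast
    have "f (pure_tensor K AD BD a b) = QD (signed_degree (tgw_rank D') vs) \<alpha> \<odot>\<^bsub>ED\<^esub> pure_tensor K AD BD a b"
      using f(2) D.tgwa_monomial_homogeneous[OF a(2,3)] D'.tgwa_monomial_homogeneous[OF b(2,3)]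
        signed_degree_carrier unfolding a(1) b(1) by blast
    then show "chi (\<alpha>, \<beta>) (pure_tensor K AD BD a b) = f (pure_tensor K AD BD a b)"
      using tgwa_chi_monomial[OF chi \<alpha> \<beta> a(2,3) b(2,3)] by (simp add: a(1) b(1))
  qed
  fix \<alpha>' \<beta>' a b
  assume "\<alpha>' \<in> carrier \<Gamma>D" "\<beta>' \<in> carrier \<Delta>D" "a \<in> tgwa_grading K D \<alpha>'" "b \<in> tgwa_grading K D' \<beta>'"
  moreover from this have "pure_tensor K AD BD a b \<in> carrier TD"
    using pure_tensor_in[OF moduleAD moduleBD] grading_carrier[OF gradedAD(3)] grading_carrier[OF gradedBD(3)] by blast
  ultimately show "chi (\<alpha>, \<beta>) (pure_tensor K AD BD a b) = QD \<beta>' \<alpha> \<odot>\<^bsub>ED\<^esub> pure_tensor K AD BD a b"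
    using eq f(2) by simp
next
  assume hom: "\<forall>\<alpha>\<in>carrier \<Gamma>D. \<forall>\<beta>\<in>carrier \<Delta>D. chi (\<alpha>, \<beta>) \<in> alg_iso K ED ED \<and> ?hom \<alpha> (chi (\<alpha>, \<beta>))"
  show "is_tgwa_chi K D D' q chi"
    unfolding is_tgwa_chi_def Let_def
  proof (intro ballI)
    fix \<alpha> \<beta> assume \<alpha>: "\<alpha> \<in> carrier \<Gamma>D" and \<beta>: "\<beta> \<in> carrier \<Delta>D"
    have iso: "chi (\<alpha>, \<beta>) \<in> alg_iso K ED ED" using hom \<alpha> \<beta> by blast
    have h: "chi (\<alpha>, \<beta>) (pure_tensor K AD BD a b) = QD \<beta>' \<alpha> \<odot>\<^bsub>ED\<^esub> pure_tensor K AD BD a b"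
      if "\<alpha>' \<in> carrier \<Gamma>D" "\<beta>' \<in> carrier \<Delta>D" "a \<in> tgwa_grading K D \<alpha>'" "b \<in> tgwa_grading K D' \<beta>'" for \<alpha>' \<beta>' a b
      using hom \<alpha> \<beta> that by blast
    have ss: "same_space TD ED" by (rule tensor_algebra_same_space)
    have P: "pure_tensor K AD BD x y \<in> carrier ED" if "x \<in> carrier AD" "y \<in> carrier BD" for x y
      using pure_tensor_in[OF moduleAD moduleBD that] ss by (simp add: same_space_def)
    have one: "\<one>\<^bsub>\<Gamma>D\<^esub> \<in> carrier \<Gamma>D" "\<one>\<^bsub>\<Delta>D\<^esub> \<in> carrier \<Delta>D"
      using signed_degree_carrier signed_degree_Nil by metis+
    have Q1: "QD \<one>\<^bsub>\<Delta>D\<^esub> \<alpha> = \<one>\<^bsub>K\<^esub>"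
      by (rule lattice_pairing_one_left[of K "tgw_rank D'" "tgw_rank D" q, OF fieldK q])
    have sing: "int i \<in> signed_indices (tgw_rank D')" "- int i \<in> signed_indices (tgw_rank D')"
      if "i \<in> {1..tgw_rank D'}" for i
      using that by (auto simp: signed_indices_def)
    show "chi (\<alpha>, \<beta>) \<in> alg_iso K ED ED \<and>
      (\<forall>r\<in>carrier (tgw_base D). \<forall>s\<in>carrier (tgw_base D').
         chi (\<alpha>, \<beta>) (pure_tensor K AD BD (tgwa_coeff K D r) (tgwa_coeff K D' s)) =
           pure_tensor K AD BD (tgwa_coeff K D r) (tgwa_coeff K D' s)) \<and>
      (\<forall>u\<in>signed_indices (tgw_rank D).
         chi (\<alpha>, \<beta>) (pure_tensor K AD BD (tgwa_X K D u) \<one>\<^bsub>BD\<^esub>) =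
           pure_tensor K AD BD (tgwa_X K D u) \<one>\<^bsub>BD\<^esub>) \<and>
      (\<forall>i\<in>{1..tgw_rank D'}.
         chi (\<alpha>, \<beta>) (pure_tensor K AD BD \<one>\<^bsub>AD\<^esub> (tgwa_X K D' (int i))) =
           (\<Otimes>\<^bsub>K\<^esub>j\<in>{1..tgw_rank D}. q i j [^]\<^bsub>K\<^esub> \<alpha> j) \<odot>\<^bsub>ED\<^esub>
             pure_tensor K AD BD \<one>\<^bsub>AD\<^esub> (tgwa_X K D' (int i)) \<and>
         chi (\<alpha>, \<beta>) (pure_tensor K AD BD \<one>\<^bsub>AD\<^esub> (tgwa_X K D' (- int i))) =
           (\<Otimes>\<^bsub>K\<^esub>j\<in>{1..tgw_rank D}. (inv\<^bsub>K\<^esub> (q i j)) [^]\<^bsub>K\<^esub> \<alpha> j) \<odot>\<^bsub>ED\<^esub>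
             pure_tensor K AD BD \<one>\<^bsub>AD\<^esub> (tgwa_X K D' (- int i)))"
    proof (intro conjI ballI)
      fix r s assume r: "r \<in> carrier (tgw_base D)" and s: "s \<in> carrier (tgw_base D')"
      show "chi (\<alpha>, \<beta>) (pure_tensor K AD BD (tgwa_coeff K D r) (tgwa_coeff K D' s)) =
           pure_tensor K AD BD (tgwa_coeff K D r) (tgwa_coeff K D' s)"
        using h[OF one D.tgwa_coeff_homogeneous[OF r] D'.tgwa_coeff_homogeneous[OF s]]
          P[OF D.tgwa_coeff_in[OF r] D'.tgwa_coeff_in[OF s]] Q1 by simp
    next
      fix u assume u: "u \<in> signed_indices (tgw_rank D)"
      show "chi (\<alpha>, \<beta>) (pure_tensor K AD BD (tgwa_X K D u) \<one>\<^bsub>BD\<^esub>) = pure_tensor K AD BD (tgwa_X K D u) \<one>\<^bsub>BD\<^esub>"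
        using h[OF signed_degree_carrier one(2) D.tgwa_X_homogeneous[OF u] gradedBD(4)]
          P[OF D.tgwa_X_in[OF u] BD.one_closed] Q1 by simp
    next
      fix i assume i: "i \<in> {1..tgw_rank D'}"
      have single:
        "QD (signed_degree (tgw_rank D') [int i]) \<alpha> = (\<Otimes>\<^bsub>K\<^esub>j\<in>{1..tgw_rank D}. q i j [^]\<^bsub>K\<^esub> \<alpha> j)"
        "QD (signed_degree (tgw_rank D') [- int i]) \<alpha> = (\<Otimes>\<^bsub>K\<^esub>j\<in>{1..tgw_rank D}. (inv\<^bsub>K\<^esub> (q i j)) [^]\<^bsub>K\<^esub> \<alpha> j)"
        using lattice_pairing_single_left[of K "tgw_rank D'" "tgw_rank D" q, OF fieldK q] i by simp_all
      show "chi (\<alpha>, \<beta>) (pure_tensor K AD BD \<one>\<^bsub>AD\<^esub> (tgwa_X K D' (int i))) =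
           (\<Otimes>\<^bsub>K\<^esub>j\<in>{1..tgw_rank D}. q i j [^]\<^bsub>K\<^esub> \<alpha> j) \<odot>\<^bsub>ED\<^esub>
             pure_tensor K AD BD \<one>\<^bsub>AD\<^esub> (tgwa_X K D' (int i))"
        using h[OF one(1) signed_degree_carrier gradedAD(4) D'.tgwa_X_homogeneous[OF sing(1)[OF i]]] single(1) by simp
      show "chi (\<alpha>, \<beta>) (pure_tensor K AD BD \<one>\<^bsub>AD\<^esub> (tgwa_X K D' (- int i))) =
           (\<Otimes>\<^bsub>K\<^esub>j\<in>{1..tgw_rank D}. (inv\<^bsub>K\<^esub> (q i j)) [^]\<^bsub>K\<^esub> \<alpha> j) \<odot>\<^bsub>ED\<^esub>
             pure_tensor K AD BD \<one>\<^bsub>AD\<^esub> (tgwa_X K D' (- int i))"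
        using h[OF one(1) signed_degree_carrier gradedAD(4) D'.tgwa_X_homogeneous[OF sing(2)[OF i]]] single(2) by simp
    qed (rule iso)
  qed
qed

lemma tgwa_chi_exists: "\<exists>chi. is_tgwa_chi K D D' q chi"
proof -
  have "\<forall>\<alpha>\<in>carrier \<Gamma>D. \<exists>f. f \<in> alg_iso K ED ED \<and> (\<forall>\<alpha>'\<in>carrier \<Gamma>D. \<forall>\<beta>'\<in>carrier \<Delta>D.
      \<forall>a\<in>tgwa_grading K D \<alpha>'. \<forall>b\<in>tgwa_grading K D' \<beta>'.
      f (pure_tensor K AD BD a b) = QD \<beta>' \<alpha> \<odot>\<^bsub>ED\<^esub> pure_tensor K AD BD a b)"
  proof
    fix \<alpha> assume "\<alpha> \<in> carrier \<Gamma>D"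
    from bicharacter_automorphism_exists[OF D.tgwa_graded D'.tgwa_graded Q_bi this]
    show "\<exists>f. f \<in> alg_iso K ED ED \<and> (\<forall>\<alpha>'\<in>carrier \<Gamma>D. \<forall>\<beta>'\<in>carrier \<Delta>D.
      \<forall>a\<in>tgwa_grading K D \<alpha>'. \<forall>b\<in>tgwa_grading K D' \<beta>'.
      f (pure_tensor K AD BD a b) = QD \<beta>' \<alpha> \<odot>\<^bsub>ED\<^esub> pure_tensor K AD BD a b)"
      unfolding Bex_def .
  qed
  from bchoice[OF this] obtain c where c:
    "\<forall>\<alpha>\<in>carrier \<Gamma>D. c \<alpha> \<in> alg_iso K ED ED \<and> (\<forall>\<alpha>'\<in>carrier \<Gamma>D. \<forall>\<beta>'\<in>carrier \<Delta>D.
      \<forall>a\<in>tgwa_grading K D \<alpha>'. \<forall>b\<in>tgwa_grading K D' \<beta>'.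
      c \<alpha> (pure_tensor K AD BD a b) = QD \<beta>' \<alpha> \<odot>\<^bsub>ED\<^esub> pure_tensor K AD BD a b)" by (rule exE)
  have "is_tgwa_chi K D D' q (\<lambda>(\<alpha>, \<beta>). c \<alpha>)"
    unfolding tgwa_chi_iff prod.case
  proof (intro ballI, goal_cases)
    case (1 \<alpha> \<beta>)
    from bspec[OF c 1(1)] show ?case .
  qed
  then show ?thesis by (rule exI[of _ "\<lambda>(\<alpha>, \<beta>). c \<alpha>"])
qed

lemma tgwa_twist_iso:
  assumes tau: "is_tgwa_twisting_map K D D' q tau" and chi: "is_tgwa_chi K D D' q chi"
  defines "gr \<equiv> tensor_grading K AD BD (tgwa_grading K D) (tgwa_grading K D')"
  shows "twisting_system K (\<Gamma>D \<times>\<times> \<Delta>D) ED gr chi"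
    and "k_algebra K (graded_twist (\<Gamma>D \<times>\<times> \<Delta>D) ED gr chi)"
    and "k_algebra K (twisted_tensor_algebra K AD BD tau)"
    and "(\<lambda>x. x) \<in> alg_iso K (graded_twist (\<Gamma>D \<times>\<times> \<Delta>D) ED gr chi) (twisted_tensor_algebra K AD BD tau)"
proof -
  have tl: "tau \<in> linear_maps K (tensor_space K BD AD) TD"
    using tau by (simp add: is_tgwa_twisting_map_def Let_def)
  note th = tau[unfolded tgwa_twisting_map_iff[OF tl], rule_format]
  note ch = chi[unfolded tgwa_chi_iff, rule_format]
  note W = D.tgwa_graded D'.tgwa_graded Q_bi tl th conjunct1[OF ch] conjunct2[OF ch, rule_format]
  show "twisting_system K (\<Gamma>D \<times>\<times> \<Delta>D) ED gr chi"
    unfolding gr_def by (rule bicharacter_twisting_system[OF W])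
  show "k_algebra K (graded_twist (\<Gamma>D \<times>\<times> \<Delta>D) ED gr chi)"
    "k_algebra K (twisted_tensor_algebra K AD BD tau)"
    "(\<lambda>x. x) \<in> alg_iso K (graded_twist (\<Gamma>D \<times>\<times> \<Delta>D) ED gr chi) (twisted_tensor_algebra K AD BD tau)"
    unfolding gr_def by (rule graded_twist_iso_twisted_tensor[OF W]; assumption)+
qed

end

theorem proposition4p10:
  fixes K :: "('k, 'x) ring_scheme"
    and D :: "('k, 'r) tgw_data"
    and D' :: "('k, 's) tgw_data"
    and q :: "nat \<Rightarrow> nat \<Rightarrow> 'k"
  assumes "field K"
    and "tgw_datum K D" and "tgw_regular D" and "tgw_consistent K D"
    and "tgw_datum K D'" and "tgw_regular D'" and "tgw_consistent K D'"
    and "\<And>i j. i \<in> {1..tgw_rank D'} \<Longrightarrow> j \<in> {1..tgw_rank D} \<Longrightarrow> q i j \<in> Units K"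
  defines "A \<equiv> tgwa K D" and "B \<equiv> tgwa K D'"
  defines "E \<equiv> tensor_algebra K A B"
    and "\<Gamma> \<equiv> int_lattice (tgw_rank D) \<times>\<times> int_lattice (tgw_rank D')"
    and "gr \<equiv> tensor_grading K A B (tgwa_grading K D) (tgwa_grading K D')"
  shows "(\<exists>tau. is_tgwa_twisting_map K D D' q tau) \<and>
    (\<exists>chi. is_tgwa_chi K D D' q chi) \<and>
    (\<forall>tau chi. is_tgwa_twisting_map K D D' q tau \<longrightarrow> is_tgwa_chi K D D' q chi \<longrightarrow>
       twisting_system K \<Gamma> E gr chi \<and>
       k_algebra K (graded_twist \<Gamma> E gr chi) \<and>
       k_algebra K (twisted_tensor_algebra K A B tau) \<and>
       (\<lambda>x. x) \<in> alg_iso K (graded_twist \<Gamma> E gr chi) (twisted_tensor_algebra K A B tau))"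
proof (intro conjI allI impI)
  note H = assms(2,5,8)
  show "\<exists>tau. is_tgwa_twisting_map K D D' q tau" by (rule tgwa_twisting_map_exists[OF H])
  show "\<exists>chi. is_tgwa_chi K D D' q chi" by (rule tgwa_chi_exists[OF H])
  fix tau chi assume W: "is_tgwa_twisting_map K D D' q tau" "is_tgwa_chi K D D' q chi"
  note iso = tgwa_twist_iso[OF H W]
  show "twisting_system K \<Gamma> E gr chi" "k_algebra K (graded_twist \<Gamma> E gr chi)"
    "k_algebra K (twisted_tensor_algebra K A B tau)"
    "(\<lambda>x. x) \<in> alg_iso K (graded_twist \<Gamma> E gr chi) (twisted_tensor_algebra K A B tau)"
    unfolding \<Gamma>_def E_def gr_def A_def B_def by (rule iso; assumption)+
qed

end
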